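(* Let $T>0$, $\lambda>0$, $x_0\in\mathbb{R}$, and consider the mean variance problem $$V_0=\sup_{\alpha}\Big[\mathbb{E}[X^{\alpha}_T]-\tfrac{\lambda}{2}\mathrm{Var}(X^{\alpha}_T)\Big],\qquad X^\alpha_s=x_0+\int_0^s\alpha_r\,dr+\int_0^s\alpha_r\,dB_r .$$ Define $$\Lambda(t,\mathbf{x}_{[0,t]})=\frac{\lambda e^{T-t}}{e^T-\lambda(\mathbf{x}_t-\mathbf{x}_0)}\qquad\text{for } \mathbf{x}\in C([0,T],\mathbb{R})\ \text{ with } \sup_{0\le t\le T}[\mathbf{x}_t-\mathbf{x}_0]<\tfrac1\lambda e^T .$$ Then the dynamic mean variance problem $$V_t=\operatorname*{ess\,sup}_{\alpha}\Big\{\mathbb{E}[X^\alpha_T|\mathcal{F}_t]-\tfrac12\Lambda(t,X^*_{[0,t]})\,\mathrm{Var}(X^\alpha_T|\mathcal{F}_t)\Big\}$$ is time consistent. Here $X^*$ is the optimal trajectory for the problem $V_0$, and it satisfies $\sup_{0\le t\le T}[X^*_t-x_0]<\frac1\lambda e^T$ a.s. Moreover, the optimal control and the optimal value are $$\alpha^*_t=-X^*_t+x_0+\tfrac1\lambda e^T,\qquad V_t=\tfrac12(1+e^{t-T})X^*_t+\tfrac12(1-e^{t-T})x_0+\tfrac{e^T}{2\lambda}(1-e^{t-T}).$$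
   Context: $B$ is a one-dimensional Brownian motion on $[0,T]$ (canonical space, Wiener measure $\mathbb{P}$), $\mathbb{F}=(\mathcal{F}_t)$ its augmented filtration. Controls $\alpha$ are real-valued $\mathbb{F}$-progressively measurable processes with $\mathbb{E}\int_0^T|\alpha_t|^2dt<\infty$. $\mathrm{Var}(\xi|\mathcal{F}_t)=\mathbb{E}[\xi^2|\mathcal{F}_t]-(\mathbb{E}[\xi|\mathcal{F}_t])^2$. $\alpha^*$ is an optimal control for $V_0$ and $X^*=X^{\alpha^*}$. In the dynamic problem at time $t$, the state starts at time $t$ from $X^*_t$, i.e. the essential supremum is over controls $\alpha$ that agree with $\alpha^*$ on $[0,t]$. The dynamic problem is called time consistent if, for every $t\in[0,T]$, the restriction $\alpha^*_{[t,T]}$ of the optimal control of the time-$0$ problem (note $\Lambda(0,x_0)=\lambda$) remains optimal for the problem $V_t$ at time $t$. *)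

theory Defs
  imports "HOL-Probability.Probability"
begin

section \<open>Brownian motion and its augmented filtration\<close>

definition natural_filtration :: "'a measure \<Rightarrow> (real \<Rightarrow> 'a \<Rightarrow> real) \<Rightarrow> real \<Rightarrow> 'a measure" where
  "natural_filtration M B t =
     sigma (space M) (\<Union>s\<in>{0..t}. {B s -` A \<inter> space M | A. A \<in> sets borel})"

text \<open>Used below with a complete measure, so that all subsets of null sets are adjoined.\<close>

definition augmented_filtration :: "'a measure \<Rightarrow> (real \<Rightarrow> 'a \<Rightarrow> real) \<Rightarrow> real \<Rightarrow> 'a measure" where
  "augmented_filtration M B t =
     sigma (space M) (sets (natural_filtration M B t) \<union> null_sets M)"

definition brownian_motion :: "'a measure \<Rightarrow> real \<Rightarrow> (real \<Rightarrow> 'a \<Rightarrow> real) \<Rightarrow> bool" where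
  "brownian_motion M T B \<longleftrightarrow>
     prob_space M \<and>
     (\<forall>t\<in>{0..T}. B t \<in> borel_measurable M) \<and>
     (AE \<omega> in M. B 0 \<omega> = 0) \<and>
     (\<forall>\<omega>\<in>space M. continuous_on {0..T} (\<lambda>t. B t \<omega>)) \<and>
     (\<forall>s t. 0 \<le> s \<and> s < t \<and> t \<le> T \<longrightarrow>
        distributed M lborel (\<lambda>\<omega>. B t \<omega> - B s \<omega>) (normal_density 0 (sqrt (t - s))) \<and>
        prob_space.indep_set M (sets (natural_filtration M B s))
          (sets (vimage_algebra (space M) (\<lambda>\<omega>. B t \<omega> - B s \<omega>) borel)))"

text \<open>
  The canonical space: continuous paths on \<open>[0,T]\<close> starting at \<open>0\<close> (represented as
  functions that are \<open>undefined\<close> outside \<open>[0,T]\<close>) with the sigma-algebra generated by the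
  coordinates.  Wiener measure is the law under which the coordinate process is a
  Brownian motion; it is taken completed.
\<close>

definition path_space :: "real \<Rightarrow> (real \<Rightarrow> real) measure" where
  "path_space T =
     restrict_space (PiM {0..T} (\<lambda>_. borel)) {\<omega>. continuous_on {0..T} \<omega> \<and> \<omega> 0 = 0}"

definition coord :: "real \<Rightarrow> (real \<Rightarrow> real) \<Rightarrow> real" where
  "coord t \<omega> = \<omega> t"

definition wiener_measure :: "real \<Rightarrow> (real \<Rightarrow> real) measure \<Rightarrow> bool" where
  "wiener_measure T P \<longleftrightarrow>
     (\<exists>W. sets W = sets (path_space T) \<and> brownian_motion W T coord \<and> P = completion W)"

section \<open>Controls and the Ito integral\<close>

definition progressively_measurable ::
  "'a measure \<Rightarrow> (real \<Rightarrow> 'a measure) \<Rightarrow> real \<Rightarrow> (real \<Rightarrow> 'a \<Rightarrow> real) \<Rightarrow> bool" where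
  "progressively_measurable M F T \<alpha> \<longleftrightarrow>
     (\<forall>t\<in>{0..T}. (\<lambda>(s, \<omega>). \<alpha> s \<omega>) \<in> borel_measurable (restrict_space borel {0..t} \<Otimes>\<^sub>M F t))"

definition controls ::
  "'a measure \<Rightarrow> (real \<Rightarrow> 'a measure) \<Rightarrow> real \<Rightarrow> (real \<Rightarrow> 'a \<Rightarrow> real) set" where
  "controls M F T =
     {\<alpha>. progressively_measurable M F T \<alpha> \<and>
         (\<integral>\<^sup>+\<omega>. (\<integral>\<^sup>+s\<in>{0..T}. ennreal ((\<alpha> s \<omega>)\<^sup>2) \<partial>lborel) \<partial>M) < \<infinity>}"

text \<open>
  A simple integrand is given by a number \<open>n\<close> of intervals, a partition
  \<open>0 \<le> \<tau> 0 \<le> \<dots> \<le> \<tau> n \<le> T\<close> and bounded \<open>F (\<tau> i)\<close>-measurable values \<open>\<xi> i\<close> on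
  \<open>(\<tau> i, \<tau> (i + 1)]\<close>.
\<close>

definition simple_integrand ::
  "'a measure \<Rightarrow> (real \<Rightarrow> 'a measure) \<Rightarrow> real \<Rightarrow> nat \<Rightarrow> (nat \<Rightarrow> real) \<Rightarrow> (nat \<Rightarrow> 'a \<Rightarrow> real) \<Rightarrow> bool" where
  "simple_integrand M F T n \<tau> \<xi> \<longleftrightarrow>
     0 \<le> \<tau> 0 \<and> (\<forall>i<n. \<tau> i \<le> \<tau> (Suc i)) \<and> \<tau> n \<le> T \<and>
     (\<forall>i<n. \<xi> i \<in> borel_measurable (F (\<tau> i)) \<and> (\<exists>C. \<forall>\<omega>\<in>space M. \<bar>\<xi> i \<omega>\<bar> \<le> C))"

definition simple_process ::
  "nat \<Rightarrow> (nat \<Rightarrow> real) \<Rightarrow> (nat \<Rightarrow> 'a \<Rightarrow> real) \<Rightarrow> real \<Rightarrow> 'a \<Rightarrow> real" where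
  "simple_process n \<tau> \<xi> r \<omega> = (\<Sum>i<n. \<xi> i \<omega> * indicator {\<tau> i<..\<tau> (Suc i)} r)"

definition simple_integral ::
  "(real \<Rightarrow> 'a \<Rightarrow> real) \<Rightarrow> nat \<Rightarrow> (nat \<Rightarrow> real) \<Rightarrow> (nat \<Rightarrow> 'a \<Rightarrow> real) \<Rightarrow> real \<Rightarrow> 'a \<Rightarrow> real" where
  "simple_integral B n \<tau> \<xi> s \<omega> =
     (\<Sum>i<n. \<xi> i \<omega> * (B (min (\<tau> (Suc i)) s) \<omega> - B (min (\<tau> i) s) \<omega>))"

text \<open>
  \<open>I\<close> is (a version of) the integral of \<open>\<alpha>\<close> against \<open>B\<close> over \<open>[0,s]\<close>: the \<open>L\<^sup>2\<close>-limit of the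
  integrals of simple integrands converging to \<open>\<alpha>\<close> in \<open>L\<^sup>2([0,s] \<times> M)\<close>.
\<close>

definition is_ito_integral ::
  "'a measure \<Rightarrow> (real \<Rightarrow> 'a measure) \<Rightarrow> real \<Rightarrow> (real \<Rightarrow> 'a \<Rightarrow> real) \<Rightarrow>
   (real \<Rightarrow> 'a \<Rightarrow> real) \<Rightarrow> real \<Rightarrow> ('a \<Rightarrow> real) \<Rightarrow> bool" where
  "is_ito_integral M F T B \<alpha> s I \<longleftrightarrow>
     I \<in> borel_measurable M \<and>
     (\<exists>n \<tau> \<xi>.
        (\<forall>k. simple_integrand M F T (n k) (\<tau> k) (\<xi> k)) \<and>
        ((\<lambda>k::nat. \<integral>\<^sup>+\<omega>. (\<integral>\<^sup>+r\<in>{0..s}.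
             ennreal ((simple_process (n k) (\<tau> k) (\<xi> k) r \<omega> - \<alpha> r \<omega>)\<^sup>2) \<partial>lborel) \<partial>M)
           \<longlonglongrightarrow> 0) \<and>
        ((\<lambda>k::nat. \<integral>\<^sup>+\<omega>.
             ennreal ((simple_integral B (n k) (\<tau> k) (\<xi> k) s \<omega> - I \<omega>)\<^sup>2) \<partial>M)
           \<longlonglongrightarrow> 0))"

definition ito_integral ::
  "'a measure \<Rightarrow> (real \<Rightarrow> 'a measure) \<Rightarrow> real \<Rightarrow> (real \<Rightarrow> 'a \<Rightarrow> real) \<Rightarrow>
   (real \<Rightarrow> 'a \<Rightarrow> real) \<Rightarrow> real \<Rightarrow> 'a \<Rightarrow> real" where
  "ito_integral M F T B \<alpha> s = (SOME I. is_ito_integral M F T B \<alpha> s I)"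

section \<open>Conditional variance and essential suprema of families\<close>

definition cond_var :: "'a measure \<Rightarrow> 'a measure \<Rightarrow> ('a \<Rightarrow> real) \<Rightarrow> 'a \<Rightarrow> real" where
  "cond_var M G \<xi> \<omega> =
     real_cond_exp M G (\<lambda>\<omega>. (\<xi> \<omega>)\<^sup>2) \<omega> - (real_cond_exp M G \<xi> \<omega>)\<^sup>2"

text \<open>
  Unlike \<^const>\<open>esssup\<close>, which is the essential supremum of one function, this is the
  almost surely least random variable dominating almost surely each member of a family.
\<close>

definition is_ess_sup :: "'a measure \<Rightarrow> ('a \<Rightarrow> real) set \<Rightarrow> ('a \<Rightarrow> real) \<Rightarrow> bool" where
  "is_ess_sup M \<Xi> V \<longleftrightarrow>
     V \<in> borel_measurable M \<and>
     (\<forall>\<xi>\<in>\<Xi>. AE \<omega> in M. \<xi> \<omega> \<le> V \<omega>) \<and>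
     (\<forall>W\<in>borel_measurable M. (\<forall>\<xi>\<in>\<Xi>. AE \<omega> in M. \<xi> \<omega> \<le> W \<omega>) \<longrightarrow> (AE \<omega> in M. V \<omega> \<le> W \<omega>))"

section \<open>The mean variance problem on the canonical space\<close>

text \<open>From here on \<open>P\<close> is the (completed) Wiener measure on the paths over \<open>[0,T]\<close>.\<close>

abbreviation wiener_filtration ::
  "(real \<Rightarrow> real) measure \<Rightarrow> real \<Rightarrow> (real \<Rightarrow> real) measure" where
  "wiener_filtration P \<equiv> augmented_filtration P coord"

abbreviation mv_controls ::
  "(real \<Rightarrow> real) measure \<Rightarrow> real \<Rightarrow> (real \<Rightarrow> (real \<Rightarrow> real) \<Rightarrow> real) set" where
  "mv_controls P T \<equiv> controls P (wiener_filtration P) T"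

text \<open>
  For each fixed time \<open>s\<close> this is a random variable, determined up to null sets; the
  continuous process is singled out by \<open>trajectory\<close> below.
\<close>

definition state ::
  "(real \<Rightarrow> real) measure \<Rightarrow> real \<Rightarrow> real \<Rightarrow> (real \<Rightarrow> (real \<Rightarrow> real) \<Rightarrow> real) \<Rightarrow>
   real \<Rightarrow> (real \<Rightarrow> real) \<Rightarrow> real" where
  "state P T x0 \<alpha> s \<omega> =
     x0 + (LINT r:{0..s}|lborel. \<alpha> r \<omega>)
        + ito_integral P (wiener_filtration P) T coord \<alpha> s \<omega>"

definition trajectory ::
  "(real \<Rightarrow> real) measure \<Rightarrow> real \<Rightarrow> real \<Rightarrow> (real \<Rightarrow> (real \<Rightarrow> real) \<Rightarrow> real) \<Rightarrow>
   (real \<Rightarrow> (real \<Rightarrow> real) \<Rightarrow> real) \<Rightarrow> bool" where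
  "trajectory P T x0 \<alpha> X \<longleftrightarrow>
     (AE \<omega> in P. continuous_on {0..T} (\<lambda>t. X t \<omega>)) \<and>
     (\<forall>t\<in>{0..T}. X t \<in> borel_measurable (wiener_filtration P t) \<and>
                 (AE \<omega> in P. X t \<omega> = state P T x0 \<alpha> t \<omega>))"

definition mv_objective ::
  "(real \<Rightarrow> real) measure \<Rightarrow> real \<Rightarrow> real \<Rightarrow> real \<Rightarrow> (real \<Rightarrow> (real \<Rightarrow> real) \<Rightarrow> real) \<Rightarrow> real" where
  "mv_objective P T lam x0 \<alpha> =
     prob_space.expectation P (state P T x0 \<alpha> T)
       - lam / 2 * prob_space.variance P (state P T x0 \<alpha> T)"

definition mv_value :: "(real \<Rightarrow> real) measure \<Rightarrow> real \<Rightarrow> real \<Rightarrow> real \<Rightarrow> ereal" where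
  "mv_value P T lam x0 = (SUP \<alpha>\<in>mv_controls P T. ereal (mv_objective P T lam x0 \<alpha>))"

definition mv_optimal ::
  "(real \<Rightarrow> real) measure \<Rightarrow> real \<Rightarrow> real \<Rightarrow> real \<Rightarrow> (real \<Rightarrow> (real \<Rightarrow> real) \<Rightarrow> real) \<Rightarrow> bool" where
  "mv_optimal P T lam x0 \<alpha> \<longleftrightarrow>
     \<alpha> \<in> mv_controls P T \<and> ereal (mv_objective P T lam x0 \<alpha>) = mv_value P T lam x0"

definition Lambda :: "real \<Rightarrow> real \<Rightarrow> real \<Rightarrow> (real \<Rightarrow> real) \<Rightarrow> real" where
  "Lambda T lam t x = lam * exp (T - t) / (exp T - lam * (x t - x 0))"

text \<open>
  In the dynamic problem, \<open>as\<close> and \<open>X\<close> are the optimal control of the time-\<open>0\<close> problem and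
  its trajectory.
\<close>

definition dyn_controls ::
  "(real \<Rightarrow> real) measure \<Rightarrow> real \<Rightarrow> (real \<Rightarrow> (real \<Rightarrow> real) \<Rightarrow> real) \<Rightarrow> real \<Rightarrow>
   (real \<Rightarrow> (real \<Rightarrow> real) \<Rightarrow> real) set" where
  "dyn_controls P T as t =
     {\<alpha> \<in> mv_controls P T.
        AE (s, \<omega>) in lborel \<Otimes>\<^sub>M P. s \<in> {0..t} \<longrightarrow> \<alpha> s \<omega> = as s \<omega>}"

definition dyn_objective ::
  "(real \<Rightarrow> real) measure \<Rightarrow> real \<Rightarrow> real \<Rightarrow> real \<Rightarrow> (real \<Rightarrow> (real \<Rightarrow> real) \<Rightarrow> real) \<Rightarrow>
   real \<Rightarrow> (real \<Rightarrow> (real \<Rightarrow> real) \<Rightarrow> real) \<Rightarrow> (real \<Rightarrow> real) \<Rightarrow> real" where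
  "dyn_objective P T lam x0 X t \<alpha> \<omega> =
     real_cond_exp P (wiener_filtration P t) (state P T x0 \<alpha> T) \<omega>
       - 1 / 2 * Lambda T lam t (\<lambda>s. X s \<omega>)
           * cond_var P (wiener_filtration P t) (state P T x0 \<alpha> T) \<omega>"

definition is_dyn_value ::
  "(real \<Rightarrow> real) measure \<Rightarrow> real \<Rightarrow> real \<Rightarrow> real \<Rightarrow> (real \<Rightarrow> (real \<Rightarrow> real) \<Rightarrow> real) \<Rightarrow>
   (real \<Rightarrow> (real \<Rightarrow> real) \<Rightarrow> real) \<Rightarrow> real \<Rightarrow> ((real \<Rightarrow> real) \<Rightarrow> real) \<Rightarrow> bool" where
  "is_dyn_value P T lam x0 as X t V \<longleftrightarrow>
     is_ess_sup P (dyn_objective P T lam x0 X t ` dyn_controls P T as t) V"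

text \<open>
  An admissible control for the problem at time \<open>t\<close> attaining the essential supremum.
\<close>

definition dyn_optimal ::
  "(real \<Rightarrow> real) measure \<Rightarrow> real \<Rightarrow> real \<Rightarrow> real \<Rightarrow> (real \<Rightarrow> (real \<Rightarrow> real) \<Rightarrow> real) \<Rightarrow>
   (real \<Rightarrow> (real \<Rightarrow> real) \<Rightarrow> real) \<Rightarrow> real \<Rightarrow> (real \<Rightarrow> (real \<Rightarrow> real) \<Rightarrow> real) \<Rightarrow> bool" where
  "dyn_optimal P T lam x0 as X t \<alpha> \<longleftrightarrow>
     \<alpha> \<in> dyn_controls P T as t \<and>
     is_dyn_value P T lam x0 as X t (dyn_objective P T lam x0 X t \<alpha>)"

definition time_consistent ::
  "(real \<Rightarrow> real) measure \<Rightarrow> real \<Rightarrow> real \<Rightarrow> real \<Rightarrow> (real \<Rightarrow> (real \<Rightarrow> real) \<Rightarrow> real) \<Rightarrow>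
   (real \<Rightarrow> (real \<Rightarrow> real) \<Rightarrow> real) \<Rightarrow> bool" where
  "time_consistent P T lam x0 as X \<longleftrightarrow> (\<forall>t\<in>{0..T}. dyn_optimal P T lam x0 as X t as)"

end

theory Submission
  imports Defs
begin

text \<open>
  The argument is a duality argument. Put \<open>zeta t u = exp (- (B\<^sub>u - B\<^sub>t) - (u - t) / 2)\<close>. This is
  the density of the change of measure that gives \<open>B\<^sub>s + s\<close> zero drift, so that every admissible
  gain \<open>\<integral> \<alpha> dr + \<integral> \<alpha> dB\<close> over \<open>[t,u]\<close>, multiplied by \<open>zeta t u\<close>, has conditional mean zero
  given \<open>F t\<close> (lemma \<open>zeta_weighted_gain\<close>).

  For the problem at time \<open>0\<close> write \<open>X\<close> for the terminal state and \<open>Z = zeta 0 T\<close>. The relations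
  \<open>E Z = 1\<close>, \<open>E Z\<^sup>2 = exp T\<close> and \<open>E (Z X) = x0\<close> give
  \<open>E X - lam / 2 Var X = x0 + (exp T - 1) / (2 lam) - 1 / (2 lam) E (lam (X - E X) - (1 - Z))\<^sup>2\<close>
  (lemma \<open>mean_variance_identity\<close>). Hence the value is at most \<open>x0 + (exp T - 1) / (2 lam)\<close>, and a
  control is optimal if and only if its terminal state is \<open>x0 + (exp T - Z) / lam\<close>. The process
  \<open>exp (T - t) zeta 0 t / lam\<close> is a control that reaches this state (lemma \<open>opt_gain\<close>), with
  trajectory \<open>X\<^sup>*\<^sub>t = x0 + (exp T - exp (T - t) zeta 0 t) / lam\<close>; positivity of \<open>zeta\<close> is the bound on
  the trajectory, and the control is the asserted feedback of \<open>X\<^sup>*\<close>. Two controls with the same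
  terminal state agree almost everywhere (lemma \<open>control_unique\<close>), so all statements about an
  arbitrary optimal control reduce to this explicit one.

  At time \<open>t\<close> the same completion of the square, conditionally on \<open>F t\<close> and with \<open>zeta t T\<close> in place
  of \<open>Z\<close>, shows that with a weight \<open>q > 0\<close> no control does better than
  \<open>X\<^sup>*\<^sub>t + (exp (T - t) - 1) / (2 q)\<close> (lemma \<open>conditional_mean_variance_bound\<close>). Along the optimal
  trajectory the weight is \<open>Lambda = lam / zeta 0 t\<close>. For this weight \<open>Lambda (X - E\<^sub>t X)\<close> equals
  \<open>1 - zeta t T\<close> for the original optimal control, which therefore attains the bound: this choice
  of \<open>Lambda\<close> is what makes the problem time consistent.

  The Ito integral is the \<open>L\<^sup>2\<close>-limit of integrals of simple integrands. It exists for every control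
  because simple integrands are dense (lemma \<open>simple_dense\<close>), and all its properties that are used
  are read off from the polarized isometry (lemma \<open>ito_isometry\<close>) and from its correlations with
  fixed random variables (lemma \<open>ito_weight\<close>).
\<close>

section \<open>Square integrable functions\<close>

definition sq_integrable :: "'a measure \<Rightarrow> ('a \<Rightarrow> real) \<Rightarrow> bool" where
  "sq_integrable M f \<longleftrightarrow> f \<in> borel_measurable M \<and> integrable M (\<lambda>x. (f x)\<^sup>2)"

lemma sq_integrable_measurable[measurable_dest]: "sq_integrable M f \<Longrightarrow> f \<in> borel_measurable M"
  and sq_integrable_square: "sq_integrable M f \<Longrightarrow> integrable M (\<lambda>x. (f x)\<^sup>2)"
  by (simp_all add: sq_integrable_def)

lemma sq_integrable_mult:
  assumes "sq_integrable M f" "sq_integrable M g"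
  shows "integrable M (\<lambda>x. f x * g x)"
proof (rule Bochner_Integration.integrable_bound)
  show "integrable M (\<lambda>x. (f x)\<^sup>2 + (g x)\<^sup>2)"
    using assms by (simp add: sq_integrable_def)
  show "(\<lambda>x. f x * g x) \<in> borel_measurable M"
    using assms by (auto simp: sq_integrable_def)
  have "\<bar>f x * g x\<bar> \<le> (f x)\<^sup>2 + (g x)\<^sup>2" for x
    using sum_squares_bound[of "\<bar>f x\<bar>" "\<bar>g x\<bar>"] mult_nonneg_nonneg[of "\<bar>f x\<bar>" "\<bar>g x\<bar>"]
    unfolding abs_mult power2_abs by linarith
  then show "AE x in M. norm (f x * g x) \<le> norm ((f x)\<^sup>2 + (g x)\<^sup>2)"
    by (auto intro!: AE_I2)
qed

lemma sq_integrable_add: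
  assumes "sq_integrable M f" "sq_integrable M g"
  shows "sq_integrable M (\<lambda>x. f x + g x)"
  using assms[measurable] sq_integrable_mult[OF assms] assms[THEN sq_integrable_square]
  unfolding sq_integrable_def power2_sum mult.assoc by simp

lemma sq_integrable_cmult: "sq_integrable M f \<Longrightarrow> sq_integrable M (\<lambda>x. c * f x)"
  unfolding sq_integrable_def by (simp add: power_mult_distrib borel_measurable_times)

lemma sq_integrable_diff:
  assumes "sq_integrable M f" "sq_integrable M g"
  shows "sq_integrable M (\<lambda>x. f x - g x)"
  using sq_integrable_add[OF assms(1) sq_integrable_cmult[OF assms(2), of "-1"]] by simp

lemma sq_integrable_zero: "sq_integrable M (\<lambda>x. 0)"
  by (simp add: sq_integrable_def)

lemma sq_integrable_sum:
  "(\<And>i. i \<in> I \<Longrightarrow> sq_integrable M (f i)) \<Longrightarrow> sq_integrable M (\<lambda>x. \<Sum>i\<in>I. f i x)"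
  by (induction I rule: infinite_finite_induct) (auto intro: sq_integrable_add sq_integrable_zero)

lemma sq_integrable_cong_AE:
  assumes "sq_integrable M f" "g \<in> borel_measurable M" "AE x in M. f x = g x"
  shows "sq_integrable M g"
proof -
  have "integrable M (\<lambda>x. (g x)\<^sup>2)"
    by (rule integrable_cong_AE_imp[where g="\<lambda>x. (f x)\<^sup>2"])
      (use assms in \<open>auto simp: sq_integrable_def\<close>)
  then show ?thesis using assms by (simp add: sq_integrable_def)
qed

lemma sq_integrable_dominated:
  assumes "sq_integrable M g" "f \<in> borel_measurable M" "AE x in M. \<bar>f x\<bar> \<le> \<bar>g x\<bar>"
  shows "sq_integrable M f"
proof -
  have "integrable M (\<lambda>x. (f x)\<^sup>2)"
    by (rule Bochner_Integration.integrable_bound[where f="\<lambda>x. (g x)\<^sup>2"])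
      (use assms in \<open>auto simp: sq_integrable_def abs_le_square_iff\<close>)
  then show ?thesis using assms by (simp add: sq_integrable_def)
qed

lemma sq_integrable_bounded_mult:
  assumes "f \<in> borel_measurable M" "\<And>x. x \<in> space M \<Longrightarrow> \<bar>f x\<bar> \<le> C" and g: "sq_integrable M g"
  shows "sq_integrable M (\<lambda>x. f x * g x)"
proof (rule sq_integrable_dominated)
  show "sq_integrable M (\<lambda>x. C * g x)" by (rule sq_integrable_cmult[OF g])
  show "(\<lambda>x. f x * g x) \<in> borel_measurable M"
    using assms(1) sq_integrable_measurable[OF g] by (rule borel_measurable_times)
  show "AE x in M. \<bar>f x * g x\<bar> \<le> \<bar>C * g x\<bar>"
    unfolding abs_mult
    by (intro AE_I2 mult_right_mono order.trans[OF assms(2) abs_ge_self]) auto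
qed

lemma (in finite_measure) sq_integrable_bounded:
  assumes "f \<in> borel_measurable M" "\<And>x. x \<in> space M \<Longrightarrow> \<bar>f x\<bar> \<le> C"
  shows "sq_integrable M f"
proof -
  have "sq_integrable M (\<lambda>x. C)" by (simp add: sq_integrable_def)
  then show ?thesis
    by (rule sq_integrable_dominated) (use assms in \<open>auto intro!: AE_I2 order.trans[OF _ abs_ge_self]\<close>)
qed

lemma (in finite_measure) sq_integrable_const: "sq_integrable M (\<lambda>x. c)"
  by (simp add: sq_integrable_def)

lemma (in finite_measure) sq_integrable_integrable:
  "sq_integrable M f \<Longrightarrow> integrable M f"
  using sq_integrable_mult[OF _ sq_integrable_const[of 1], of f] by simp

lemma integral_square_eq_0_imp_AE:
  assumes "sq_integrable M f" "(\<integral>x. (f x)\<^sup>2 \<partial>M) = 0"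
  shows "AE x in M. f x = 0"
  using integral_nonneg_eq_0_iff_AE[of M "\<lambda>x. (f x)\<^sup>2"] assms by (auto simp: sq_integrable_def)

lemma integral_square_add:
  assumes "sq_integrable M f" "sq_integrable M g"
  shows "(\<integral>x. (f x + g x)\<^sup>2 \<partial>M) = (\<integral>x. (f x)\<^sup>2 \<partial>M) + (\<integral>x. (g x)\<^sup>2 \<partial>M) + 2 * (\<integral>x. f x * g x \<partial>M)"
proof -
  note [simp] = sq_integrable_mult[OF assms] assms[THEN sq_integrable_square]
  have "(\<integral>x. (f x + g x)\<^sup>2 \<partial>M) = (\<integral>x. (f x)\<^sup>2 + (g x)\<^sup>2 + 2 * (f x * g x) \<partial>M)"
    by (simp add: power2_sum mult.assoc)
  then show ?thesis by simp
qed

lemma integral_square_diff: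
  assumes "sq_integrable M f" "sq_integrable M g"
  shows "(\<integral>x. (f x - g x)\<^sup>2 \<partial>M) = (\<integral>x. (f x)\<^sup>2 \<partial>M) + (\<integral>x. (g x)\<^sup>2 \<partial>M) - 2 * (\<integral>x. f x * g x \<partial>M)"
  using integral_square_add[OF assms(1) sq_integrable_cmult[OF assms(2), of "-1"]] by simp

lemma integral_square_triangle:
  assumes f: "sq_integrable M f" and g: "sq_integrable M g" and h: "sq_integrable M h"
  shows "(\<integral>x. (f x - h x)\<^sup>2 \<partial>M) \<le> 2 * (\<integral>x. (f x - g x)\<^sup>2 \<partial>M) + 2 * (\<integral>x. (g x - h x)\<^sup>2 \<partial>M)"
proof -
  note i = sq_integrable_square[OF sq_integrable_diff[OF f g]] sq_integrable_square[OF sq_integrable_diff[OF g h]]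
    sq_integrable_square[OF sq_integrable_diff[OF f h]]
  have "(\<integral>x. (f x - h x)\<^sup>2 \<partial>M) \<le> (\<integral>x. 2 * (f x - g x)\<^sup>2 + 2 * (g x - h x)\<^sup>2 \<partial>M)"
  proof (rule integral_mono)
    fix x
    have "(f x - h x)\<^sup>2 + ((f x - g x) - (g x - h x))\<^sup>2 = 2 * (f x - g x)\<^sup>2 + 2 * (g x - h x)\<^sup>2"
      by (simp add: power2_eq_square algebra_simps)
    then show "(f x - h x)\<^sup>2 \<le> 2 * (f x - g x)\<^sup>2 + 2 * (g x - h x)\<^sup>2"
      using zero_le_power2[of "(f x - g x) - (g x - h x)"] by linarith
  qed (use i in auto)
  then show ?thesis using i by simp
qed

lemma Cauchy_Schwarz_integral:
  assumes "sq_integrable M f" "sq_integrable M g"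
  shows "(\<integral>x. f x * g x \<partial>M)\<^sup>2 \<le> (\<integral>x. (f x)\<^sup>2 \<partial>M) * (\<integral>x. (g x)\<^sup>2 \<partial>M)"
proof -
  define a where "a = (\<integral>x. (f x)\<^sup>2 \<partial>M)"
  define b where "b = (\<integral>x. f x * g x \<partial>M)"
  define c where "c = (\<integral>x. (g x)\<^sup>2 \<partial>M)"
  have quad: "0 \<le> a + t\<^sup>2 * c + 2 * t * b" for t
  proof -
    have "0 \<le> (\<integral>x. (f x + t * g x)\<^sup>2 \<partial>M)" by simp
    also have "\<dots> = a + t\<^sup>2 * c + 2 * t * b"
      by (subst integral_square_add[OF assms(1) sq_integrable_cmult[OF assms(2)]])
        (simp add: a_def b_def c_def power_mult_distrib mult.left_commute)
    finally show ?thesis .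
  qed
  have "c \<ge> 0" by (simp add: c_def)
  show "b\<^sup>2 \<le> a * c"
  proof (cases "c = 0")
    case True
    then have "AE x in M. g x = 0" using integral_square_eq_0_imp_AE[OF assms(2)] by (simp add: c_def)
    then have "b = (\<integral>x. 0 \<partial>M)" unfolding b_def
      by (intro integral_cong_AE) (use assms in \<open>auto simp: sq_integrable_def\<close>)
    then show ?thesis using True by simp
  next
    case False
    then have "0 \<le> c * (a + (- b / c)\<^sup>2 * c + 2 * (- b / c) * b)"
      by (intro mult_nonneg_nonneg[OF \<open>c \<ge> 0\<close> quad])
    also have "\<dots> = a * c - b\<^sup>2" using False by (simp add: field_simps power2_eq_square)
    finally show ?thesis by simp
  qed
qed

lemma sq_integrable_iff_nn:
  assumes "f \<in> borel_measurable M"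
  shows "sq_integrable M f \<longleftrightarrow> (\<integral>\<^sup>+x. ennreal ((f x)\<^sup>2) \<partial>M) < \<infinity>"
  using assms by (simp add: sq_integrable_def integrable_iff_bounded)

lemma nn_integral_square:
  "sq_integrable M f \<Longrightarrow> (\<integral>\<^sup>+x. ennreal ((f x)\<^sup>2) \<partial>M) = ennreal (\<integral>x. (f x)\<^sup>2 \<partial>M)"
  by (intro nn_integral_eq_integral) (auto simp: sq_integrable_def)

definition l2_tendsto :: "'a measure \<Rightarrow> (nat \<Rightarrow> 'a \<Rightarrow> real) \<Rightarrow> ('a \<Rightarrow> real) \<Rightarrow> bool" where
  "l2_tendsto M F f \<longleftrightarrow> (\<forall>n. sq_integrable M (F n)) \<and> sq_integrable M f \<and>
     (\<lambda>n. \<integral>x. (F n x - f x)\<^sup>2 \<partial>M) \<longlonglongrightarrow> 0"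

lemma l2_tendsto_nnI:
  assumes F: "\<And>n. sq_integrable M (F n)" and f: "f \<in> borel_measurable M"
    and lim: "(\<lambda>n. \<integral>\<^sup>+x. ennreal ((F n x - f x)\<^sup>2) \<partial>M) \<longlonglongrightarrow> 0"
  shows "l2_tendsto M F f"
proof -
  have "eventually (\<lambda>n. (\<integral>\<^sup>+x. ennreal ((F n x - f x)\<^sup>2) \<partial>M) < 1) sequentially"
    using lim by (rule order_tendstoD) simp
  then obtain n where n: "(\<integral>\<^sup>+x. ennreal ((F n x - f x)\<^sup>2) \<partial>M) < 1"
    by (auto simp: eventually_sequentially)
  have meas: "(\<lambda>x. F n x - f x) \<in> borel_measurable M" for n
    using F[of n, measurable] f by measurable
  have "sq_integrable M (\<lambda>x. F n x - f x)"
    using n by (subst sq_integrable_iff_nn[OF meas]) (auto elim: order.strict_trans)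
  from sq_integrable_diff[OF F[of n] this] have sf: "sq_integrable M f" by simp
  have "(\<lambda>n. ennreal (\<integral>x. (F n x - f x)\<^sup>2 \<partial>M)) \<longlonglongrightarrow> ennreal 0"
    using lim by (simp add: nn_integral_square[OF sq_integrable_diff[OF F sf]])
  then have "(\<lambda>n. \<integral>x. (F n x - f x)\<^sup>2 \<partial>M) \<longlonglongrightarrow> 0"
    by (subst (asm) tendsto_ennreal_iff) (auto intro!: always_eventually)
  then show ?thesis using F sf by (simp add: l2_tendsto_def)
qed

lemma l2_tendsto_nnD:
  assumes "l2_tendsto M F f"
  shows "(\<lambda>n. \<integral>\<^sup>+x. ennreal ((F n x - f x)\<^sup>2) \<partial>M) \<longlonglongrightarrow> 0"
proof -
  have "(\<lambda>n. ennreal (\<integral>x. (F n x - f x)\<^sup>2 \<partial>M)) \<longlonglongrightarrow> ennreal 0"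
    using assms by (intro tendsto_ennrealI) (simp add: l2_tendsto_def)
  then show ?thesis
    using assms by (simp add: nn_integral_square sq_integrable_diff l2_tendsto_def)
qed

lemma l2_tendsto_const: "sq_integrable M f \<Longrightarrow> l2_tendsto M (\<lambda>n. f) f"
  by (simp add: l2_tendsto_def)

lemma l2_tendsto_diff:
  assumes "l2_tendsto M F f" "l2_tendsto M G g"
  shows "l2_tendsto M (\<lambda>n x. F n x - G n x) (\<lambda>x. f x - g x)"
proof -
  note F = assms(1)[unfolded l2_tendsto_def] and G = assms(2)[unfolded l2_tendsto_def]
  have "(\<lambda>n. \<integral>x. ((F n x - G n x) - (f x - g x))\<^sup>2 \<partial>M) \<longlonglongrightarrow> 0"
  proof (rule tendsto_sandwich[OF _ _ tendsto_const])
    show "(\<lambda>n. 2 * (\<integral>x. (F n x - f x)\<^sup>2 \<partial>M) + 2 * (\<integral>x. (G n x - g x)\<^sup>2 \<partial>M)) \<longlonglongrightarrow> 0"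
      using F G by (auto intro!: tendsto_eq_intros)
    show "\<forall>\<^sub>F n in sequentially. (\<integral>x. ((F n x - G n x) - (f x - g x))\<^sup>2 \<partial>M)
        \<le> 2 * (\<integral>x. (F n x - f x)\<^sup>2 \<partial>M) + 2 * (\<integral>x. (G n x - g x)\<^sup>2 \<partial>M)"
    proof (intro always_eventually allI)
      fix n
      let ?h = "\<lambda>x. F n x - f x" and ?k = "\<lambda>x. G n x - g x"
      have "sq_integrable M ?h" "sq_integrable M ?k" using F G by (auto intro: sq_integrable_diff)
      note triangle = integral_square_triangle[OF this(1) sq_integrable_zero this(2)]
      have eq: "(F n x - G n x) - (f x - g x) = ?h x - ?k x" for x by simp
      show "(\<integral>x. ((F n x - G n x) - (f x - g x))\<^sup>2 \<partial>M)
        \<le> 2 * (\<integral>x. (F n x - f x)\<^sup>2 \<partial>M) + 2 * (\<integral>x. (G n x - g x)\<^sup>2 \<partial>M)"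
        using triangle by (simp only: eq diff_0_right diff_0 power2_minus)
    qed
  qed (auto intro!: always_eventually)
  then show ?thesis using F G by (auto simp: l2_tendsto_def intro: sq_integrable_diff)
qed

lemma l2_tendsto_inner:
  assumes "l2_tendsto M F f" "l2_tendsto M G g"
  shows "(\<lambda>n. \<integral>x. F n x * G n x \<partial>M) \<longlonglongrightarrow> (\<integral>x. f x * g x \<partial>M)"
proof -
  note F = assms(1)[unfolded l2_tendsto_def] and G = assms(2)[unfolded l2_tendsto_def]
  have null: "(\<lambda>n. \<integral>x. P n x * Q n x \<partial>M) \<longlonglongrightarrow> 0"
    if PQ: "\<And>n. sq_integrable M (P n)" "\<And>n. sq_integrable M (Q n)"
      and lim: "(\<lambda>n. (\<integral>x. (P n x)\<^sup>2 \<partial>M) * (\<integral>x. (Q n x)\<^sup>2 \<partial>M)) \<longlonglongrightarrow> 0" for P Q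
  proof -
    have "(\<lambda>n. (\<integral>x. P n x * Q n x \<partial>M)\<^sup>2) \<longlonglongrightarrow> 0"
      by (rule tendsto_sandwich[OF _ _ tendsto_const lim])
        (auto intro!: always_eventually Cauchy_Schwarz_integral PQ)
    from tendsto_real_sqrt[OF this] show ?thesis by (simp add: tendsto_rabs_zero_iff)
  qed
  have d: "\<And>n. sq_integrable M (\<lambda>x. F n x - f x)" "\<And>n. sq_integrable M (\<lambda>x. G n x - g x)"
    using F G by (auto intro: sq_integrable_diff)
  have 1: "(\<lambda>n. \<integral>x. (F n x - f x) * (G n x - g x) \<partial>M) \<longlonglongrightarrow> 0"
    by (rule null) (use F G d in \<open>auto intro!: tendsto_eq_intros\<close>)
  have 2: "(\<lambda>n. \<integral>x. f x * (G n x - g x) \<partial>M) \<longlonglongrightarrow> 0"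
    by (rule null) (use F G d in \<open>auto intro!: tendsto_eq_intros\<close>)
  have 3: "(\<lambda>n. \<integral>x. (F n x - f x) * g x \<partial>M) \<longlonglongrightarrow> 0"
    by (rule null) (use F G d in \<open>auto intro!: tendsto_eq_intros\<close>)
  have "(\<integral>x. F n x * G n x \<partial>M) = (\<integral>x. (F n x - f x) * (G n x - g x) \<partial>M)
      + (\<integral>x. f x * (G n x - g x) \<partial>M) + (\<integral>x. (F n x - f x) * g x \<partial>M) + (\<integral>x. f x * g x \<partial>M)" for n
  proof -
    have i: "integrable M (\<lambda>x. (F n x - f x) * (G n x - g x))" "integrable M (\<lambda>x. f x * (G n x - g x))"
      "integrable M (\<lambda>x. (F n x - f x) * g x)" "integrable M (\<lambda>x. f x * g x)"
      using F G d by (auto intro!: sq_integrable_mult)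
    have "(\<integral>x. F n x * G n x \<partial>M) = (\<integral>x. (F n x - f x) * (G n x - g x) + f x * (G n x - g x)
       + (F n x - f x) * g x + f x * g x \<partial>M)"
      by (intro arg_cong[where f="integral\<^sup>L M"] ext) (simp add: algebra_simps)
    also have "\<dots> = (\<integral>x. (F n x - f x) * (G n x - g x) \<partial>M)
      + (\<integral>x. f x * (G n x - g x) \<partial>M) + (\<integral>x. (F n x - f x) * g x \<partial>M) + (\<integral>x. f x * g x \<partial>M)"
      using i by (simp only: Bochner_Integration.integral_add Bochner_Integration.integrable_add)
    finally show ?thesis .
  qed
  then show ?thesis using tendsto_add[OF tendsto_add[OF tendsto_add[OF 1 2] 3] tendsto_const] by simp
qed

lemma l2_tendsto_Cauchy:
  assumes "l2_tendsto M F f" "e > 0"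
  shows "\<exists>N. \<forall>m\<ge>N. \<forall>n\<ge>N. (\<integral>x. (F m x - F n x)\<^sup>2 \<partial>M) < (e::real)"
proof -
  note F = assms(1)[unfolded l2_tendsto_def]
  have "eventually (\<lambda>n. (\<integral>x. (F n x - f x)\<^sup>2 \<partial>M) < e / 4) sequentially"
    using F assms(2) by (intro order_tendstoD(2)) auto
  then obtain N where N: "\<And>n. n \<ge> N \<Longrightarrow> (\<integral>x. (F n x - f x)\<^sup>2 \<partial>M) < e / 4"
    by (auto simp: eventually_sequentially)
  have "(\<integral>x. (F m x - F n x)\<^sup>2 \<partial>M) < e" if "m \<ge> N" "n \<ge> N" for m n
  proof -
    have "(\<integral>x. (f x - F n x)\<^sup>2 \<partial>M) = (\<integral>x. (F n x - f x)\<^sup>2 \<partial>M)" by (simp add: power2_commute)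
    then show ?thesis
      using integral_square_triangle[of M "F m" f "F n"] F N[OF that(1)] N[OF that(2)] by simp
  qed
  then show ?thesis by blast
qed

lemma l2_tendsto_bounded_mult:
  assumes F: "l2_tendsto M F f" and h: "h \<in> borel_measurable M" "\<And>x. \<bar>h x\<bar> \<le> 1"
  shows "l2_tendsto M (\<lambda>n x. h x * F n x) (\<lambda>x. h x * f x)"
proof -
  note F = F[unfolded l2_tendsto_def]
  have bm: "sq_integrable M (\<lambda>x. h x * g x)" if "sq_integrable M g" for g
    by (rule sq_integrable_bounded_mult[OF h(1) h(2) that])
  have "(\<lambda>n. \<integral>x. (h x * F n x - h x * f x)\<^sup>2 \<partial>M) \<longlonglongrightarrow> 0"
  proof (rule tendsto_sandwich[OF _ _ tendsto_const])
    show "(\<lambda>n. \<integral>x. (F n x - f x)\<^sup>2 \<partial>M) \<longlonglongrightarrow> 0" using F by auto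
    show "\<forall>\<^sub>F n in sequentially. (\<integral>x. (h x * F n x - h x * f x)\<^sup>2 \<partial>M) \<le> (\<integral>x. (F n x - f x)\<^sup>2 \<partial>M)"
    proof (intro always_eventually allI integral_mono)
      fix n x
      have "\<bar>h x * (F n x - f x)\<bar> \<le> \<bar>F n x - f x\<bar>"
        unfolding abs_mult using mult_right_mono[OF h(2)[of x], of "\<bar>F n x - f x\<bar>"] by simp
      then show "(h x * F n x - h x * f x)\<^sup>2 \<le> (F n x - f x)\<^sup>2"
        unfolding abs_le_square_iff by (simp add: right_diff_distrib)
    qed (use F in \<open>auto intro!: sq_integrable_square sq_integrable_diff bm\<close>)
  qed (auto intro!: always_eventually)
  then show ?thesis using F by (auto simp: l2_tendsto_def intro: bm)
qed

lemma l2_tendsto_cong_AE: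
  assumes "l2_tendsto M F f" "g \<in> borel_measurable M" "AE x in M. f x = g x"
  shows "l2_tendsto M F g"
proof -
  note F = assms(1)[unfolded l2_tendsto_def]
  have [measurable]: "F n \<in> borel_measurable M" "f \<in> borel_measurable M" "g \<in> borel_measurable M" for n
    using F assms(2) by (auto simp: sq_integrable_def)
  have "(\<integral>x. (F n x - f x)\<^sup>2 \<partial>M) = (\<integral>x. (F n x - g x)\<^sup>2 \<partial>M)" for n
    by (rule integral_cong_AE) (use assms(3) in auto)
  then show ?thesis using F sq_integrable_cong_AE[OF _ assms(2,3)] by (simp add: l2_tendsto_def)
qed

text \<open>
  Completeness of \<open>L\<^sup>2\<close>. Along a subsequence with increments of order \<open>8\<^sup>-\<^sup>k\<close> in squared norm the
  weighted sum \<open>\<Sum>k. 2\<^sup>k d\<^sub>k\<^sup>2\<close> of the squared increments has finite integral, which gives an almost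
  everywhere limit; Fatou's lemma turns it into the limit of the whole sequence.
\<close>

lemma l2_complete:
  assumes F: "\<And>n. sq_integrable M (F n)"
    and Cauchy: "\<And>e. e > 0 \<Longrightarrow> \<exists>N. \<forall>m\<ge>N. \<forall>n\<ge>N. (\<integral>x. (F m x - F n x)\<^sup>2 \<partial>M) < (e::real)"
  shows "\<exists>f. l2_tendsto M F f"
proof -
  have [measurable]: "F n \<in> borel_measurable M" for n using F by (simp add: sq_integrable_def)
  have "\<exists>N. \<forall>k. \<forall>m\<ge>N k. \<forall>n\<ge>N k. (\<integral>x. (F m x - F n x)\<^sup>2 \<partial>M) < (1/8)^k"
    by (intro choice allI Cauchy) auto
  then obtain N where N: "\<And>k m n. m \<ge> N k \<Longrightarrow> n \<ge> N k \<Longrightarrow> (\<integral>x. (F m x - F n x)\<^sup>2 \<partial>M) < (1/8)^k"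
    by blast
  define r where "r k = k + (\<Sum>i\<le>k. N i)" for k
  have rN: "N k \<le> r k" for k unfolding r_def by (rule trans_le_add2, rule member_le_sum) auto
  have rmono: "r k \<le> r l" if "k \<le> l" for k l unfolding r_def by (rule add_mono[OF that sum_mono2]) (use that in auto)
  have d2: "sq_integrable M (\<lambda>x. F m x - F n x)" for m n by (intro sq_integrable_diff F)
  define d where "d k x = F (r (Suc k)) x - F (r k) x" for k x
  have [measurable]: "d k \<in> borel_measurable M" for k unfolding d_def by measurable
  have "(\<integral>\<^sup>+x. (\<Sum>k. ennreal (2^k * (d k x)\<^sup>2)) \<partial>M) = (\<Sum>k. \<integral>\<^sup>+x. ennreal (2^k * (d k x)\<^sup>2) \<partial>M)"
    by (rule nn_integral_suminf) simp
  also have "\<dots> \<le> (\<Sum>k. ennreal ((1/4)^k))"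
  proof (rule suminf_le)
    fix k
    have "(\<integral>\<^sup>+x. ennreal (2^k * (d k x)\<^sup>2) \<partial>M) = ennreal (2^k * (\<integral>x. (d k x)\<^sup>2 \<partial>M))"
      using d2 by (subst nn_integral_eq_integral) (auto simp: d_def sq_integrable_def)
    also have "\<dots> \<le> ennreal (2^k * (1/8)^k)"
      unfolding d_def using N[of k "r (Suc k)" "r k"] rN[of k] rmono[of k "Suc k"]
      by (intro ennreal_leI mult_left_mono) auto
    also have "2^k * (1/8::real)^k = (1/4)^k" by (simp flip: power_mult_distrib)
    finally show "(\<integral>\<^sup>+x. ennreal (2^k * (d k x)\<^sup>2) \<partial>M) \<le> ennreal ((1/4)^k)" .
  qed auto
  also have "\<dots> = ennreal (\<Sum>k. (1/4)^k)"
    by (rule suminf_ennreal2) (auto intro: summable_geometric)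
  also have "\<dots> < \<infinity>" by simp
  finally have "AE x in M. (\<Sum>k. ennreal (2^k * (d k x)\<^sup>2)) \<noteq> \<infinity>"
    by (intro nn_integral_PInf_AE) auto
  then have ae: "AE x in M. convergent (\<lambda>k. F (r k) x)"
  proof eventually_elim
    fix x assume "(\<Sum>k. ennreal (2^k * (d k x)\<^sup>2)) \<noteq> \<infinity>"
    then have s: "summable (\<lambda>k. 2^k * (d k x)\<^sup>2)" by (intro summable_suminf_not_top) auto
    have "summable (\<lambda>k. d k x)"
    proof (rule summable_comparison_test)
      show "summable (\<lambda>k. (1/2)^k + 2^k * (d k x)\<^sup>2)"
        by (intro summable_add s summable_geometric) auto
      have "\<bar>d k x\<bar> \<le> (1/2)^k + 2^k * (d k x)\<^sup>2" for k
      proof -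
        have "0 \<le> 2^k * (\<bar>d k x\<bar> - (1/2)^k)\<^sup>2" by simp
        also have "\<dots> = 2^k * (d k x)\<^sup>2 - 2 * \<bar>d k x\<bar> * (2^k * (1/2)^k) + (2^k * (1/2)^k) * (1/2)^k"
          by (simp add: power2_eq_square algebra_simps)
        also have "2^k * (1/2::real)^k = 1" by (simp flip: power_mult_distrib)
        finally show ?thesis by (simp add: abs_ge_zero)
      qed
      then show "\<exists>N. \<forall>n\<ge>N. norm (d n x) \<le> (1/2)^n + 2^n * (d n x)\<^sup>2" by auto
    qed
    then have "convergent (\<lambda>n. (\<Sum>k<n. d k x) + F (r 0) x)"
      by (intro convergent_add convergent_const) (simp add: summable_iff_convergent)
    moreover have "(\<Sum>k<n. d k x) + F (r 0) x = F (r n) x" for n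
      by (induction n) (simp_all add: d_def)
    ultimately show "convergent (\<lambda>k. F (r k) x)" by simp
  qed
  define f where "f x = lim (\<lambda>k. F (r k) x)" for x
  have [measurable]: "f \<in> borel_measurable M" unfolding f_def by measurable
  have ae: "AE x in M. (\<lambda>k. F (r k) x) \<longlonglongrightarrow> f x"
    using ae by (simp add: f_def convergent_LIMSEQ_iff)
  have "(\<lambda>n. \<integral>\<^sup>+x. ennreal ((F n x - f x)\<^sup>2) \<partial>M) \<longlonglongrightarrow> 0"
  proof (rule order_tendstoI)
    fix a :: ennreal assume "0 < a"
    then obtain y where y: "0 < y" "y < a" using dense by blast
    then obtain e where e: "y = ennreal e" "e \<ge> 0" by (cases y) auto
    then have "e > 0" using y by (cases "e = 0") auto
    from Cauchy[OF this] obtain K where K: "\<And>m n. m \<ge> K \<Longrightarrow> n \<ge> K \<Longrightarrow> (\<integral>x. (F m x - F n x)\<^sup>2 \<partial>M) < e" by blast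
    have "(\<integral>\<^sup>+x. ennreal ((F n x - f x)\<^sup>2) \<partial>M) < a" if "n \<ge> K" for n
    proof -
      have "(\<integral>\<^sup>+x. ennreal ((F n x - f x)\<^sup>2) \<partial>M) = (\<integral>\<^sup>+x. liminf (\<lambda>k. ennreal ((F n x - F (r (k + K)) x)\<^sup>2)) \<partial>M)"
      proof (rule nn_integral_cong_AE)
        show "AE x in M. ennreal ((F n x - f x)\<^sup>2) = liminf (\<lambda>k. ennreal ((F n x - F (r (k + K)) x)\<^sup>2))"
          using ae
        proof eventually_elim
          fix x assume "(\<lambda>k. F (r k) x) \<longlonglongrightarrow> f x"
          then have "(\<lambda>k. F (r (k + K)) x) \<longlonglongrightarrow> f x" by (rule LIMSEQ_ignore_initial_segment)
          then have "(\<lambda>k. ennreal ((F n x - F (r (k + K)) x)\<^sup>2)) \<longlonglongrightarrow> ennreal ((F n x - f x)\<^sup>2)"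
            by (intro tendsto_ennrealI tendsto_intros)
          then show "ennreal ((F n x - f x)\<^sup>2) = liminf (\<lambda>k. ennreal ((F n x - F (r (k + K)) x)\<^sup>2))"
            using lim_imp_Liminf[OF trivial_limit_sequentially] by metis
        qed
      qed
      also have "\<dots> \<le> liminf (\<lambda>k. \<integral>\<^sup>+x. ennreal ((F n x - F (r (k + K)) x)\<^sup>2) \<partial>M)"
        by (rule nn_integral_liminf) measurable
      also have "\<dots> \<le> ennreal e"
      proof (rule Liminf_le)
        have "K \<le> r (k + K)" for k by (simp add: r_def)
        then show "\<forall>\<^sub>F k in sequentially. (\<integral>\<^sup>+x. ennreal ((F n x - F (r (k + K)) x)\<^sup>2) \<partial>M) \<le> ennreal e"
          using K[OF \<open>n \<ge> K\<close>, THEN less_imp_le] by (auto simp: nn_integral_square[OF d2] intro!: always_eventually ennreal_leI)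
      qed simp
      finally show ?thesis using y e by simp
    qed
    then show "\<forall>\<^sub>F n in sequentially. (\<integral>\<^sup>+x. ennreal ((F n x - f x)\<^sup>2) \<partial>M) < a"
      by (auto simp: eventually_sequentially)
  qed simp
  then have "l2_tendsto M F f" by (intro l2_tendsto_nnI F) auto
  then show ?thesis by blast
qed

section \<open>Brownian motion with respect to a filtration\<close>

text \<open>
  Exponential tilting shifts the mean of a Gaussian; all moments below follow from this.
\<close>

lemma normal_density_mult_exp:
  assumes "\<sigma> > 0"
  shows "normal_density 0 \<sigma> x * exp (a * x) = exp (a\<^sup>2 * \<sigma>\<^sup>2 / 2) * normal_density (a * \<sigma>\<^sup>2) \<sigma> x"
proof -
  have "- (x\<^sup>2 / (2 * \<sigma>\<^sup>2)) + a * x = a\<^sup>2 * \<sigma>\<^sup>2 / 2 - (x - a * \<sigma>\<^sup>2)\<^sup>2 / (2 * \<sigma>\<^sup>2)"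
    using assms by (simp add: field_simps power2_eq_square)
  then show ?thesis
    by (simp add: normal_density_def mult_exp_exp)
qed

context prob_space
begin

lemma normal_exp_moment:
  assumes D: "distributed M lborel D (normal_density 0 \<sigma>)" and \<sigma>: "\<sigma> > 0"
  shows "has_bochner_integral M (\<lambda>\<omega>. exp (a * D \<omega>)) (exp (a\<^sup>2 * \<sigma>\<^sup>2 / 2))"
    and "has_bochner_integral M (\<lambda>\<omega>. D \<omega> * exp (a * D \<omega>)) (a * \<sigma>\<^sup>2 * exp (a\<^sup>2 * \<sigma>\<^sup>2 / 2))"
    and "has_bochner_integral M (\<lambda>\<omega>. (D \<omega>)\<^sup>2) (\<sigma>\<^sup>2)"
proof -
  have transfer: "has_bochner_integral M (\<lambda>\<omega>. g (D \<omega>)) I"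
    if "has_bochner_integral lborel (\<lambda>x. normal_density 0 \<sigma> x * g x) I" "g \<in> borel_measurable borel" for g I
    using that distributed_integrable[OF D, of g] distributed_integral[OF D, of g]
    by (auto simp: has_bochner_integral_iff)
  let ?E = "exp (a\<^sup>2 * \<sigma>\<^sup>2 / 2)"
  have "has_bochner_integral lborel (\<lambda>x. ?E * normal_density (a * \<sigma>\<^sup>2) \<sigma> x) ?E"
    using \<sigma> by (simp add: has_bochner_integral_iff)
  then show "has_bochner_integral M (\<lambda>\<omega>. exp (a * D \<omega>)) ?E"
    by (intro transfer) (simp_all add: normal_density_mult_exp[OF \<sigma>])
  have "has_bochner_integral lborel (\<lambda>x. ?E * (normal_density (a * \<sigma>\<^sup>2) \<sigma> x * x)) (?E * (a * \<sigma>\<^sup>2))"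
    by (intro has_bochner_integral_mult_right normal_moment_nz_1 \<sigma>)
  moreover have "normal_density 0 \<sigma> x * (x * exp (a * x)) = ?E * (normal_density (a * \<sigma>\<^sup>2) \<sigma> x * x)" for x
    using normal_density_mult_exp[OF \<sigma>, of x a] by simp
  ultimately have "has_bochner_integral lborel (\<lambda>x. normal_density 0 \<sigma> x * (x * exp (a * x))) (a * \<sigma>\<^sup>2 * ?E)"
    by (simp only: mult.commute[of "a * \<sigma>\<^sup>2"])
  then show "has_bochner_integral M (\<lambda>\<omega>. D \<omega> * exp (a * D \<omega>)) (a * \<sigma>\<^sup>2 * ?E)"
    by (intro transfer) simp_all
  have "fact (2 * 1) / ((2 / \<sigma>\<^sup>2) ^ 1 * fact 1) = \<sigma>\<^sup>2"
    using \<sigma> by (simp add: fact_numeral)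
  then have "has_bochner_integral lborel (\<lambda>x. normal_density 0 \<sigma> x * x\<^sup>2) (\<sigma>\<^sup>2)"
    using normal_moment_even[OF \<sigma>, of 0 1] by simp
  then show "has_bochner_integral M (\<lambda>\<omega>. (D \<omega>)\<^sup>2) (\<sigma>\<^sup>2)"
    by (intro transfer) simp_all
qed

end

text \<open>
  The filtration may be larger than the one generated by \<open>B\<close>, as long as the increments stay
  independent of the past; this covers augmentation by null sets.
\<close>

locale brownian_filtration = prob_space M for M :: "'a measure" +
  fixes F :: "real \<Rightarrow> 'a measure" and T :: real and B :: "real \<Rightarrow> 'a \<Rightarrow> real"
  assumes T_pos: "T > 0"
    and subalg: "\<And>t. 0 \<le> t \<Longrightarrow> t \<le> T \<Longrightarrow> subalgebra M (F t)"
    and filtration_mono: "\<And>s t. 0 \<le> s \<Longrightarrow> s \<le> t \<Longrightarrow> t \<le> T \<Longrightarrow> sets (F s) \<subseteq> sets (F t)"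
    and adapted: "\<And>t. 0 \<le> t \<Longrightarrow> t \<le> T \<Longrightarrow> B t \<in> borel_measurable (F t)"
    and continuous_paths: "\<And>\<omega>. \<omega> \<in> space M \<Longrightarrow> continuous_on {0..T} (\<lambda>t. B t \<omega>)"
    and increment_normal: "\<And>s t. 0 \<le> s \<Longrightarrow> s < t \<Longrightarrow> t \<le> T \<Longrightarrow>
      distributed M lborel (\<lambda>\<omega>. B t \<omega> - B s \<omega>) (normal_density 0 (sqrt (t - s)))"
    and increment_indep: "\<And>s t. 0 \<le> s \<Longrightarrow> s < t \<Longrightarrow> t \<le> T \<Longrightarrow>
      indep_set (sets (F s)) (sets (vimage_algebra (space M) (\<lambda>\<omega>. B t \<omega> - B s \<omega>) borel))"
begin

lemma space_F: "0 \<le> t \<Longrightarrow> t \<le> T \<Longrightarrow> space (F t) = space M"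
  using subalg[of t] by (simp add: subalgebra_def)

lemma F_imp_M: "(f :: 'a \<Rightarrow> real) \<in> borel_measurable (F t) \<Longrightarrow> 0 \<le> t \<Longrightarrow> t \<le> T \<Longrightarrow> f \<in> borel_measurable M"
  by (rule measurable_from_subalg[OF subalg])

lemma F_mono: "(f :: 'a \<Rightarrow> real) \<in> borel_measurable (F s) \<Longrightarrow> 0 \<le> s \<Longrightarrow> s \<le> t \<Longrightarrow> t \<le> T \<Longrightarrow> f \<in> borel_measurable (F t)"
  by (rule measurable_from_subalg[of "F t" "F s"]) (simp_all add: subalgebra_def filtration_mono space_F)

lemma B_F: "0 \<le> s \<Longrightarrow> s \<le> t \<Longrightarrow> t \<le> T \<Longrightarrow> B s \<in> borel_measurable (F t)"
  by (rule F_mono[OF adapted]) linarith+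

lemma B_M: "0 \<le> s \<Longrightarrow> s \<le> T \<Longrightarrow> B s \<in> borel_measurable M"
  by (rule F_imp_M[OF adapted])

text \<open>
  The case \<open>s = t\<close> is included because partition points of simple integrands may coincide.
\<close>

lemma increment_mult:
  fixes X :: "'a \<Rightarrow> real" and g :: "real \<Rightarrow> real"
  assumes st: "0 \<le> s" "s \<le> t" "t \<le> T"
    and X: "X \<in> borel_measurable (F s)" "integrable M X"
    and g: "g \<in> borel_measurable borel"
    and G: "has_bochner_integral M (\<lambda>\<omega>. g (B t \<omega> - B s \<omega>)) m"
  shows "has_bochner_integral M (\<lambda>\<omega>. X \<omega> * g (B t \<omega> - B s \<omega>)) (expectation X * m)"
proof (cases "s = t")
  case True
  have "expectation (\<lambda>\<omega>. g 0) = m" using G True by (simp only: has_bochner_integral_iff diff_self)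
  then have "m = g 0" by (simp add: prob_space)
  then show ?thesis using True X by (simp add: has_bochner_integral_iff)
next
  case False
  then have "s < t" using st by simp
  have [measurable]: "B s \<in> borel_measurable M" "B t \<in> borel_measurable M" "g \<in> borel_measurable borel"
    using st g by (auto intro!: B_M)
  have X_M[measurable]: "X \<in> borel_measurable M" by (rule F_imp_M[OF X(1)]) (use st in linarith)+
  let ?D = "\<lambda>\<omega>. B t \<omega> - B s \<omega>"
  have "indep_var borel X borel (\<lambda>\<omega>. g (?D \<omega>))"
    unfolding indep_var_eq
  proof (intro conjI)
    have iset: "indep_set (sets (F s)) (sets (vimage_algebra (space M) ?D borel))"
      by (rule increment_indep[OF st(1) \<open>s < t\<close> st(3)])
    have "{X -` A \<inter> space M |A. A \<in> sets borel} \<subseteq> sets (F s)"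
      using measurable_sets[OF X(1)] space_F[of s] st by auto
    then have 1: "sigma_sets (space M) {X -` A \<inter> space M |A. A \<in> sets borel} \<subseteq> sets (F s)"
      using sets.sigma_sets_subset[of _ "F s"] space_F[of s] st by auto
    let ?V = "vimage_algebra (space M) ?D borel"
    have "(\<lambda>\<omega>. g (?D \<omega>)) \<in> borel_measurable ?V"
      by (rule measurable_compose[OF _ g]) (rule measurable_vimage_algebra1, auto)
    from measurable_sets[OF this]
    have "{(\<lambda>\<omega>. g (?D \<omega>)) -` A \<inter> space M |A. A \<in> sets borel} \<subseteq> sets ?V" by auto
    then have 2: "sigma_sets (space M) {(\<lambda>\<omega>. g (?D \<omega>)) -` A \<inter> space M |A. A \<in> sets borel} \<subseteq> sets ?V"
      using sets.sigma_sets_subset[of _ ?V] by simp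
    show "indep_set (sigma_sets (space M) {X -` A \<inter> space M |A. A \<in> sets borel})
     (sigma_sets (space M) {(\<lambda>\<omega>. g (?D \<omega>)) -` A \<inter> space M |A. A \<in> sets borel})"
      using iset 1 2 unfolding indep_set_def
      by (elim indep_sets_mono_sets) (auto split: bool.split)
  qed auto
  then show ?thesis
    using indep_var_lebesgue_integral[of X "\<lambda>\<omega>. g (?D \<omega>)"] indep_var_integrable[of X "\<lambda>\<omega>. g (?D \<omega>)"] X(2) G
    by (auto simp: has_bochner_integral_iff)
qed

lemma increment_moments:
  assumes st: "0 \<le> s" "s \<le> t" "t \<le> T"
  shows "has_bochner_integral M (\<lambda>\<omega>. exp (a * (B t \<omega> - B s \<omega>))) (exp (a\<^sup>2 * (t - s) / 2))" (is ?a)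
    and "has_bochner_integral M (\<lambda>\<omega>. (B t \<omega> - B s \<omega>) * exp (a * (B t \<omega> - B s \<omega>)))
      (a * (t - s) * exp (a\<^sup>2 * (t - s) / 2))" (is ?b)
    and "has_bochner_integral M (\<lambda>\<omega>. (B t \<omega> - B s \<omega>)\<^sup>2) (t - s)" (is ?c)
proof -
  have "?a \<and> ?b \<and> ?c"
  proof (cases "s = t")
    case True then show ?thesis by (simp add: has_bochner_integral_iff prob_space)
  next
    case False
    then have "s < t" using st by simp
    then show ?thesis
      using normal_exp_moment(1,2)[OF increment_normal[OF st(1) \<open>s < t\<close> st(3)], where a=a]
        normal_exp_moment(3)[OF increment_normal[OF st(1) \<open>s < t\<close> st(3)]] by simp
  qed
  then show ?a ?b ?c by auto
qed

lemma increment_sq_integrable: "0 \<le> s \<Longrightarrow> s \<le> t \<Longrightarrow> t \<le> T \<Longrightarrow> sq_integrable M (\<lambda>\<omega>. B t \<omega> - B s \<omega>)"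
  unfolding sq_integrable_def using increment_moments(3)[of s t]
  by (auto simp: has_bochner_integral_iff intro!: borel_measurable_diff B_M)

lemma increment_mean_zero:
  fixes X :: "'a \<Rightarrow> real"
  assumes "0 \<le> s" "s \<le> t" "t \<le> T" "X \<in> borel_measurable (F s)" "integrable M X"
  shows "has_bochner_integral M (\<lambda>\<omega>. X \<omega> * (B t \<omega> - B s \<omega>)) 0"
proof -
  have "has_bochner_integral M (\<lambda>\<omega>. B t \<omega> - B s \<omega>) 0"
    using increment_moments(2)[OF assms(1-3), of 0] by simp
  from increment_mult[OF assms _ this] show ?thesis by simp
qed

text \<open>
  The density process, from time \<open>t\<close> on, of the measure under which \<open>B\<^sub>s + s\<close> is driftless; it is
  the stochastic exponential of \<open>- B\<close>. Two time indices make it multiplicative and independent of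
  \<open>F t\<close>.
\<close>

definition zeta :: "real \<Rightarrow> real \<Rightarrow> 'a \<Rightarrow> real" where
  "zeta t u \<omega> = exp (- (B u \<omega> - B t \<omega>) - (u - t) / 2)"

lemma zeta_pos: "zeta t u \<omega> > 0"
  by (simp add: zeta_def)

lemma zeta_mult: "zeta t u \<omega> * zeta u v \<omega> = zeta t v \<omega>"
  unfolding zeta_def mult_exp_exp by (simp add: algebra_simps diff_divide_distrib)

lemma zeta_refl: "zeta t t \<omega> = 1"
  by (simp add: zeta_def)

lemma zeta_F:
  assumes "0 \<le> t" "t \<le> u" "u \<le> v" "v \<le> T"
  shows "zeta t u \<in> borel_measurable (F v)"
proof -
  have [measurable]: "B t \<in> borel_measurable (F v)" "B u \<in> borel_measurable (F v)"
    by (rule B_F, use assms in linarith, use assms in linarith, use assms in linarith)+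
  show ?thesis unfolding zeta_def by measurable
qed

lemma zeta_M: "0 \<le> t \<Longrightarrow> t \<le> u \<Longrightarrow> u \<le> T \<Longrightarrow> zeta t u \<in> borel_measurable M"
  by (rule F_imp_M[OF zeta_F[of t u u]]) linarith+

text \<open>
  The last part is the drift \<open>-1\<close> that the tilt gives to the increments of \<open>B\<close>.
\<close>

lemma zeta_moments:
  assumes tu: "0 \<le> t" "t \<le> u" "u \<le> T" and X: "X \<in> borel_measurable (F t)" "integrable M X"
  shows "has_bochner_integral M (\<lambda>\<omega>. X \<omega> * zeta t u \<omega>) (expectation X)"
    and "has_bochner_integral M (\<lambda>\<omega>. X \<omega> * (zeta t u \<omega>)\<^sup>2) (expectation X * exp (u - t))"
    and "has_bochner_integral M (\<lambda>\<omega>. X \<omega> * ((B u \<omega> - B t \<omega>) * zeta t u \<omega>)) (- (u - t) * expectation X)"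
proof -
  have z: "zeta t u \<omega> = exp (- ((u - t) / 2)) * exp (- 1 * (B u \<omega> - B t \<omega>))"
      "(zeta t u \<omega>)\<^sup>2 = exp (- (u - t)) * exp (- 2 * (B u \<omega> - B t \<omega>))" for \<omega>
    unfolding zeta_def power2_eq_square mult_exp_exp by (simp_all add: algebra_simps)
  have e: "- (u - t) + (- 2)\<^sup>2 * (u - t) / 2 = u - t" by (simp add: field_simps)
  have "has_bochner_integral M (\<lambda>\<omega>. exp (- ((u - t) / 2)) * exp (- 1 * (B u \<omega> - B t \<omega>)))
      (exp (- ((u - t) / 2)) * exp ((-1)\<^sup>2 * (u - t) / 2))"
    by (intro has_bochner_integral_mult_right increment_moments tu)
  from increment_mult[OF tu X _ this] show "has_bochner_integral M (\<lambda>\<omega>. X \<omega> * zeta t u \<omega>) (expectation X)"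
    unfolding z by (simp add: mult_exp_exp field_simps)
  have "has_bochner_integral M (\<lambda>\<omega>. exp (- (u - t)) * exp (- 2 * (B u \<omega> - B t \<omega>)))
      (exp (- (u - t)) * exp ((-2)\<^sup>2 * (u - t) / 2))"
    by (intro has_bochner_integral_mult_right increment_moments tu)
  from increment_mult[OF tu X _ this] show "has_bochner_integral M (\<lambda>\<omega>. X \<omega> * (zeta t u \<omega>)\<^sup>2) (expectation X * exp (u - t))"
    unfolding z(2) mult_exp_exp e by simp
  have "has_bochner_integral M (\<lambda>\<omega>. exp (- ((u - t) / 2)) * ((B u \<omega> - B t \<omega>) * exp (- 1 * (B u \<omega> - B t \<omega>))))
      (exp (- ((u - t) / 2)) * (- 1 * (u - t) * exp ((-1)\<^sup>2 * (u - t) / 2)))"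
    by (intro has_bochner_integral_mult_right increment_moments tu)
  also have "exp (- ((u - t) / 2)) * (- 1 * (u - t) * exp ((-1)\<^sup>2 * (u - t) / 2)) = - (u - t)"
    by (simp add: exp_minus)
  finally have "has_bochner_integral M (\<lambda>\<omega>. exp (- ((u - t) / 2)) * ((B u \<omega> - B t \<omega>) * exp (- 1 * (B u \<omega> - B t \<omega>)))) (- (u - t))" .
  from increment_mult[OF tu X _ this] show "has_bochner_integral M (\<lambda>\<omega>. X \<omega> * ((B u \<omega> - B t \<omega>) * zeta t u \<omega>)) (- (u - t) * expectation X)"
    unfolding z by (simp add: ac_simps)
qed

lemma zeta_sq_integrable:
  assumes "0 \<le> t" "t \<le> u" "u \<le> T"
  shows "sq_integrable M (zeta t u)"
  unfolding sq_integrable_def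
proof
  show "zeta t u \<in> borel_measurable M" by (rule zeta_M[OF assms])
  have "has_bochner_integral M (\<lambda>\<omega>. 1 * (zeta t u \<omega>)\<^sup>2) (expectation (\<lambda>\<omega>. 1) * exp (u - t))"
    by (rule zeta_moments(2)[OF assms]) auto
  then show "integrable M (\<lambda>\<omega>. (zeta t u \<omega>)\<^sup>2)"
    by (simp only: mult_1 has_bochner_integral_iff)
qed

end

section \<open>The Ito isometry for simple integrands\<close>

lemma (in pair_sigma_finite)
  fixes f :: "'a \<Rightarrow> real" and g :: "'b \<Rightarrow> real"
  assumes f: "integrable M1 f" and g: "integrable M2 g"
  shows integrable_product_mult: "integrable (M1 \<Otimes>\<^sub>M M2) (\<lambda>x. f (fst x) * g (snd x))"
    and integral_product_mult: "(\<integral>x. f (fst x) * g (snd x) \<partial>(M1 \<Otimes>\<^sub>M M2)) = (\<integral>x. f x \<partial>M1) * (\<integral>x. g x \<partial>M2)"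
proof -
  have [measurable]: "f \<in> borel_measurable M1" "g \<in> borel_measurable M2" using f g by auto
  show i: "integrable (M1 \<Otimes>\<^sub>M M2) (\<lambda>x. f (fst x) * g (snd x))"
    by (rule Fubini_integrable) (use f g in \<open>auto simp: abs_mult\<close>)
  show "(\<integral>x. f (fst x) * g (snd x) \<partial>(M1 \<Otimes>\<^sub>M M2)) = (\<integral>x. f x \<partial>M1) * (\<integral>x. g x \<partial>M2)"
    using integral_fst'[OF i] by simp
qed

lemma integral_sum_product:
  fixes f g :: "nat \<Rightarrow> 'a \<Rightarrow> real"
  assumes "\<And>i j. i < n \<Longrightarrow> j < m \<Longrightarrow> integrable M (\<lambda>x. f i x * g j x)"
  shows "(\<integral>x. (\<Sum>i<n. f i x) * (\<Sum>j<m. g j x) \<partial>M) = (\<Sum>i<n. \<Sum>j<m. \<integral>x. f i x * g j x \<partial>M)"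
proof -
  have "(\<integral>x. (\<Sum>i<n. f i x) * (\<Sum>j<m. g j x) \<partial>M) = (\<Sum>i<n. \<integral>x. (\<Sum>j<m. f i x * g j x) \<partial>M)"
    unfolding sum_product by (rule Bochner_Integration.integral_sum) (auto intro: assms)
  also have "\<dots> = (\<Sum>i<n. \<Sum>j<m. \<integral>x. f i x * g j x \<partial>M)"
    by (intro sum.cong refl Bochner_Integration.integral_sum) (auto intro: assms)
  finally show ?thesis .
qed

context brownian_filtration
begin

sublocale P: pair_sigma_finite M "lborel :: real measure" ..

definition bounded_F :: "real \<Rightarrow> ('a \<Rightarrow> real) \<Rightarrow> bool" where
  "bounded_F t \<xi> \<longleftrightarrow> \<xi> \<in> borel_measurable (F t) \<and> (\<exists>C. \<forall>\<omega>\<in>space M. \<bar>\<xi> \<omega>\<bar> \<le> C)"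

lemma bounded_F_M: "bounded_F t \<xi> \<Longrightarrow> 0 \<le> t \<Longrightarrow> t \<le> T \<Longrightarrow> \<xi> \<in> borel_measurable M"
  unfolding bounded_F_def by (elim conjE, rule F_imp_M)

lemma bounded_F_mono: "bounded_F s \<xi> \<Longrightarrow> 0 \<le> s \<Longrightarrow> s \<le> t \<Longrightarrow> t \<le> T \<Longrightarrow> bounded_F t \<xi>"
  unfolding bounded_F_def by (elim conjE, intro conjI, erule (3) F_mono)

lemma bounded_F_sq_integrable:
  assumes "bounded_F t \<xi>" "0 \<le> t" "t \<le> T"
  shows "sq_integrable M \<xi>"
proof -
  obtain C where "\<And>\<omega>. \<omega> \<in> space M \<Longrightarrow> \<bar>\<xi> \<omega>\<bar> \<le> C" using assms(1) by (auto simp: bounded_F_def)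
  with bounded_F_M[OF assms] show ?thesis by (rule sq_integrable_bounded)
qed

lemma bounded_F_integrable: "bounded_F t \<xi> \<Longrightarrow> 0 \<le> t \<Longrightarrow> t \<le> T \<Longrightarrow> integrable M \<xi>"
  by (intro sq_integrable_integrable bounded_F_sq_integrable)

lemma bounded_F_mult_sq_integrable:
  assumes "bounded_F t \<xi>" "0 \<le> t" "t \<le> T" "sq_integrable M g"
  shows "sq_integrable M (\<lambda>\<omega>. \<xi> \<omega> * g \<omega>)"
proof -
  obtain C where "\<And>\<omega>. \<omega> \<in> space M \<Longrightarrow> \<bar>\<xi> \<omega>\<bar> \<le> C" using assms(1) by (auto simp: bounded_F_def)
  then show ?thesis using bounded_F_M[OF assms(1-3)] assms(4) by (intro sq_integrable_bounded_mult)
qed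

lemma bounded_F_mult:
  assumes "bounded_F t \<xi>" "bounded_F t \<eta>"
  shows "bounded_F t (\<lambda>\<omega>. \<xi> \<omega> * \<eta> \<omega>)"
proof -
  obtain C D where CD: "\<And>\<omega>. \<omega> \<in> space M \<Longrightarrow> \<bar>\<xi> \<omega>\<bar> \<le> C" "\<And>\<omega>. \<omega> \<in> space M \<Longrightarrow> \<bar>\<eta> \<omega>\<bar> \<le> D"
    using assms by (auto simp: bounded_F_def)
  have "\<bar>\<xi> \<omega> * \<eta> \<omega>\<bar> \<le> \<bar>C\<bar> * \<bar>D\<bar>" if "\<omega> \<in> space M" for \<omega>
    unfolding abs_mult using CD[OF that] by (intro mult_mono) auto
  then show ?thesis using assms unfolding bounded_F_def by (auto intro: borel_measurable_times)
qed

text \<open>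
  The first increment is split at \<open>c\<close>, and the overlap of the two intervals is split off the
  second. Of the resulting products only the square of the increment over the overlap has a mean:
  in the others the later increment is independent of the remaining factors.
\<close>

lemma term_product_ordered:
  assumes ac: "a \<le> c" and ab: "0 \<le> a" "a \<le> b" "b \<le> T" and cd: "c \<le> d" "d \<le> T"
    and \<xi>: "bounded_F a \<xi>" and \<eta>: "bounded_F c \<eta>"
  shows "has_bochner_integral M (\<lambda>\<omega>. \<xi> \<omega> * (B b \<omega> - B a \<omega>) * (\<eta> \<omega> * (B d \<omega> - B c \<omega>)))
    (expectation (\<lambda>\<omega>. \<xi> \<omega> * \<eta> \<omega>) * max 0 (min b d - max a c))"
proof -
  have c: "0 \<le> c" "c \<le> T" using ac ab cd by auto
  have "bounded_F c \<xi>" by (rule bounded_F_mono[OF \<xi> ab(1) ac c(2)])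
  from bounded_F_mult[OF this \<eta>] have \<xi>\<eta>: "bounded_F c (\<lambda>\<omega>. \<xi> \<omega> * \<eta> \<omega>)" .
  have mean_zero: "has_bochner_integral M (\<lambda>\<omega>. (\<xi> \<omega> * \<eta> \<omega>) * (B v \<omega> - B u \<omega>) * (B y \<omega> - B x \<omega>)) 0"
    if uv: "0 \<le> u" "u \<le> v" and x: "v \<le> x" "c \<le> x" "x \<le> y" "y \<le> T" for u v x y
  proof (rule increment_mean_zero)
    have "bounded_F x (\<lambda>\<omega>. \<xi> \<omega> * \<eta> \<omega>)" by (rule bounded_F_mono[OF \<xi>\<eta>]) (use c x in auto)
    moreover have "B v \<in> borel_measurable (F x)" "B u \<in> borel_measurable (F x)"
      by (rule B_F; use uv x in linarith)+
    ultimately show "(\<lambda>\<omega>. \<xi> \<omega> * \<eta> \<omega> * (B v \<omega> - B u \<omega>)) \<in> borel_measurable (F x)"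
      by (auto simp: bounded_F_def)
    show "integrable M (\<lambda>\<omega>. \<xi> \<omega> * \<eta> \<omega> * (B v \<omega> - B u \<omega>))"
      by (intro sq_integrable_integrable bounded_F_mult_sq_integrable[OF \<xi>\<eta> c] increment_sq_integrable)
        (use uv x in auto)
  qed (use uv x in auto)
  show ?thesis
  proof (cases "b \<le> c")
    case True
    have "has_bochner_integral M (\<lambda>\<omega>. (\<xi> \<omega> * \<eta> \<omega>) * (B b \<omega> - B a \<omega>) * (B d \<omega> - B c \<omega>)) 0"
      by (rule mean_zero) (use True ab cd in auto)
    moreover have "max 0 (min b d - max a c) = 0" using True ac ab by auto
    ultimately show ?thesis by (simp add: mult_ac)
  next
    case False
    define m where "m = min b d"
    define l where "l = max b d"
    have m: "c \<le> m" "m \<le> l" "l \<le> T" "m \<le> T" "0 \<le> m" using False ab cd c by (auto simp: m_def l_def)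
    have 1: "has_bochner_integral M (\<lambda>\<omega>. (\<xi> \<omega> * \<eta> \<omega>) * (B c \<omega> - B a \<omega>) * (B d \<omega> - B c \<omega>)) 0"
      by (rule mean_zero) (use ac ab cd in auto)
    have 2: "has_bochner_integral M (\<lambda>\<omega>. (\<xi> \<omega> * \<eta> \<omega>) * (B m \<omega> - B c \<omega>)\<^sup>2)
        (expectation (\<lambda>\<omega>. \<xi> \<omega> * \<eta> \<omega>) * (m - c))"
      using increment_mult[where g="\<lambda>x. x\<^sup>2", OF c(1) m(1,4) _ bounded_F_integrable[OF \<xi>\<eta> c] _
         increment_moments(3)[OF c(1) m(1,4)]] \<xi>\<eta> by (simp add: bounded_F_def)
    have 3: "has_bochner_integral M (\<lambda>\<omega>. (\<xi> \<omega> * \<eta> \<omega>) * (B m \<omega> - B c \<omega>) * (B l \<omega> - B m \<omega>)) 0"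
      by (rule mean_zero) (use m c in auto)
    have "\<xi> \<omega> * (B b \<omega> - B a \<omega>) * (\<eta> \<omega> * (B d \<omega> - B c \<omega>)) = (\<xi> \<omega> * \<eta> \<omega>) * (B c \<omega> - B a \<omega>) * (B d \<omega> - B c \<omega>)
      + (\<xi> \<omega> * \<eta> \<omega>) * (B m \<omega> - B c \<omega>)\<^sup>2 + (\<xi> \<omega> * \<eta> \<omega>) * (B m \<omega> - B c \<omega>) * (B l \<omega> - B m \<omega>)" for \<omega>
      by (cases "b \<le> d") (simp_all add: m_def l_def power2_eq_square algebra_simps)
    moreover have "max 0 (min b d - max a c) = m - c" using m ac by (auto simp: m_def)
    ultimately show ?thesis
      using has_bochner_integral_add[OF has_bochner_integral_add[OF 1 2] 3] by simp
  qed
qed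

lemma term_product:
  assumes ab: "0 \<le> a" "a \<le> b" "b \<le> T" and cd: "0 \<le> c" "c \<le> d" "d \<le> T"
    and \<xi>: "bounded_F a \<xi>" and \<eta>: "bounded_F c \<eta>"
  shows "has_bochner_integral M (\<lambda>\<omega>. \<xi> \<omega> * (B b \<omega> - B a \<omega>) * (\<eta> \<omega> * (B d \<omega> - B c \<omega>)))
    (expectation (\<lambda>\<omega>. \<xi> \<omega> * \<eta> \<omega>) * max 0 (min b d - max a c))"
proof (cases "a \<le> c")
  case True
  then show ?thesis by (rule term_product_ordered[OF _ ab cd(2,3) \<xi> \<eta>])
next
  case False
  then have "c \<le> a" by simp
  from term_product_ordered[OF this cd ab(2,3) \<eta> \<xi>] show ?thesis
    by (simp add: mult.commute min.commute max.commute)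
qed

text \<open>
  Processes are viewed as functions on \<open>\<Omega> \<times> \<real>\<close>, set to zero outside the times in \<open>A\<close>, so that
  integrals over all time horizons live in the one space \<open>L\<^sup>2\<close> of the product of \<open>M\<close> with
  Lebesgue measure.
\<close>

definition cut :: "real set \<Rightarrow> (real \<Rightarrow> 'a \<Rightarrow> real) \<Rightarrow> 'a \<times> real \<Rightarrow> real" where
  "cut A \<alpha> x = indicator A (snd x) * \<alpha> (snd x) (fst x)"

definition term_integral :: "real \<Rightarrow> ('a \<Rightarrow> real) \<Rightarrow> real \<Rightarrow> real \<Rightarrow> 'a \<Rightarrow> real" where
  "term_integral s \<xi> a b \<omega> = \<xi> \<omega> * (B (min b s) \<omega> - B (min a s) \<omega>)"

lemma term_integral_sq_integrable:
  assumes "0 \<le> a" "a \<le> b" "b \<le> T" "0 \<le> s" "bounded_F a \<xi>"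
  shows "sq_integrable M (term_integral s \<xi> a b)"
  unfolding term_integral_def
  by (intro bounded_F_mult_sq_integrable[OF assms(5)] increment_sq_integrable) (use assms in auto)

lemma indicator_Int_length:
  "(\<integral>r. indicator {0..s} r * indicator {a<..b} r * (indicator {0..u} r * indicator {c<..d} r) \<partial>lborel)
    = max 0 (min (min b s) (min d u) - max a (c :: real))"
  if "0 \<le> a" "0 \<le> c" for a b c d s u :: real
proof -
  have "indicator {0..s} r * indicator {a<..b} r * (indicator {0..u} r * indicator {c<..d} r)
    = (indicator {max a c<..min (min b s) (min d u)} r :: real)" for r
    using that by (auto simp: indicator_def)
  moreover have "(\<integral>r. indicator {l<..h} r \<partial>lborel) = max 0 (h - l)" for l h :: real
    by (cases "l \<le> h") auto
  ultimately show ?thesis by (simp only:)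
qed

text \<open>
  A term with \<open>s < a\<close> is zero although its coefficient is measurable only at the later time \<open>a\<close>; this
  case has to be separated.
\<close>

lemma term_isometry:
  assumes ab: "0 \<le> a" "a \<le> b" "b \<le> T" and cd: "0 \<le> c" "c \<le> d" "d \<le> T" and su: "0 \<le> s" "0 \<le> u"
    and \<xi>: "bounded_F a \<xi>" and \<eta>: "bounded_F c \<eta>"
  shows "expectation (\<lambda>\<omega>. term_integral s \<xi> a b \<omega> * term_integral u \<eta> c d \<omega>) =
    (\<integral>x. cut {0..s} (\<lambda>r \<omega>. \<xi> \<omega> * indicator {a<..b} r) x * cut {0..u} (\<lambda>r \<omega>. \<eta> \<omega> * indicator {c<..d} r) x
      \<partial>(M \<Otimes>\<^sub>M lborel))" (is "?L = ?R")
proof -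
  have aT: "a \<le> T" "c \<le> T" using ab cd by auto
  have i: "integrable M (\<lambda>\<omega>. \<xi> \<omega> * \<eta> \<omega>)"
    using bounded_F_sq_integrable[OF \<xi>] bounded_F_sq_integrable[OF \<eta>] ab cd aT by (intro sq_integrable_mult) auto
  have "?R = (\<integral>x. (\<xi> (fst x) * \<eta> (fst x)) * (indicator {0..s} (snd x) * indicator {a<..b} (snd x) *
      (indicator {0..u} (snd x) * indicator {c<..d} (snd x))) \<partial>(M \<Otimes>\<^sub>M lborel))"
    unfolding cut_def by (intro Bochner_Integration.integral_cong refl) (simp add: mult_ac)
  also have "\<dots> = expectation (\<lambda>\<omega>. \<xi> \<omega> * \<eta> \<omega>) * (\<integral>r. indicator {0..s} r * indicator {a<..b} r *
      (indicator {0..u} r * indicator {c<..d} r) \<partial>lborel)"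
  proof (rule P.integral_product_mult[OF i])
    have "integrable lborel (\<lambda>r. indicator ({0..s} \<inter> {a<..b} \<inter> ({0..u} \<inter> {c<..d})) r :: real)"
      by (intro integrable_real_indicator emeasure_bounded_finite) (auto intro: bounded_subset[of "{a..b}"])
    then show "integrable lborel (\<lambda>r. indicator {0..s} r * indicator {a<..b} r * (indicator {0..u} r * indicator {c<..d} r) :: real)"
      by (simp only: indicator_inter_arith)
  qed
  also have "\<dots> = expectation (\<lambda>\<omega>. \<xi> \<omega> * \<eta> \<omega>) * max 0 (min (min b s) (min d u) - max a c)"
    using ab cd by (simp only: indicator_Int_length)
  also have "\<dots> = ?L"
  proof (cases "a \<le> s \<and> c \<le> u")
    case True
    have "has_bochner_integral M (\<lambda>\<omega>. \<xi> \<omega> * (B (min b s) \<omega> - B a \<omega>) * (\<eta> \<omega> * (B (min d u) \<omega> - B c \<omega>)))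
      (expectation (\<lambda>\<omega>. \<xi> \<omega> * \<eta> \<omega>) * max 0 (min (min b s) (min d u) - max a c))"
      by (rule term_product) (use True assms in auto)
    then show ?thesis using True by (simp add: term_integral_def has_bochner_integral_iff)
  next
    case False
    then have "(\<lambda>\<omega>. term_integral s \<xi> a b \<omega> * term_integral u \<eta> c d \<omega>) = (\<lambda>\<omega>. 0)"
      using ab cd by (auto simp: term_integral_def min_def)
    moreover have "max 0 (min (min b s) (min d u) - max a c) = 0" using False ab cd by auto
    ultimately show ?thesis by simp
  qed
  finally show ?thesis by simp
qed

lemma cut_term_sq_integrable:
  assumes "0 \<le> a" "a \<le> T" "bounded_F a \<xi>"
  shows "sq_integrable (M \<Otimes>\<^sub>M lborel) (cut {0..s} (\<lambda>r \<omega>. \<xi> \<omega> * indicator {a<..b} r))"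
proof -
  have [measurable]: "\<xi> \<in> borel_measurable M" by (rule bounded_F_M[OF assms(3,1,2)])
  have e: "(cut {0..s} (\<lambda>r \<omega>. \<xi> \<omega> * indicator {a<..b} r) x)\<^sup>2 = (\<xi> (fst x))\<^sup>2 * indicator ({0..s} \<inter> {a<..b}) (snd x)" for x
    by (auto simp: cut_def indicator_def)
  have "integrable (M \<Otimes>\<^sub>M lborel) (\<lambda>x. (\<xi> (fst x))\<^sup>2 * indicator ({0..s} \<inter> {a<..b}) (snd x))"
  proof (rule P.integrable_product_mult)
    show "integrable M (\<lambda>\<omega>. (\<xi> \<omega>)\<^sup>2)"
      using bounded_F_sq_integrable[OF assms(3,1,2)] by (rule sq_integrable_square)
    show "integrable lborel (indicator ({0..s} \<inter> {a<..b}) :: real \<Rightarrow> real)"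
      by (intro integrable_real_indicator emeasure_bounded_finite) (auto intro: bounded_subset[of "{a..b}"])
  qed
  moreover have "cut {0..s} (\<lambda>r \<omega>. \<xi> \<omega> * indicator {a<..b} r) \<in> borel_measurable (M \<Otimes>\<^sub>M lborel)"
    unfolding cut_def by measurable
  ultimately show ?thesis unfolding sq_integrable_def e by simp
qed

lemma simple_integrand_iff:
  "simple_integrand M F T n \<tau> \<xi> \<longleftrightarrow>
     0 \<le> \<tau> 0 \<and> (\<forall>i<n. \<tau> i \<le> \<tau> (Suc i)) \<and> \<tau> n \<le> T \<and> (\<forall>i<n. bounded_F (\<tau> i) (\<xi> i))"
  by (simp add: simple_integrand_def bounded_F_def)

lemma simple_integrand_terms:
  assumes "simple_integrand M F T n \<tau> \<xi>" "i < n"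
  shows "0 \<le> \<tau> i" "\<tau> i \<le> \<tau> (Suc i)" "\<tau> (Suc i) \<le> T" "\<tau> i \<le> T" "bounded_F (\<tau> i) (\<xi> i)"
proof -
  have step: "\<forall>i<n. \<tau> i \<le> \<tau> (Suc i)" and ends: "0 \<le> \<tau> 0" "\<tau> n \<le> T"
    using assms(1) by (auto simp: simple_integrand_iff)
  have mono: "\<tau> j \<le> \<tau> k" if "j \<le> k" "k \<le> n" for j k
    using that by (induction k rule: dec_induct) (use step in \<open>auto intro: order.trans\<close>)
  show "0 \<le> \<tau> i" using mono[of 0 i] ends assms(2) by auto
  show "\<tau> i \<le> \<tau> (Suc i)" using step assms(2) by auto
  show "\<tau> (Suc i) \<le> T" using mono[of "Suc i" n] ends assms(2) by auto
  show "\<tau> i \<le> T" using mono[of i n] ends assms(2) by auto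
  show "bounded_F (\<tau> i) (\<xi> i)" using assms by (auto simp: simple_integrand_iff)
qed

lemma simple_integral_eq: "simple_integral B n \<tau> \<xi> s \<omega> = (\<Sum>i<n. term_integral s (\<xi> i) (\<tau> i) (\<tau> (Suc i)) \<omega>)"
  by (simp add: simple_integral_def term_integral_def)

lemma cut_simple_process:
  "cut A (simple_process n \<tau> \<xi>) x = (\<Sum>i<n. cut A (\<lambda>r \<omega>. \<xi> i \<omega> * indicator {\<tau> i<..\<tau> (Suc i)} r) x)"
  unfolding cut_def simple_process_def by (rule sum_distrib_left)

lemma simple_integral_sq_integrable:
  assumes "simple_integrand M F T n \<tau> \<xi>" "0 \<le> s"
  shows "sq_integrable M (simple_integral B n \<tau> \<xi> s)"
  unfolding simple_integral_eq[abs_def]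
  by (intro sq_integrable_sum term_integral_sq_integrable)
    (use simple_integrand_terms[OF assms(1)] assms(2) in auto)

lemma cut_simple_sq_integrable:
  assumes "simple_integrand M F T n \<tau> \<xi>"
  shows "sq_integrable (M \<Otimes>\<^sub>M lborel) (cut {0..s} (simple_process n \<tau> \<xi>))"
  unfolding cut_simple_process[abs_def]
  by (intro sq_integrable_sum cut_term_sq_integrable) (use simple_integrand_terms[OF assms(1)] in auto)

text \<open>
  The polarized isometry for two unrelated partitions: the double sum is expanded term by term,
  without passing to a common refinement.
\<close>

lemma simple_isometry:
  assumes S: "simple_integrand M F T n \<tau> \<xi>" and R: "simple_integrand M F T m \<sigma> \<eta>" and su: "0 \<le> s" "0 \<le> u"
  shows "expectation (\<lambda>\<omega>. simple_integral B n \<tau> \<xi> s \<omega> * simple_integral B m \<sigma> \<eta> u \<omega>) =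
    (\<integral>x. cut {0..s} (simple_process n \<tau> \<xi>) x * cut {0..u} (simple_process m \<sigma> \<eta>) x \<partial>(M \<Otimes>\<^sub>M lborel))"
proof -
  note tS = simple_integrand_terms[OF S] and tR = simple_integrand_terms[OF R]
  have "expectation (\<lambda>\<omega>. simple_integral B n \<tau> \<xi> s \<omega> * simple_integral B m \<sigma> \<eta> u \<omega>) =
    (\<Sum>i<n. \<Sum>j<m. expectation (\<lambda>\<omega>. term_integral s (\<xi> i) (\<tau> i) (\<tau> (Suc i)) \<omega> * term_integral u (\<eta> j) (\<sigma> j) (\<sigma> (Suc j)) \<omega>))"
    unfolding simple_integral_eq
    by (intro integral_sum_product sq_integrable_mult term_integral_sq_integrable) (use tS tR su in auto)
  also have "\<dots> = (\<Sum>i<n. \<Sum>j<m. \<integral>x. cut {0..s} (\<lambda>r \<omega>. \<xi> i \<omega> * indicator {\<tau> i<..\<tau> (Suc i)} r) x *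
      cut {0..u} (\<lambda>r \<omega>. \<eta> j \<omega> * indicator {\<sigma> j<..\<sigma> (Suc j)} r) x \<partial>(M \<Otimes>\<^sub>M lborel))"
    by (intro sum.cong refl term_isometry) (use tS tR su in auto)
  also have "\<dots> = (\<integral>x. cut {0..s} (simple_process n \<tau> \<xi>) x * cut {0..u} (simple_process m \<sigma> \<eta>) x \<partial>(M \<Otimes>\<^sub>M lborel))"
    unfolding cut_simple_process
    by (intro integral_sum_product[symmetric] sq_integrable_mult cut_term_sq_integrable) (use tS tR su in auto)
  finally show ?thesis .
qed

text \<open>
  Clamping the partition to \<open>[t,s]\<close> turns the increment of the integral over \<open>[t,s]\<close> into a sum of
  terms inside \<open>[t,s]\<close>, to which the assumption on single terms applies.
\<close>

lemma simple_integral_weight: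
  assumes S: "simple_integrand M F T n \<tau> \<xi>" and ts: "0 \<le> t" "t \<le> s" "s \<le> T"
    and N: "sq_integrable M N" and \<kappa>: "sq_integrable (M \<Otimes>\<^sub>M lborel) \<kappa>"
    and weight: "\<And>a b \<eta>. t \<le> a \<Longrightarrow> a \<le> b \<Longrightarrow> b \<le> s \<Longrightarrow> bounded_F a \<eta> \<Longrightarrow>
      expectation (\<lambda>\<omega>. N \<omega> * (\<eta> \<omega> * (B b \<omega> - B a \<omega>))) =
      (\<integral>x. \<kappa> x * cut {a<..b} (\<lambda>_. \<eta>) x \<partial>(M \<Otimes>\<^sub>M lborel))"
  shows "expectation (\<lambda>\<omega>. N \<omega> * (simple_integral B n \<tau> \<xi> s \<omega> - simple_integral B n \<tau> \<xi> t \<omega>)) =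
    (\<integral>x. \<kappa> x * (cut {0..s} (simple_process n \<tau> \<xi>) x - cut {0..t} (simple_process n \<tau> \<xi>) x) \<partial>(M \<Otimes>\<^sub>M lborel))"
proof -
  note tS = simple_integrand_terms[OF S]
  have s: "0 \<le> s" using ts by auto
  let ?I = "\<lambda>u i \<omega>. term_integral u (\<xi> i) (\<tau> i) (\<tau> (Suc i)) \<omega>"
  let ?C = "\<lambda>u i. cut {0..u} (\<lambda>r \<omega>. \<xi> i \<omega> * indicator {\<tau> i<..\<tau> (Suc i)} r)"
  have "expectation (\<lambda>\<omega>. N \<omega> * (simple_integral B n \<tau> \<xi> s \<omega> - simple_integral B n \<tau> \<xi> t \<omega>)) =
      expectation (\<lambda>\<omega>. \<Sum>i<n. N \<omega> * (?I s i \<omega> - ?I t i \<omega>))"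
    unfolding simple_integral_eq by (simp only: sum_distrib_left flip: sum_subtractf)
  also have "\<dots> = (\<Sum>i<n. expectation (\<lambda>\<omega>. N \<omega> * (?I s i \<omega> - ?I t i \<omega>)))"
    by (intro Bochner_Integration.integral_sum sq_integrable_mult[OF N] sq_integrable_diff term_integral_sq_integrable)
      (use tS ts s in auto)
  also have "\<dots> = (\<Sum>i<n. \<integral>x. \<kappa> x * (?C s i x - ?C t i x) \<partial>(M \<Otimes>\<^sub>M lborel))"
  proof (intro sum.cong refl)
    fix i assume "i \<in> {..<n}"
    then have i: "i < n" by simp
    define a where "a = min (max (\<tau> i) t) s"
    define b where "b = min (max (\<tau> (Suc i)) t) s"
    have ab: "t \<le> a" "a \<le> b" "b \<le> s" "a \<le> T" using ts tS[OF i] by (auto simp: a_def b_def)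
    have I: "?I s i \<omega> - ?I t i \<omega> = \<xi> i \<omega> * (B b \<omega> - B a \<omega>)" for \<omega>
      unfolding term_integral_def a_def b_def using ts tS(2)[OF i]
      by (auto simp: min_def max_def algebra_simps)
    have C: "?C s i x - ?C t i x = cut {a<..b} (\<lambda>_. \<xi> i) x" for x
      unfolding cut_def a_def b_def using ts tS(1,2)[OF i] by (auto simp: indicator_def)
    show "expectation (\<lambda>\<omega>. N \<omega> * (?I s i \<omega> - ?I t i \<omega>)) = (\<integral>x. \<kappa> x * (?C s i x - ?C t i x) \<partial>(M \<Otimes>\<^sub>M lborel))"
    proof (cases "\<tau> i \<le> s")
      case True
      have "bounded_F a (\<xi> i)"
        by (rule bounded_F_mono[OF tS(5)[OF i] tS(1)[OF i]]) (use True ab in \<open>auto simp: a_def\<close>)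
      from weight[OF ab(1-3) this] show ?thesis by (simp only: I C)
    next
      case False
      then have "a = b" using ts tS[OF i] by (auto simp: a_def b_def)
      then have "?I s i \<omega> - ?I t i \<omega> = 0" "?C s i x - ?C t i x = 0" for \<omega> x
        unfolding I C by (simp_all add: cut_def)
      then show ?thesis by simp
    qed
  qed
  also have "\<dots> = (\<integral>x. (\<Sum>i<n. \<kappa> x * (?C s i x - ?C t i x)) \<partial>(M \<Otimes>\<^sub>M lborel))"
    by (intro Bochner_Integration.integral_sum[symmetric] sq_integrable_mult[OF \<kappa>] sq_integrable_diff cut_term_sq_integrable)
      (use tS in auto)
  finally show ?thesis
    unfolding cut_simple_process by (simp only: sum_distrib_left flip: sum_subtractf)
qed

end

section \<open>Density of the simple integrands\<close>

definition grid :: "real \<Rightarrow> nat \<Rightarrow> nat \<Rightarrow> real" where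
  "grid T n i = real i * (T / real n)"

text \<open>
  The value on a cell is the average over the preceding cell, so that it depends only on the past.
  The first cell has no past and gets the value \<open>0\<close>, which does not affect the limit.
\<close>

definition past_average :: "real \<Rightarrow> nat \<Rightarrow> (real \<Rightarrow> real) \<Rightarrow> nat \<Rightarrow> real" where
  "past_average T n f i = (case i of 0 \<Rightarrow> 0 | Suc j \<Rightarrow>
     real n / T * (\<integral>r. indicator {grid T n j<..grid T n (Suc j)} r * f r \<partial>lborel))"

definition past_average_step :: "real \<Rightarrow> nat \<Rightarrow> (real \<Rightarrow> real) \<Rightarrow> real \<Rightarrow> real" where
  "past_average_step T n f r =
     (\<Sum>i<n. past_average T n f i * indicator {grid T n i<..grid T n (Suc i)} r)"

lemma grid_0: "grid T n 0 = 0"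
  by (simp add: grid_def)

lemma grid_Suc: "grid T n (Suc i) = grid T n i + T / real n"
  by (simp add: grid_def distrib_right add_divide_distrib)

lemma grid_end: "n > 0 \<Longrightarrow> grid T n n = T"
  by (simp add: grid_def)

lemma grid_mono: "T \<ge> 0 \<Longrightarrow> i \<le> j \<Longrightarrow> grid T n i \<le> grid T n j"
  unfolding grid_def by (intro mult_right_mono) auto

lemma grid_nonneg: "T \<ge> 0 \<Longrightarrow> grid T n i \<ge> 0"
  by (simp add: grid_def)

lemma sum_indicator_grid:
  assumes "T \<ge> 0"
  shows "(\<Sum>i<m. indicator {grid T n i<..grid T n (Suc i)} r) = (indicator {0<..grid T n m} r :: real)"
proof (induction m)
  case (Suc m)
  have "0 \<le> grid T n m" "grid T n m \<le> grid T n (Suc m)" using assms by (auto intro: grid_nonneg grid_mono)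
  then have "indicator {0<..grid T n m} r + indicator {grid T n m<..grid T n (Suc m)} r
    = (indicator {0<..grid T n (Suc m)} r :: real)"
    by (auto simp: indicator_def)
  then show ?case using Suc by simp
qed (simp add: grid_0)

lemma bounded_integrable_interval:
  fixes f :: "real \<Rightarrow> real"
  assumes "f \<in> borel_measurable borel" "\<And>r. \<bar>f r\<bar> \<le> C"
  shows bounded_integrable_Ioc: "integrable lborel (\<lambda>r. indicator {a<..b} r * f r)"
    and bounded_integrable_Icc: "integrable lborel (\<lambda>r. indicator {a..b} r * f r)"
proof -
  have "integrable lborel (\<lambda>r. indicator A r * f r)" if "bounded A" "A \<in> sets borel" for A
  proof (rule Bochner_Integration.integrable_bound)
    show "integrable lborel (\<lambda>r. C * indicator A r)"
      using that by (intro integrable_mult_right integrable_real_indicator emeasure_bounded_finite) auto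
    show "AE r in lborel. norm (indicator A r * f r) \<le> norm (C * indicator A r)"
      using assms(2) by (auto simp: indicator_def intro!: AE_I2 order.trans[OF _ abs_ge_self])
  qed (use assms(1) that in measurable)
  then show "integrable lborel (\<lambda>r. indicator {a<..b} r * f r)" "integrable lborel (\<lambda>r. indicator {a..b} r * f r)"
    by auto
qed

lemma past_average_bound:
  assumes f: "f \<in> borel_measurable borel" "\<And>r. \<bar>f r\<bar> \<le> C" and T: "T > 0"
  shows "\<bar>past_average T n f i\<bar> \<le> C"
proof (cases "\<exists>j. i = Suc j \<and> n > 0")
  case False
  have "0 \<le> C" using f(2)[of 0] by linarith
  with False show ?thesis by (auto simp: past_average_def split: nat.split)
next
  case True
  then obtain j where j: "i = Suc j" "n > 0" by auto
  let ?J = "{grid T n j<..grid T n (Suc j)}"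
  have "T / n > 0" using j T by simp
  have "\<bar>\<integral>r. indicator ?J r * f r \<partial>lborel\<bar> \<le> (\<integral>r. \<bar>indicator ?J r * f r\<bar> \<partial>lborel)"
    by (rule integral_abs_bound)
  also have "\<dots> \<le> (\<integral>r. indicator ?J r * C \<partial>lborel)"
    by (intro integral_mono integrable_abs bounded_integrable_Ioc[OF f] bounded_integrable_Ioc[of "\<lambda>_. C" "\<bar>C\<bar>"])
      (auto simp: abs_mult indicator_def f(2))
  also have "\<dots> = C * (T / n)" using \<open>T / n > 0\<close> by (simp add: grid_Suc)
  finally have "real n / T * \<bar>\<integral>r. indicator ?J r * f r \<partial>lborel\<bar> \<le> real n / T * (C * (T / n))"
    using T by (intro mult_left_mono) auto
  also have "\<dots> = C" using T j by simp
  finally show ?thesis using j T by (simp add: past_average_def abs_mult)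
qed

lemma past_average_diff:
  assumes f: "f \<in> borel_measurable borel" "\<And>r. \<bar>f r\<bar> \<le> C"
    and g: "g \<in> borel_measurable borel" "\<And>r. \<bar>g r\<bar> \<le> D"
  shows "past_average T n (\<lambda>r. f r - g r) i = past_average T n f i - past_average T n g i"
  using bounded_integrable_Ioc[OF f] bounded_integrable_Ioc[OF g]
  by (simp add: past_average_def right_diff_distrib split: nat.split)

lemma past_average_step_measurable [measurable]: "past_average_step T n f \<in> borel_measurable borel"
  unfolding past_average_step_def by measurable

lemma past_average_step_eq:
  assumes "T > 0" "i < n" "r \<in> {grid T n i<..grid T n (Suc i)}"
  shows "past_average_step T n f r = past_average T n f i"
proof -
  have ind: "indicator {grid T n j<..grid T n (Suc j)} r = (if j = i then 1 else 0 :: real)" for j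
  proof (cases j i rule: linorder_cases)
    case less
    then have "grid T n (Suc j) \<le> grid T n i" using assms by (intro grid_mono) auto
    then show ?thesis using less assms(3) by (auto simp: indicator_def)
  next
    case greater
    then have "grid T n (Suc i) \<le> grid T n j" using assms by (intro grid_mono) auto
    then show ?thesis using greater assms(3) by (auto simp: indicator_def)
  qed (use assms(3) in simp)
  show ?thesis unfolding past_average_step_def ind using assms(2) by (simp add: if_distrib cong: if_cong)
qed

lemma past_average_step_outside:
  assumes "T > 0" "r \<notin> {0<..T}"
  shows "past_average_step T n f r = 0"
proof -
  have "indicator {grid T n i<..grid T n (Suc i)} r = (0 :: real)" if "i < n" for i
  proof -
    have "grid T n (Suc i) \<le> grid T n n" using that assms by (intro grid_mono) auto
    moreover have "0 \<le> grid T n i" using assms by (intro grid_nonneg) auto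
    ultimately show ?thesis using assms that grid_end[of n T] by (auto simp: indicator_def)
  qed
  then show ?thesis by (simp add: past_average_step_def)
qed

lemma grid_cell:
  fixes n :: nat
  assumes "T > 0" "r \<in> {0<..T}" "n > 0"
  shows "\<exists>i<n. r \<in> {grid T n i<..grid T n (Suc i)}"
proof (rule ccontr)
  assume "\<not> ?thesis"
  then have "(\<Sum>i<n. indicator {grid T n i<..grid T n (Suc i)} r) = (0::real)"
    by (intro sum.neutral) (auto simp: indicator_def)
  then show False using assms by (subst (asm) sum_indicator_grid) (auto simp: grid_end)
qed

lemma past_average_step_bound:
  assumes f: "f \<in> borel_measurable borel" "\<And>r. \<bar>f r\<bar> \<le> C" and T: "T > 0"
  shows "\<bar>past_average_step T n f r\<bar> \<le> C"
proof (cases "r \<in> {0<..T} \<and> n > 0")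
  case True
  then obtain i where "i < n" "r \<in> {grid T n i<..grid T n (Suc i)}" using grid_cell[OF T, of r n] by blast
  then show ?thesis using past_average_step_eq[OF T] past_average_bound[OF f T] by simp
next
  case False
  have "0 \<le> C" using f(2)[of 0] by linarith
  have "past_average_step T n f r = 0"
    using False past_average_step_outside[OF T] by (cases "n = 0") (auto simp: past_average_step_def)
  with \<open>0 \<le> C\<close> show ?thesis by simp
qed

text \<open>
  Each cell contributes at most the integral of \<open>\<bar>f\<bar>\<close> over its predecessor.
\<close>

lemma past_average_step_contraction:
  assumes f: "f \<in> borel_measurable borel" "\<And>r. \<bar>f r\<bar> \<le> C" and T: "T > 0"
  shows "(\<integral>r. indicator {0..T} r * \<bar>past_average_step T n f r\<bar> \<partial>lborel) \<le> (\<integral>r. indicator {0..T} r * \<bar>f r\<bar> \<partial>lborel)"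
proof (cases "n = 0")
  case True
  then show ?thesis by (simp add: past_average_step_def)
next
  case False
  let ?h = "T / real n"
  let ?J = "\<lambda>i. {grid T n i<..grid T n (Suc i)}"
  have h: "?h > 0" using False T by auto
  have absf: "(\<lambda>r. \<bar>f r\<bar>) \<in> borel_measurable borel" "\<And>r. \<bar>\<bar>f r\<bar>\<bar> \<le> C" using f by auto
  note int = bounded_integrable_Ioc[OF absf]
  have av: "\<bar>past_average T n f (Suc i)\<bar> * ?h \<le> (\<integral>r. indicator (?J i) r * \<bar>f r\<bar> \<partial>lborel)" for i
  proof -
    have "\<bar>past_average T n f (Suc i)\<bar> * ?h = \<bar>\<integral>r. indicator (?J i) r * f r \<partial>lborel\<bar>"
      using False T by (simp add: past_average_def abs_mult)
    also have "\<dots> \<le> (\<integral>r. \<bar>indicator (?J i) r * f r\<bar> \<partial>lborel)" by (rule integral_abs_bound)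
    finally show ?thesis by (simp add: abs_mult)
  qed
  have "(\<integral>r. indicator {0..T} r * \<bar>past_average_step T n f r\<bar> \<partial>lborel)
    \<le> (\<integral>r. (\<Sum>i<n. \<bar>past_average T n f i\<bar> * indicator (?J i) r) \<partial>lborel)"
  proof (rule integral_mono)
    show "integrable lborel (\<lambda>r. indicator {0..T} r * \<bar>past_average_step T n f r\<bar>)"
      by (rule bounded_integrable_Icc[of _ C]) (use past_average_step_bound[OF f T] in auto)
    show "integrable lborel (\<lambda>r. \<Sum>i<n. \<bar>past_average T n f i\<bar> * indicator (?J i) r)"
      by (intro Bochner_Integration.integrable_sum integrable_mult_right integrable_real_indicator emeasure_bounded_finite) auto
    fix r
    have "indicator {0..T} r * \<bar>past_average_step T n f r\<bar> \<le> \<bar>past_average_step T n f r\<bar>"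
      by (auto simp: indicator_def)
    also have "\<dots> \<le> (\<Sum>i<n. \<bar>past_average T n f i * indicator (?J i) r\<bar>)"
      unfolding past_average_step_def by (rule sum_abs)
    finally show "indicator {0..T} r * \<bar>past_average_step T n f r\<bar> \<le> (\<Sum>i<n. \<bar>past_average T n f i\<bar> * indicator (?J i) r)"
      by (simp add: abs_mult)
  qed
  also have "\<dots> = (\<Sum>i<n. \<integral>r. \<bar>past_average T n f i\<bar> * indicator (?J i) r \<partial>lborel)"
    by (intro Bochner_Integration.integral_sum integrable_mult_right integrable_real_indicator emeasure_bounded_finite) auto
  also have "\<dots> = (\<Sum>i<n. \<bar>past_average T n f i\<bar> * ?h)"
    using h by (intro sum.cong refl) (simp add: grid_Suc)
  also have "\<dots> = (\<Sum>i<n - 1. \<bar>past_average T n f (Suc i)\<bar> * ?h)"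
    using False by (subst (1) Suc_pred'[of n]) (auto simp only: sum.lessThan_Suc_shift past_average_def nat.case abs_zero mult_zero_left add_0)
  also have "\<dots> \<le> (\<Sum>i<n - 1. \<integral>r. indicator (?J i) r * \<bar>f r\<bar> \<partial>lborel)"
    by (intro sum_mono av)
  also have "\<dots> \<le> (\<Sum>i<n. \<integral>r. indicator (?J i) r * \<bar>f r\<bar> \<partial>lborel)"
    by (intro sum_mono2) auto
  also have "\<dots> = (\<integral>r. (\<Sum>i<n. indicator (?J i) r * \<bar>f r\<bar>) \<partial>lborel)"
    by (intro Bochner_Integration.integral_sum[symmetric] int)
  also have "\<dots> = (\<integral>r. indicator {0<..T} r * \<bar>f r\<bar> \<partial>lborel)"
    using False T by (simp only: sum_distrib_right[symmetric] sum_indicator_grid less_imp_le grid_end neq0_conv)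
  also have "\<dots> \<le> (\<integral>r. indicator {0..T} r * \<bar>f r\<bar> \<partial>lborel)"
    by (intro integral_mono int bounded_integrable_Icc[OF absf]) (auto simp: indicator_def)
  finally show ?thesis .
qed

text \<open>
  For \<open>n\<close> large the point \<open>r\<close> is not in the first cell, and \<open>r\<close> and the averaged cell lie in an interval of
  length \<open>2 T / n\<close>.
\<close>

lemma past_average_step_tendsto:
  assumes g: "continuous_on UNIV g" "\<And>r. \<bar>g r\<bar> \<le> C" and T: "T > 0" and r: "r \<in> {0<..T}"
  shows "(\<lambda>n. past_average_step T n g r) \<longlonglongrightarrow> g r"
proof (rule LIMSEQ_I)
  fix e :: real assume "e > 0"
  have gm: "g \<in> borel_measurable borel" using g(1) by (rule borel_measurable_continuous_onI)
  have "\<exists>d>0. \<forall>y\<in>UNIV. dist y r < d \<longrightarrow> dist (g y) (g r) < e / 2"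
    using g(1)[unfolded continuous_on_iff] \<open>e > 0\<close> half_gt_zero by blast
  then obtain d where d: "d > 0" "\<And>y. \<bar>y - r\<bar> < d \<Longrightarrow> \<bar>g y - g r\<bar> < e / 2"
    by (auto simp: dist_real_def)
  obtain N :: nat where N: "real N > max (2 * T / d) (T / r)" using reals_Archimedean2 by blast
  have "\<bar>past_average_step T n g r - g r\<bar> < e" if "n \<ge> N" for n
  proof -
    have n: "real n > 2 * T / d" "real n > T / r" using N that by auto
    have "0 < T / r" using T r by simp
    then have "n > 0" using n by (cases n) auto
    let ?h = "T / real n"
    have h: "?h > 0" "2 * ?h < d" "?h < r" using n \<open>n > 0\<close> T d(1) r by (auto simp: field_simps)
    obtain i where i: "i < n" "r \<in> {grid T n i<..grid T n (Suc i)}" using grid_cell[OF T r \<open>n > 0\<close>] by blast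
    have "i \<noteq> 0" using i h by (cases i) (auto simp: grid_0 grid_Suc)
    then obtain j where ij: "i = Suc j" by (cases i) auto
    let ?J = "{grid T n j<..grid T n (Suc j)}"
    have len: "grid T n (Suc j) - grid T n j = ?h" by (simp add: grid_Suc)
    have near: "\<bar>g y - g r\<bar> \<le> e / 2" if "y \<in> ?J" for y
    proof (rule less_imp_le, rule d(2))
      show "\<bar>y - r\<bar> < d" using i that h by (auto simp: ij grid_Suc)
    qed
    have ig: "integrable lborel (\<lambda>y. indicator ?J y * g y)" "integrable lborel (\<lambda>y. indicator ?J y * g r)"
      by (rule bounded_integrable_Ioc[OF gm g(2)], rule bounded_integrable_Ioc[of _ C]) (use g(2) in auto)
    have "\<bar>(\<integral>y. indicator ?J y * g y \<partial>lborel) - ?h * g r\<bar> = \<bar>(\<integral>y. indicator ?J y * g y \<partial>lborel) - (\<integral>y. indicator ?J y * g r \<partial>lborel)\<bar>"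
      using h by (simp add: grid_Suc)
    also have "\<dots> = \<bar>\<integral>y. indicator ?J y * (g y - g r) \<partial>lborel\<bar>"
      using ig by (simp add: right_diff_distrib)
    also have "\<dots> \<le> (\<integral>y. \<bar>indicator ?J y * (g y - g r)\<bar> \<partial>lborel)" by (rule integral_abs_bound)
    also have "\<dots> \<le> (\<integral>y. indicator ?J y * (e / 2) \<partial>lborel)"
    proof (rule integral_mono)
      show "integrable lborel (\<lambda>y. \<bar>indicator ?J y * (g y - g r)\<bar>)"
        using Bochner_Integration.integrable_diff[OF ig] by (intro integrable_abs) (simp add: right_diff_distrib)
      show "integrable lborel (\<lambda>y. indicator ?J y * (e / 2))"
        by (rule bounded_integrable_Ioc[of _ "e/2"]) (use \<open>e > 0\<close> in auto)
      show "\<bar>indicator ?J y * (g y - g r)\<bar> \<le> indicator ?J y * (e / 2)" for y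
        using near[of y] by (auto simp: indicator_def)
    qed
    also have "\<dots> = ?h * (e / 2)" using h by (simp add: grid_Suc)
    finally have "\<bar>(\<integral>y. indicator ?J y * g y \<partial>lborel) - ?h * g r\<bar> \<le> ?h * (e / 2)" .
    then have le: "real n / T * \<bar>(\<integral>y. indicator ?J y * g y \<partial>lborel) - ?h * g r\<bar> \<le> real n / T * (?h * (e / 2))"
      using T by (intro mult_left_mono) auto
    have "past_average_step T n g r - g r = real n / T * ((\<integral>y. indicator ?J y * g y \<partial>lborel) - ?h * g r)"
      using past_average_step_eq[OF T i] T \<open>n > 0\<close> by (simp add: ij past_average_def right_diff_distrib)
    then have "\<bar>past_average_step T n g r - g r\<bar> = real n / T * \<bar>(\<integral>y. indicator ?J y * g y \<partial>lborel) - ?h * g r\<bar>"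
      using T by (simp only: abs_mult abs_divide abs_of_nat abs_of_pos)
    also note le
    also have "real n / T * (?h * (e / 2)) < e" using T \<open>n > 0\<close> \<open>e > 0\<close> by simp
    finally show ?thesis .
  qed
  then show "\<exists>N. \<forall>n\<ge>N. norm (past_average_step T n g r - g r) < e" by auto
qed

text \<open>
  A bounded Borel function is an almost everywhere limit of continuous functions, which may be
  truncated to keep the bound.
\<close>

lemma bounded_borel_continuous_approx:
  fixes f :: "real \<Rightarrow> real"
  assumes f: "f \<in> borel_measurable borel" "\<And>r. \<bar>f r\<bar> \<le> C"
  obtains g where "\<And>m. continuous_on UNIV (g m)" "\<And>m r. \<bar>g m r\<bar> \<le> C"
    "AE r in lborel. (\<lambda>m::nat. g m r) \<longlonglongrightarrow> f r"
proof -
  have "f \<in> borel_measurable lebesgue" using f(1) by (simp add: measurable_completion)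
  then have "f measurable_on UNIV" by (intro lebesgue_measurable_imp_measurable_on_real) auto
  then obtain N h where N: "negligible N" and h: "\<And>m::nat. continuous_on UNIV (h m)"
    "\<And>r. r \<notin> N \<Longrightarrow> (\<lambda>m. h m r) \<longlonglongrightarrow> f r"
    unfolding measurable_on_def by auto
  define g where "g m r = max (- C) (min C (h m r))" for m r
  have C: "0 \<le> C" using f(2)[of 0] by linarith
  show ?thesis
  proof
    show "continuous_on UNIV (g m)" for m unfolding g_def by (intro continuous_intros h)
    show "\<bar>g m r\<bar> \<le> C" for m r using C by (auto simp: g_def)
    have "(\<lambda>m. g m r) \<longlonglongrightarrow> f r" if "r \<notin> N" for r
    proof -
      have "(\<lambda>m. g m r) \<longlonglongrightarrow> max (- C) (min C (f r))"
        unfolding g_def by (intro tendsto_intros h that)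
      moreover have "max (- C) (min C (f r)) = f r" using f(2)[of r] by (auto simp: abs_le_iff)
      ultimately show ?thesis by simp
    qed
    moreover have "AE r in lebesgue. r \<notin> N" using N by (simp add: AE_not_in negligible_iff_null_sets)
    ultimately show "AE r in lborel. (\<lambda>m. g m r) \<longlonglongrightarrow> f r"
      by (subst AE_completion_iff[symmetric]) (auto elim: eventually_mono)
  qed
qed

text \<open>
  For continuous functions this is dominated convergence; the contraction property carries it
  over to limits in \<open>L\<^sup>1\<close>.
\<close>

lemma past_average_step_L1:
  fixes f :: "real \<Rightarrow> real"
  assumes f: "f \<in> borel_measurable borel" "\<And>r. \<bar>f r\<bar> \<le> C" and T: "T > 0"
  shows "(\<lambda>n. \<integral>r. indicator {0..T} r * \<bar>past_average_step T n f r - f r\<bar> \<partial>lborel) \<longlonglongrightarrow> 0"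
proof (rule LIMSEQ_I)
  fix e :: real assume "e > 0"
  obtain g where g: "\<And>m. continuous_on UNIV (g m)" "\<And>m r. \<bar>g m r\<bar> \<le> C"
    "AE r in lborel. (\<lambda>m::nat. g m r) \<longlonglongrightarrow> f r"
    using bounded_borel_continuous_approx[OF f] by blast
  have gm[measurable]: "g m \<in> borel_measurable borel" for m using g(1) by (rule borel_measurable_continuous_onI)
  have [measurable]: "f \<in> borel_measurable borel" by (rule f(1))
  have C: "0 \<le> C" using f(2)[of 0] by linarith
  have dom: "integrable lborel (\<lambda>r. indicator {0..T} r * (2 * C))"
    by (rule bounded_integrable_Icc[of _ "2 * C"]) (use C in auto)
  have "(\<lambda>m. \<integral>r. indicator {0..T} r * \<bar>f r - g m r\<bar> \<partial>lborel) \<longlonglongrightarrow> (\<integral>r. 0 \<partial>(lborel :: real measure))"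
  proof (rule integral_dominated_convergence[OF _ _ dom])
    show "AE r in lborel. (\<lambda>m. indicator {0..T} r * \<bar>f r - g m r\<bar>) \<longlonglongrightarrow> 0"
      using g(3) by eventually_elim (auto intro!: tendsto_eq_intros)
    have "\<bar>f r - g m r\<bar> \<le> 2 * C" for r m using f(2)[of r] g(2)[of m r] by linarith
    then show "AE r in lborel. norm (indicator {0..T} r * \<bar>f r - g m r\<bar>) \<le> indicator {0..T} r * (2 * C)" for m
      by (auto intro!: AE_I2 simp: indicator_def)
  qed measurable
  then have "eventually (\<lambda>m. (\<integral>r. indicator {0..T} r * \<bar>f r - g m r\<bar> \<partial>lborel) < e / 3) sequentially"
    using \<open>e > 0\<close> by (intro order_tendstoD) auto
  then obtain m where m: "(\<integral>r. indicator {0..T} r * \<bar>f r - g m r\<bar> \<partial>lborel) < e / 3"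
    by (auto simp: eventually_sequentially)
  have "(\<lambda>n. \<integral>r. indicator {0<..T} r * \<bar>past_average_step T n (g m) r - g m r\<bar> \<partial>lborel) \<longlonglongrightarrow> (\<integral>r. 0 \<partial>(lborel :: real measure))"
  proof (rule integral_dominated_convergence[OF _ _ dom])
    have "(\<lambda>n. indicator {0<..T} r * \<bar>past_average_step T n (g m) r - g m r\<bar>) \<longlonglongrightarrow> 0" for r
      using past_average_step_tendsto[OF g(1,2) T, of r]
      by (cases "r \<in> {0<..T}") (auto intro!: tendsto_eq_intros)
    then show "AE r in lborel. (\<lambda>n. indicator {0<..T} r * \<bar>past_average_step T n (g m) r - g m r\<bar>) \<longlonglongrightarrow> 0" by simp
    have "\<bar>past_average_step T n (g m) r - g m r\<bar> \<le> 2 * C" for r n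
      using past_average_step_bound[OF gm g(2) T, of n m r] g(2)[of m r] by linarith
    then show "AE r in lborel. norm (indicator {0<..T} r * \<bar>past_average_step T n (g m) r - g m r\<bar>) \<le> indicator {0..T} r * (2 * C)" for n
      using C by (auto intro!: AE_I2 simp: indicator_def)
  qed measurable
  then have "eventually (\<lambda>n. (\<integral>r. indicator {0<..T} r * \<bar>past_average_step T n (g m) r - g m r\<bar> \<partial>lborel) < e / 3) sequentially"
    using \<open>e > 0\<close> by (intro order_tendstoD) auto
  then obtain K where K: "\<And>n. n \<ge> K \<Longrightarrow> (\<integral>r. indicator {0<..T} r * \<bar>past_average_step T n (g m) r - g m r\<bar> \<partial>lborel) < e / 3"
    by (auto simp: eventually_sequentially)
  have "(\<integral>r. indicator {0..T} r * \<bar>past_average_step T n f r - f r\<bar> \<partial>lborel) < e" if "n \<ge> K" for n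
  proof -
    let ?A = "\<lambda>f. past_average_step T n f"
    let ?d = "\<lambda>r. f r - g m r"
    have "\<bar>?d r\<bar> \<le> 2 * C" for r using f(2)[of r] g(2)[of m r] by linarith
    then have d: "?d \<in> borel_measurable borel" "\<And>r. \<bar>?d r\<bar> \<le> 2 * C" by auto
    have Ad: "?A ?d r = ?A f r - ?A (g m) r" for r
      by (simp add: past_average_step_def past_average_diff[OF f gm g(2)] left_diff_distrib sum_subtractf)
    have b: "\<bar>?A (g m) r - g m r\<bar> \<le> 2 * C" for r
      using past_average_step_bound[OF gm g(2) T, of n m r] g(2)[of m r] by linarith
    have i1: "integrable lborel (\<lambda>r. indicator {0..T} r * \<bar>?A ?d r\<bar>)"
      by (rule bounded_integrable_Icc[of _ "2 * C"]) (use past_average_step_bound[OF d T] in auto)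
    have i2: "integrable lborel (\<lambda>r. indicator {0..T} r * \<bar>?A (g m) r - g m r\<bar>)"
      by (rule bounded_integrable_Icc[of _ "2 * C"]) (use b in auto)
    have i3: "integrable lborel (\<lambda>r. indicator {0..T} r * \<bar>?d r\<bar>)"
      by (rule bounded_integrable_Icc[of _ "2 * C"]) (use d in auto)
    have "(\<integral>r. indicator {0..T} r * \<bar>?A f r - f r\<bar> \<partial>lborel) \<le>
      (\<integral>r. indicator {0..T} r * \<bar>?A ?d r\<bar> + indicator {0..T} r * \<bar>?A (g m) r - g m r\<bar> + indicator {0..T} r * \<bar>?d r\<bar> \<partial>lborel)"
    proof (rule integral_mono)
      have "\<bar>?A f r - f r\<bar> \<le> 2 * C" for r
        using past_average_step_bound[OF f T, of n r] f(2)[of r] by linarith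
      then show "integrable lborel (\<lambda>r. indicator {0..T} r * \<bar>?A f r - f r\<bar>)"
        by (intro bounded_integrable_Icc[of _ "2 * C"]) auto
      show "indicator {0..T} r * \<bar>?A f r - f r\<bar> \<le> indicator {0..T} r * \<bar>?A ?d r\<bar> + indicator {0..T} r * \<bar>?A (g m) r - g m r\<bar> + indicator {0..T} r * \<bar>?d r\<bar>" for r
        unfolding Ad by (auto simp: indicator_def)
    qed (use i1 i2 i3 in auto)
    also have "\<dots> = (\<integral>r. indicator {0..T} r * \<bar>?A ?d r\<bar> \<partial>lborel) + (\<integral>r. indicator {0..T} r * \<bar>?A (g m) r - g m r\<bar> \<partial>lborel)
        + (\<integral>r. indicator {0..T} r * \<bar>?d r\<bar> \<partial>lborel)"
      using i1 i2 i3 by (simp only: Bochner_Integration.integral_add Bochner_Integration.integrable_add)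
    also have "(\<integral>r. indicator {0..T} r * \<bar>?A (g m) r - g m r\<bar> \<partial>lborel) = (\<integral>r. indicator {0<..T} r * \<bar>?A (g m) r - g m r\<bar> \<partial>lborel)"
    proof (rule integral_cong_AE)
      show "AE r in lborel. indicator {0..T} r * \<bar>?A (g m) r - g m r\<bar> = indicator {0<..T} r * \<bar>?A (g m) r - g m r\<bar>"
        using AE_lborel_singleton[of "0::real"] by eventually_elim (auto simp: indicator_def)
    qed measurable
    also have "(\<integral>r. indicator {0..T} r * \<bar>?A ?d r\<bar> \<partial>lborel) \<le> (\<integral>r. indicator {0..T} r * \<bar>?d r\<bar> \<partial>lborel)"
      by (rule past_average_step_contraction[OF d T])
    finally show ?thesis using m K[OF that] by linarith
  qed
  then show "\<exists>N. \<forall>n\<ge>N. norm ((\<integral>r. indicator {0..T} r * \<bar>past_average_step T n f r - f r\<bar> \<partial>lborel) - 0) < e"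
    by (auto intro!: exI[of _ K] simp: abs_of_nonneg Bochner_Integration.integral_nonneg)
qed

lemma past_average_step_L2:
  fixes f :: "real \<Rightarrow> real"
  assumes f: "f \<in> borel_measurable borel" "\<And>r. \<bar>f r\<bar> \<le> C" and T: "T > 0"
  shows "(\<lambda>n. \<integral>r. indicator {0..T} r * (past_average_step T n f r - f r)\<^sup>2 \<partial>lborel) \<longlonglongrightarrow> 0"
proof (rule tendsto_sandwich[OF _ _ tendsto_const])
  have [measurable]: "f \<in> borel_measurable borel" by (rule f(1))
  have b: "\<bar>past_average_step T n f r - f r\<bar> \<le> 2 * C" for r n
    using past_average_step_bound[OF f T, of n r] f(2)[of r] by linarith
  show "(\<lambda>n. 2 * C * (\<integral>r. indicator {0..T} r * \<bar>past_average_step T n f r - f r\<bar> \<partial>lborel)) \<longlonglongrightarrow> 0"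
    by (rule tendsto_mult_right_zero[OF past_average_step_L1[OF f T]])
  show "\<forall>\<^sub>F n in sequentially. (\<integral>r. indicator {0..T} r * (past_average_step T n f r - f r)\<^sup>2 \<partial>lborel)
     \<le> 2 * C * (\<integral>r. indicator {0..T} r * \<bar>past_average_step T n f r - f r\<bar> \<partial>lborel)"
  proof (intro always_eventually allI)
    fix n
    have sq: "(past_average_step T n f r - f r)\<^sup>2 \<le> 2 * C * \<bar>past_average_step T n f r - f r\<bar>" for r
      using mult_right_mono[OF b[of n r], of "\<bar>past_average_step T n f r - f r\<bar>"]
      by (simp add: power2_eq_square flip: abs_mult)
    have "(\<integral>r. indicator {0..T} r * (past_average_step T n f r - f r)\<^sup>2 \<partial>lborel)
      \<le> (\<integral>r. 2 * C * (indicator {0..T} r * \<bar>past_average_step T n f r - f r\<bar>) \<partial>lborel)"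
    proof (rule integral_mono)
      show "integrable lborel (\<lambda>r. indicator {0..T} r * (past_average_step T n f r - f r)\<^sup>2)"
      proof (rule bounded_integrable_Icc)
        show "\<bar>(past_average_step T n f r - f r)\<^sup>2\<bar> \<le> (2 * C)\<^sup>2" for r
          using power_mono[OF b[of n r] abs_ge_zero, of 2] by simp
      qed measurable
      show "integrable lborel (\<lambda>r. 2 * C * (indicator {0..T} r * \<bar>past_average_step T n f r - f r\<bar>))"
        by (intro integrable_mult_right bounded_integrable_Icc[of _ "2 * C"]) (use b in auto)
    qed (use sq in \<open>auto simp: indicator_def\<close>)
    then show "(\<integral>r. indicator {0..T} r * (past_average_step T n f r - f r)\<^sup>2 \<partial>lborel)
      \<le> 2 * C * (\<integral>r. indicator {0..T} r * \<bar>past_average_step T n f r - f r\<bar> \<partial>lborel)" by simp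
  qed
qed (auto intro!: always_eventually)

context brownian_filtration
begin

lemma cut_restrict: "s \<le> u \<Longrightarrow> cut {0..s} \<alpha> x = indicator {0..s} (snd x) * cut {0..u} \<alpha> x"
  by (auto simp: cut_def indicator_def)

lemma cut_measurable_F:
  assumes \<alpha>: "progressively_measurable M F T \<alpha>" and t: "0 \<le> t" "t \<le> T"
  shows "cut {0..t} \<alpha> \<in> borel_measurable (F t \<Otimes>\<^sub>M lborel)"
proof -
  let ?R = "restrict_space borel {0..t} :: real measure" and ?D = "{x. snd x \<in> {0..t}} :: ('a \<times> real) set"
  let ?P = "F t \<Otimes>\<^sub>M (lborel :: real measure)"
  have f: "(\<lambda>(s, \<omega>). \<alpha> s \<omega>) \<in> borel_measurable (?R \<Otimes>\<^sub>M F t)"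
    using \<alpha> t by (auto simp: progressively_measurable_def)
  have "(\<lambda>x. (snd x, fst x)) \<in> restrict_space ?P ?D \<rightarrow>\<^sub>M ?R \<Otimes>\<^sub>M F t"
  proof (rule measurable_Pair)
    show "snd \<in> restrict_space ?P ?D \<rightarrow>\<^sub>M ?R"
    proof (rule measurable_restrict_space2)
      show "snd \<in> space (restrict_space ?P ?D) \<rightarrow> {0..t}" by (auto simp: space_restrict_space)
      show "snd \<in> restrict_space ?P ?D \<rightarrow>\<^sub>M borel"
        by (rule measurable_restrict_space1) (simp add: measurable_snd'' flip: measurable_lborel1)
    qed
    show "fst \<in> restrict_space ?P ?D \<rightarrow>\<^sub>M F t" by (rule measurable_restrict_space1) simp
  qed
  from measurable_compose[OF this f]
  have "(\<lambda>x. \<alpha> (snd x) (fst x)) \<in> borel_measurable (restrict_space ?P ?D)" by simp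
  moreover have "?D \<inter> space ?P \<in> sets ?P"
  proof -
    have "?D \<inter> space ?P = snd -` {0..t} \<inter> space ?P" by auto
    also have "\<dots> \<in> sets ?P" by (rule measurable_sets[OF measurable_snd]) simp
    finally show ?thesis .
  qed
  ultimately have "(\<lambda>x. indicator ?D x *\<^sub>R \<alpha> (snd x) (fst x)) \<in> borel_measurable ?P"
    by (subst (asm) borel_measurable_restrict_space_iff)
  moreover have "indicator ?D x *\<^sub>R \<alpha> (snd x) (fst x) = cut {0..t} \<alpha> x" for x
    by (simp add: cut_def indicator_def)
  ultimately show ?thesis by simp
qed

lemma pair_F_imp_M:
  fixes f :: "'a \<times> real \<Rightarrow> real"
  assumes "0 \<le> t" "t \<le> T" "f \<in> borel_measurable (F t \<Otimes>\<^sub>M lborel)"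
  shows "f \<in> borel_measurable (M \<Otimes>\<^sub>M lborel)"
proof -
  have "(\<lambda>\<omega>. \<omega>) \<in> M \<rightarrow>\<^sub>M F t"
    using subalg[OF assms(1,2)] by (intro measurableI) (auto simp: subalgebra_def)
  then have "(\<lambda>x. (fst x, snd x)) \<in> M \<Otimes>\<^sub>M lborel \<rightarrow>\<^sub>M F t \<Otimes>\<^sub>M (lborel :: real measure)"
    by (intro measurable_Pair measurable_snd measurable_compose[OF measurable_fst])
  from measurable_compose[OF this assms(3)] show ?thesis by simp
qed

lemma nn_integral_cut:
  assumes "cut {0..s} \<alpha> \<in> borel_measurable (M \<Otimes>\<^sub>M lborel)"
  shows "(\<integral>\<^sup>+\<omega>. (\<integral>\<^sup>+r\<in>{0..s}. ennreal ((\<alpha> r \<omega>)\<^sup>2) \<partial>lborel) \<partial>M) = (\<integral>\<^sup>+x. ennreal ((cut {0..s} \<alpha> x)\<^sup>2) \<partial>(M \<Otimes>\<^sub>M lborel))"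
proof -
  have "(\<integral>\<^sup>+x. ennreal ((cut {0..s} \<alpha> x)\<^sup>2) \<partial>(M \<Otimes>\<^sub>M lborel)) = (\<integral>\<^sup>+\<omega>. \<integral>\<^sup>+r. ennreal ((cut {0..s} \<alpha> (\<omega>, r))\<^sup>2) \<partial>lborel \<partial>M)"
    by (intro P.M2.nn_integral_fst[symmetric] measurable_compose[OF assms]) measurable
  also have "\<dots> = (\<integral>\<^sup>+\<omega>. (\<integral>\<^sup>+r\<in>{0..s}. ennreal ((\<alpha> r \<omega>)\<^sup>2) \<partial>lborel) \<partial>M)"
    by (intro nn_integral_cong) (auto simp: cut_def indicator_def)
  finally show ?thesis by simp
qed

lemma controls_progressive: "\<alpha> \<in> controls M F T \<Longrightarrow> progressively_measurable M F T \<alpha>"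
  by (simp add: controls_def)

lemma progressive_cut_M:
  assumes "progressively_measurable M F T \<alpha>" "0 \<le> s" "s \<le> T"
  shows "cut {0..s} \<alpha> \<in> borel_measurable (M \<Otimes>\<^sub>M lborel)"
  by (rule pair_F_imp_M[OF assms(2,3) cut_measurable_F[OF assms]])

lemma controls_iff:
  "\<alpha> \<in> controls M F T \<longleftrightarrow> progressively_measurable M F T \<alpha> \<and> sq_integrable (M \<Otimes>\<^sub>M lborel) (cut {0..T} \<alpha>)"
proof (cases "progressively_measurable M F T \<alpha>")
  case True
  then have m: "cut {0..T} \<alpha> \<in> borel_measurable (M \<Otimes>\<^sub>M lborel)"
    by (rule progressive_cut_M) (use T_pos in auto)
  then show ?thesis using True by (simp add: controls_def nn_integral_cut[OF m] sq_integrable_iff_nn[OF m])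
qed (simp add: controls_def)

lemma controls_cut_sq_integrable:
  assumes "\<alpha> \<in> controls M F T" "0 \<le> s" "s \<le> T"
  shows "sq_integrable (M \<Otimes>\<^sub>M lborel) (cut {0..s} \<alpha>)"
proof -
  have "sq_integrable (M \<Otimes>\<^sub>M lborel) (\<lambda>x. indicator {0..s} (snd x) * cut {0..T} \<alpha> x)"
    by (rule sq_integrable_bounded_mult[of _ _ 1]) (use assms in \<open>auto simp: controls_iff indicator_def\<close>)
  then show ?thesis by (simp only: cut_restrict[OF assms(3), symmetric])
qed

text \<open>
  The past averages of a bounded progressive process are coefficients of simple integrands: by
  progressive measurability and Fubini's theorem the average over a cell is measurable at its end.
\<close>

lemma simple_dense_bounded:
  assumes \<beta>: "progressively_measurable M F T \<beta>" and C: "\<And>r \<omega>. \<bar>\<beta> r \<omega>\<bar> \<le> C"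
  shows "\<exists>\<tau> \<xi>. (\<forall>n. simple_integrand M F T n (\<tau> n) (\<xi> n)) \<and>
    l2_tendsto (M \<Otimes>\<^sub>M lborel) (\<lambda>n. cut {0..T} (simple_process n (\<tau> n) (\<xi> n))) (cut {0..T} \<beta>)"
proof -
  let ?f = "\<lambda>\<omega> r. cut {0..T} \<beta> (\<omega>, r)"
  define \<xi> where "\<xi> n i \<omega> = past_average T n (?f \<omega>) i" for n i \<omega>
  have T: "0 \<le> T" using T_pos by simp
  have C0: "0 \<le> C" using C[of undefined undefined] by linarith
  have m[measurable]: "cut {0..T} \<beta> \<in> borel_measurable (M \<Otimes>\<^sub>M lborel)" by (rule progressive_cut_M[OF \<beta> T]) simp
  have fm: "?f \<omega> \<in> borel_measurable borel" if "\<omega> \<in> space M" for \<omega>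
    using measurable_compose[OF measurable_Pair1'[OF that] m] by simp
  have fb: "\<bar>?f \<omega> r\<bar> \<le> C" for \<omega> r using C[of r \<omega>] C0 by (auto simp: cut_def indicator_def)
  have S: "simple_integrand M F T n (grid T n) (\<xi> n)" for n
    unfolding simple_integrand_iff
  proof (intro conjI allI impI)
    show "0 \<le> grid T n 0" by (simp add: grid_0)
    show "grid T n i \<le> grid T n (Suc i)" for i using T by (intro grid_mono) auto
    show "grid T n n \<le> T" using T grid_end[of n T] by (cases "n = 0") (auto simp: grid_0)
    fix i assume i: "i < n"
    have gT: "0 \<le> grid T n i" "grid T n i \<le> T"
      using grid_mono[OF T, of i n n] grid_end[of n T] i T by (auto intro: grid_nonneg)
    have "\<xi> n i \<in> borel_measurable (F (grid T n i))"
    proof (cases i)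
      case 0
      then show ?thesis by (simp add: \<xi>_def[abs_def] past_average_def)
    next
      case (Suc j)
      let ?J = "{grid T n j<..grid T n (Suc j)}"
      have "cut {0..grid T n i} \<beta> \<in> borel_measurable (F (grid T n i) \<Otimes>\<^sub>M lborel)"
        by (rule cut_measurable_F[OF \<beta> gT])
      then have "(\<lambda>(\<omega>, r). indicator ?J r * cut {0..grid T n i} \<beta> (\<omega>, r)) \<in> borel_measurable (F (grid T n i) \<Otimes>\<^sub>M lborel)"
        by measurable
      also have "(\<lambda>(\<omega>, r). indicator ?J r * cut {0..grid T n i} \<beta> (\<omega>, r)) = (\<lambda>(\<omega>, r). indicator ?J r * ?f \<omega> r)"
        using gT grid_nonneg[OF T, of n j] Suc by (auto simp: cut_def indicator_def fun_eq_iff)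
      finally have "(\<lambda>\<omega>. \<integral>r. indicator ?J r * ?f \<omega> r \<partial>lborel) \<in> borel_measurable (F (grid T n i))"
        by (rule P.M2.borel_measurable_lebesgue_integral)
      then show ?thesis unfolding \<xi>_def[abs_def] past_average_def Suc by simp
    qed
    moreover have "\<bar>\<xi> n i \<omega>\<bar> \<le> C" if "\<omega> \<in> space M" for \<omega>
      unfolding \<xi>_def by (rule past_average_bound[OF fm[OF that] fb T_pos])
    ultimately show "bounded_F (grid T n i) (\<xi> n i)" by (auto simp: bounded_F_def)
  qed
  have proc: "simple_process n (grid T n) (\<xi> n) r \<omega> = past_average_step T n (?f \<omega>) r" for n r \<omega>
    by (simp add: simple_process_def past_average_step_def \<xi>_def)
  have bsq: "sq_integrable (M \<Otimes>\<^sub>M lborel) (cut {0..T} \<beta>)"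
  proof (rule sq_integrable_dominated[OF _ m])
    have "integrable (M \<Otimes>\<^sub>M lborel) (\<lambda>x. C\<^sup>2 * indicator {0..T} (snd x))"
      using T by (intro P.integrable_product_mult[of "\<lambda>_. C\<^sup>2"] integrable_real_indicator) auto
    moreover have "(C * indicator {0..T} (snd x))\<^sup>2 = C\<^sup>2 * indicator {0..T} (snd x)" for x :: "'a \<times> real"
      by (auto simp: indicator_def)
    ultimately show "sq_integrable (M \<Otimes>\<^sub>M lborel) (\<lambda>x. C * indicator {0..T} (snd x))"
      by (simp add: sq_integrable_def)
    show "AE x in M \<Otimes>\<^sub>M lborel. \<bar>cut {0..T} \<beta> x\<bar> \<le> \<bar>C * indicator {0..T} (snd x)\<bar>"
      using C by (auto intro!: AE_I2 order.trans[OF _ abs_ge_self] simp: cut_def indicator_def)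
  qed
  let ?h = "\<lambda>n \<omega>. \<integral>r. indicator {0..T} r * (past_average_step T n (?f \<omega>) r - ?f \<omega> r)\<^sup>2 \<partial>lborel"
  let ?d = "\<lambda>n x. cut {0..T} (simple_process n (grid T n) (\<xi> n)) x - cut {0..T} \<beta> x"
  have d: "integrable (M \<Otimes>\<^sub>M lborel) (\<lambda>x. (?d n x)\<^sup>2)" for n
    by (intro sq_integrable_square sq_integrable_diff cut_simple_sq_integrable[OF S] bsq)
  have inner: "(\<integral>r. (?d n (\<omega>, r))\<^sup>2 \<partial>lborel) = ?h n \<omega>" for n \<omega>
    by (intro Bochner_Integration.integral_cong refl) (auto simp: cut_def proc indicator_def)
  have eq: "(\<integral>x. (?d n x)\<^sup>2 \<partial>(M \<Otimes>\<^sub>M lborel)) = expectation (?h n)" for n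
    using P.integral_fst'[OF d[of n]] inner by simp
  have hm: "?h n \<in> borel_measurable M" for n
    using P.integrable_fst'[OF d[of n]] inner by (auto dest: borel_measurable_integrable)
  have "(\<lambda>n. expectation (?h n)) \<longlonglongrightarrow> expectation (\<lambda>\<omega>. 0)"
  proof (rule integral_dominated_convergence[where w="\<lambda>_. (2 * C)\<^sup>2 * T", OF _ hm])
    show "AE \<omega> in M. (\<lambda>n. ?h n \<omega>) \<longlonglongrightarrow> 0"
      by (intro AE_I2 past_average_step_L2[OF fm fb T_pos])
    show "AE \<omega> in M. norm (?h n \<omega>) \<le> (2 * C)\<^sup>2 * T" for n
    proof (intro AE_I2)
      fix \<omega> assume \<omega>: "\<omega> \<in> space M"
      have b: "\<bar>past_average_step T n (?f \<omega>) r - ?f \<omega> r\<bar> \<le> 2 * C" for r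
        using past_average_step_bound[OF fm[OF \<omega>] fb T_pos, of n r] fb[of \<omega> r] by linarith
      have sq: "(past_average_step T n (?f \<omega>) r - ?f \<omega> r)\<^sup>2 \<le> (2 * C)\<^sup>2" for r
        using power_mono[OF b[of r] abs_ge_zero, of 2] by simp
      have [measurable]: "?f \<omega> \<in> borel_measurable borel" by (rule fm[OF \<omega>])
      have "?h n \<omega> \<le> (\<integral>r. indicator {0..T} r * (2 * C)\<^sup>2 \<partial>lborel)"
      proof (rule integral_mono)
        show "integrable lborel (\<lambda>r. indicator {0..T} r * (past_average_step T n (?f \<omega>) r - ?f \<omega> r)\<^sup>2)"
          by (rule bounded_integrable_Icc[of _ "(2 * C)\<^sup>2"]) (use sq in auto)
        show "integrable lborel (\<lambda>r. indicator {0..T} r * (2 * C)\<^sup>2)"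
          by (rule bounded_integrable_Icc[of _ "(2 * C)\<^sup>2"]) auto
      qed (use sq in \<open>auto simp: indicator_def\<close>)
      also have "\<dots> = (2 * C)\<^sup>2 * T" using T by simp
      finally show "norm (?h n \<omega>) \<le> (2 * C)\<^sup>2 * T"
        by (simp add: Bochner_Integration.integral_nonneg)
    qed
  qed auto
  then have "l2_tendsto (M \<Otimes>\<^sub>M lborel) (\<lambda>n. cut {0..T} (simple_process n (grid T n) (\<xi> n))) (cut {0..T} \<beta>)"
    unfolding l2_tendsto_def eq using bsq cut_simple_sq_integrable[OF S] by simp
  then show ?thesis using S by blast
qed

text \<open>
  Truncation reduces this to bounded processes.
\<close>

lemma simple_dense:
  assumes \<alpha>: "\<alpha> \<in> controls M F T"
  shows "\<exists>n \<tau> \<xi>. (\<forall>k::nat. simple_integrand M F T (n k) (\<tau> k) (\<xi> k)) \<and>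
    l2_tendsto (M \<Otimes>\<^sub>M lborel) (\<lambda>k. cut {0..T} (simple_process (n k) (\<tau> k) (\<xi> k))) (cut {0..T} \<alpha>)"
proof -
  let ?P = "M \<Otimes>\<^sub>M (lborel :: real measure)"
  define \<beta> where "\<beta> k r \<omega> = max (- real k) (min (real k) (\<alpha> r \<omega>))" for k :: nat and r \<omega>
  have \<alpha>p: "progressively_measurable M F T \<alpha>" and \<alpha>s: "sq_integrable ?P (cut {0..T} \<alpha>)"
    using \<alpha> by (auto simp: controls_iff)
  have \<beta>p: "progressively_measurable M F T (\<beta> k)" for k
    using \<alpha>p unfolding progressively_measurable_def \<beta>_def by (auto simp: split_beta')
  have \<beta>b: "\<bar>\<beta> k r \<omega>\<bar> \<le> real k" for k r \<omega> by (auto simp: \<beta>_def)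
  have [measurable]: "cut {0..T} (\<beta> k) \<in> borel_measurable ?P" "cut {0..T} \<alpha> \<in> borel_measurable ?P" for k
    by (rule progressive_cut_M; use \<beta>p \<alpha>p T_pos in simp)+
  have dom: "(cut {0..T} (\<beta> k) x - cut {0..T} \<alpha> x)\<^sup>2 \<le> (cut {0..T} \<alpha> x)\<^sup>2" for k x
    by (intro abs_le_square_iff[THEN iffD1]) (auto simp: cut_def \<beta>_def indicator_def)
  have "(\<lambda>k. \<integral>x. (cut {0..T} (\<beta> k) x - cut {0..T} \<alpha> x)\<^sup>2 \<partial>?P) \<longlonglongrightarrow> (\<integral>x. 0 \<partial>?P)"
  proof (rule integral_dominated_convergence[where w="\<lambda>x. (cut {0..T} \<alpha> x)\<^sup>2"])
    show "integrable ?P (\<lambda>x. (cut {0..T} \<alpha> x)\<^sup>2)" by (rule sq_integrable_square[OF \<alpha>s])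
    show "AE x in ?P. (\<lambda>k. (cut {0..T} (\<beta> k) x - cut {0..T} \<alpha> x)\<^sup>2) \<longlonglongrightarrow> 0"
    proof (intro AE_I2)
      fix x
      obtain K :: nat where K: "\<bar>\<alpha> (snd x) (fst x)\<bar> \<le> real K" using real_arch_simple by blast
      have "\<forall>\<^sub>F k in sequentially. 0 = (cut {0..T} (\<beta> k) x - cut {0..T} \<alpha> x)\<^sup>2"
        unfolding eventually_sequentially
      proof (intro exI[of _ K] allI impI)
        fix k assume "K \<le> k"
        then have "\<bar>\<alpha> (snd x) (fst x)\<bar> \<le> real k" using K by linarith
        then show "0 = (cut {0..T} (\<beta> k) x - cut {0..T} \<alpha> x)\<^sup>2" by (auto simp: cut_def \<beta>_def)
      qed
      then show "(\<lambda>k. (cut {0..T} (\<beta> k) x - cut {0..T} \<alpha> x)\<^sup>2) \<longlonglongrightarrow> 0"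
        by (rule Lim_transform_eventually[OF tendsto_const])
    qed
  qed (use dom in auto)
  then have lim: "(\<lambda>k. \<integral>x. (cut {0..T} (\<beta> k) x - cut {0..T} \<alpha> x)\<^sup>2 \<partial>?P) \<longlonglongrightarrow> 0" by simp
  have approx: "\<exists>n \<tau> \<xi>. simple_integrand M F T n \<tau> \<xi> \<and>
    (\<integral>x. (cut {0..T} (simple_process n \<tau> \<xi>) x - cut {0..T} \<alpha> x)\<^sup>2 \<partial>?P) < inverse (real (Suc k))" for k
  proof -
    define e where "e = inverse (real (Suc k)) / 4"
    have "e > 0" by (simp add: e_def)
    have "eventually (\<lambda>k. (\<integral>x. (cut {0..T} (\<beta> k) x - cut {0..T} \<alpha> x)\<^sup>2 \<partial>?P) < e) sequentially"
      using lim \<open>e > 0\<close> by (rule order_tendstoD)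
    then obtain l where l: "(\<integral>x. (cut {0..T} (\<beta> l) x - cut {0..T} \<alpha> x)\<^sup>2 \<partial>?P) < e"
      by (auto simp: eventually_sequentially)
    from simple_dense_bounded[OF \<beta>p \<beta>b, of l] obtain \<tau> \<xi> where S: "\<And>n. simple_integrand M F T n (\<tau> n) (\<xi> n)"
      and L: "l2_tendsto ?P (\<lambda>n. cut {0..T} (simple_process n (\<tau> n) (\<xi> n))) (cut {0..T} (\<beta> l))" by blast
    have "eventually (\<lambda>n. (\<integral>x. (cut {0..T} (simple_process n (\<tau> n) (\<xi> n)) x - cut {0..T} (\<beta> l) x)\<^sup>2 \<partial>?P) < e) sequentially"
      using L \<open>e > 0\<close> unfolding l2_tendsto_def by (intro order_tendstoD(2)[of _ 0]) auto
    then obtain n where n: "(\<integral>x. (cut {0..T} (simple_process n (\<tau> n) (\<xi> n)) x - cut {0..T} (\<beta> l) x)\<^sup>2 \<partial>?P) < e"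
      by (auto simp: eventually_sequentially)
    let ?a = "cut {0..T} (simple_process n (\<tau> n) (\<xi> n))" and ?b = "cut {0..T} (\<beta> l)" and ?c = "cut {0..T} \<alpha>"
    have sq: "sq_integrable ?P ?a" "sq_integrable ?P ?b" "sq_integrable ?P ?c"
      using L \<alpha>s cut_simple_sq_integrable[OF S] by (auto simp: l2_tendsto_def)
    have "(\<integral>x. (?a x - ?c x)\<^sup>2 \<partial>?P) \<le> 2 * (\<integral>x. (?a x - ?b x)\<^sup>2 \<partial>?P) + 2 * (\<integral>x. (?b x - ?c x)\<^sup>2 \<partial>?P)"
      by (rule integral_square_triangle[OF sq])
    also have "\<dots> < inverse (real (Suc k))" using l n by (simp add: e_def)
    finally show ?thesis using S by blast
  qed
  let ?Q = "\<lambda>k n \<tau> \<xi>. simple_integrand M F T n \<tau> \<xi> \<and>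
    (\<integral>x. (cut {0..T} (simple_process n \<tau> \<xi>) x - cut {0..T} \<alpha> x)\<^sup>2 \<partial>?P) < inverse (real (Suc k))"
  have "\<forall>k. \<exists>n \<tau> \<xi>. ?Q k n \<tau> \<xi>" using approx by (rule allI)
  then obtain n where "\<forall>k. \<exists>\<tau> \<xi>. ?Q k (n k) \<tau> \<xi>" by (rule choice[THEN exE])
  then obtain \<tau> where "\<forall>k. \<exists>\<xi>. ?Q k (n k) (\<tau> k) \<xi>" by (rule choice[THEN exE])
  then obtain \<xi> where "\<forall>k. ?Q k (n k) (\<tau> k) (\<xi> k)" by (rule choice[THEN exE])
  then have S: "\<And>k. simple_integrand M F T (n k) (\<tau> k) (\<xi> k)"
    and e: "\<And>k. (\<integral>x. (cut {0..T} (simple_process (n k) (\<tau> k) (\<xi> k)) x - cut {0..T} \<alpha> x)\<^sup>2 \<partial>?P) < inverse (real (Suc k))"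
    by simp_all
  have "(\<lambda>k. \<integral>x. (cut {0..T} (simple_process (n k) (\<tau> k) (\<xi> k)) x - cut {0..T} \<alpha> x)\<^sup>2 \<partial>?P) \<longlonglongrightarrow> 0"
    by (rule tendsto_sandwich[OF _ _ tendsto_const LIMSEQ_inverse_real_of_nat])
      (simp, rule always_eventually, rule allI, rule less_imp_le, rule e)
  then have "l2_tendsto ?P (\<lambda>k. cut {0..T} (simple_process (n k) (\<tau> k) (\<xi> k))) (cut {0..T} \<alpha>)"
    using \<alpha>s cut_simple_sq_integrable[OF S] by (simp add: l2_tendsto_def)
  then show ?thesis using S by blast
qed

end

section \<open>The Ito integral\<close>

context brownian_filtration
begin

abbreviation PM :: "('a \<times> real) measure" where
  "PM \<equiv> M \<Otimes>\<^sub>M (lborel :: real measure)"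

lemma is_ito_integral_iff:
  assumes \<alpha>: "\<alpha> \<in> controls M F T" and s: "0 \<le> s" "s \<le> T"
  shows "is_ito_integral M F T B \<alpha> s I \<longleftrightarrow> (\<exists>n \<tau> \<xi>.
    (\<forall>k::nat. simple_integrand M F T (n k) (\<tau> k) (\<xi> k)) \<and>
    l2_tendsto PM (\<lambda>k. cut {0..s} (simple_process (n k) (\<tau> k) (\<xi> k))) (cut {0..s} \<alpha>) \<and>
    l2_tendsto M (\<lambda>k. simple_integral B (n k) (\<tau> k) (\<xi> k) s) I)"
proof -
  have cs: "sq_integrable PM (cut {0..s} \<alpha>)" by (rule controls_cut_sq_integrable[OF \<alpha> s])
  have eq: "(\<integral>\<^sup>+\<omega>. (\<integral>\<^sup>+r\<in>{0..s}. ennreal ((simple_process n \<tau> \<xi> r \<omega> - \<alpha> r \<omega>)\<^sup>2) \<partial>lborel) \<partial>M)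
    = (\<integral>\<^sup>+x. ennreal ((cut {0..s} (simple_process n \<tau> \<xi>) x - cut {0..s} \<alpha> x)\<^sup>2) \<partial>PM)"
    if "simple_integrand M F T n \<tau> \<xi>" for n \<tau> \<xi>
  proof -
    have e: "cut {0..s} (\<lambda>r \<omega>. simple_process n \<tau> \<xi> r \<omega> - \<alpha> r \<omega>) x = cut {0..s} (simple_process n \<tau> \<xi>) x - cut {0..s} \<alpha> x" for x
      by (simp add: cut_def right_diff_distrib)
    have "cut {0..s} (\<lambda>r \<omega>. simple_process n \<tau> \<xi> r \<omega> - \<alpha> r \<omega>) \<in> borel_measurable PM"
      unfolding e[abs_def]
      by (intro borel_measurable_diff sq_integrable_measurable cut_simple_sq_integrable[OF that] cs)
    from nn_integral_cut[OF this] show ?thesis by (simp only: e)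
  qed
  show ?thesis
  proof
    assume "is_ito_integral M F T B \<alpha> s I"
    then obtain n \<tau> \<xi> where I: "I \<in> borel_measurable M"
      and S: "\<And>k. simple_integrand M F T (n k) (\<tau> k) (\<xi> k)"
      and 1: "(\<lambda>k::nat. \<integral>\<^sup>+\<omega>. (\<integral>\<^sup>+r\<in>{0..s}. ennreal ((simple_process (n k) (\<tau> k) (\<xi> k) r \<omega> - \<alpha> r \<omega>)\<^sup>2) \<partial>lborel) \<partial>M) \<longlonglongrightarrow> 0"
      and 2: "(\<lambda>k::nat. \<integral>\<^sup>+\<omega>. ennreal ((simple_integral B (n k) (\<tau> k) (\<xi> k) s \<omega> - I \<omega>)\<^sup>2) \<partial>M) \<longlonglongrightarrow> 0"
      unfolding is_ito_integral_def by blast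
    have "l2_tendsto PM (\<lambda>k. cut {0..s} (simple_process (n k) (\<tau> k) (\<xi> k))) (cut {0..s} \<alpha>)"
      using 1 unfolding eq[OF S]
      by (intro l2_tendsto_nnI cut_simple_sq_integrable[OF S] sq_integrable_measurable[OF cs])
    moreover have "l2_tendsto M (\<lambda>k. simple_integral B (n k) (\<tau> k) (\<xi> k) s) I"
      by (intro l2_tendsto_nnI simple_integral_sq_integrable[OF S] s I 2)
    ultimately show "\<exists>n \<tau> \<xi>.
      (\<forall>k::nat. simple_integrand M F T (n k) (\<tau> k) (\<xi> k)) \<and>
      l2_tendsto PM (\<lambda>k. cut {0..s} (simple_process (n k) (\<tau> k) (\<xi> k))) (cut {0..s} \<alpha>) \<and>
      l2_tendsto M (\<lambda>k. simple_integral B (n k) (\<tau> k) (\<xi> k) s) I" using S by blast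
  next
    assume "\<exists>n \<tau> \<xi>.
      (\<forall>k::nat. simple_integrand M F T (n k) (\<tau> k) (\<xi> k)) \<and>
      l2_tendsto PM (\<lambda>k. cut {0..s} (simple_process (n k) (\<tau> k) (\<xi> k))) (cut {0..s} \<alpha>) \<and>
      l2_tendsto M (\<lambda>k. simple_integral B (n k) (\<tau> k) (\<xi> k) s) I"
    then obtain n \<tau> \<xi> where S: "\<And>k::nat. simple_integrand M F T (n k) (\<tau> k) (\<xi> k)"
      and 1: "l2_tendsto PM (\<lambda>k. cut {0..s} (simple_process (n k) (\<tau> k) (\<xi> k))) (cut {0..s} \<alpha>)"
      and 2: "l2_tendsto M (\<lambda>k. simple_integral B (n k) (\<tau> k) (\<xi> k) s) I" by blast
    have "I \<in> borel_measurable M" using 2 by (simp add: l2_tendsto_def sq_integrable_def)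
    then show "is_ito_integral M F T B \<alpha> s I"
      unfolding is_ito_integral_def
      using S l2_tendsto_nnD[OF 1] l2_tendsto_nnD[OF 2]
      by (intro conjI exI[of _ n] exI[of _ \<tau>] exI[of _ \<xi>]) (simp_all only: eq[OF S], simp_all)
  qed
qed

lemma simple_integral_diff_norm:
  assumes S: "simple_integrand M F T n \<tau> \<xi>" and R: "simple_integrand M F T m \<sigma> \<eta>" and s: "0 \<le> s"
  shows "expectation (\<lambda>\<omega>. (simple_integral B n \<tau> \<xi> s \<omega> - simple_integral B m \<sigma> \<eta> s \<omega>)\<^sup>2)
    = (\<integral>x. (cut {0..s} (simple_process n \<tau> \<xi>) x - cut {0..s} (simple_process m \<sigma> \<eta>) x)\<^sup>2 \<partial>PM)"
  using integral_square_diff[OF simple_integral_sq_integrable[OF S s] simple_integral_sq_integrable[OF R s]]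
    integral_square_diff[OF cut_simple_sq_integrable[OF S, of s] cut_simple_sq_integrable[OF R, of s]]
    simple_isometry[OF S S s s] simple_isometry[OF R R s s] simple_isometry[OF S R s s]
  by (simp add: power2_eq_square)

lemma cut_l2_tendsto_restrict:
  assumes "l2_tendsto PM (\<lambda>k. cut {0..T} (S k)) (cut {0..T} \<alpha>)" "s \<le> T"
  shows "l2_tendsto PM (\<lambda>k. cut {0..s} (S k)) (cut {0..s} \<alpha>)"
proof -
  have "l2_tendsto PM (\<lambda>k x. indicator {0..s} (snd x) * cut {0..T} (S k) x) (\<lambda>x. indicator {0..s} (snd x) * cut {0..T} \<alpha> x)"
    by (rule l2_tendsto_bounded_mult[OF assms(1)]) (auto simp: indicator_def)
  then show ?thesis by (simp only: cut_restrict[OF assms(2), symmetric])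
qed

text \<open>
  The isometry makes the integrals a Cauchy sequence.
\<close>

lemma simple_integrals_converge:
  assumes S: "\<And>k::nat. simple_integrand M F T (n k) (\<tau> k) (\<xi> k)" and s: "0 \<le> s"
    and lim: "l2_tendsto PM (\<lambda>k. cut {0..s} (simple_process (n k) (\<tau> k) (\<xi> k))) f"
  shows "\<exists>I. l2_tendsto M (\<lambda>k. simple_integral B (n k) (\<tau> k) (\<xi> k) s) I"
proof (rule l2_complete)
  show "sq_integrable M (simple_integral B (n k) (\<tau> k) (\<xi> k) s)" for k
    by (rule simple_integral_sq_integrable[OF S s])
  fix e :: real assume "e > 0"
  from l2_tendsto_Cauchy[OF lim this]
  show "\<exists>N. \<forall>m\<ge>N. \<forall>k\<ge>N. expectation (\<lambda>\<omega>. (simple_integral B (n m) (\<tau> m) (\<xi> m) s \<omega> - simple_integral B (n k) (\<tau> k) (\<xi> k) s \<omega>)\<^sup>2) < e"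
    by (simp only: simple_integral_diff_norm[OF S S s])
qed

abbreviation ito :: "(real \<Rightarrow> 'a \<Rightarrow> real) \<Rightarrow> real \<Rightarrow> 'a \<Rightarrow> real" where
  "ito \<equiv> ito_integral M F T B"

text \<open>
  Uniqueness, linearity and the dependence on the integrand up to null sets are all consequences:
  in each case the norm of a difference of integrals is computed from the integrands.
\<close>

lemma is_ito_inner:
  assumes \<alpha>: "\<alpha> \<in> controls M F T" "0 \<le> s" "s \<le> T" and \<beta>: "\<beta> \<in> controls M F T" "0 \<le> u" "u \<le> T"
    and I: "is_ito_integral M F T B \<alpha> s I" and J: "is_ito_integral M F T B \<beta> u J"
  shows "expectation (\<lambda>\<omega>. I \<omega> * J \<omega>) = (\<integral>x. cut {0..s} \<alpha> x * cut {0..u} \<beta> x \<partial>PM)"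
proof -
  obtain n \<tau> \<xi> where S: "\<And>k::nat. simple_integrand M F T (n k) (\<tau> k) (\<xi> k)"
    and S1: "l2_tendsto PM (\<lambda>k. cut {0..s} (simple_process (n k) (\<tau> k) (\<xi> k))) (cut {0..s} \<alpha>)"
    and S2: "l2_tendsto M (\<lambda>k. simple_integral B (n k) (\<tau> k) (\<xi> k) s) I"
    using I unfolding is_ito_integral_iff[OF \<alpha>] by blast
  obtain m \<sigma> \<eta> where R: "\<And>k::nat. simple_integrand M F T (m k) (\<sigma> k) (\<eta> k)"
    and R1: "l2_tendsto PM (\<lambda>k. cut {0..u} (simple_process (m k) (\<sigma> k) (\<eta> k))) (cut {0..u} \<beta>)"
    and R2: "l2_tendsto M (\<lambda>k. simple_integral B (m k) (\<sigma> k) (\<eta> k) u) J"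
    using J unfolding is_ito_integral_iff[OF \<beta>] by blast
  show ?thesis
    using l2_tendsto_inner[OF S2 R2] l2_tendsto_inner[OF S1 R1]
    unfolding simple_isometry[OF S R \<alpha>(2) \<beta>(2)] by (rule LIMSEQ_unique)
qed

lemma is_ito_sq_integrable:
  "\<alpha> \<in> controls M F T \<Longrightarrow> 0 \<le> s \<Longrightarrow> s \<le> T \<Longrightarrow> is_ito_integral M F T B \<alpha> s I \<Longrightarrow> sq_integrable M I"
  by (auto simp: is_ito_integral_iff l2_tendsto_def)

lemma is_ito_unique:
  assumes \<alpha>: "\<alpha> \<in> controls M F T" "0 \<le> s" "s \<le> T"
    and I: "is_ito_integral M F T B \<alpha> s I" and J: "is_ito_integral M F T B \<alpha> s J"
  shows "AE \<omega> in M. I \<omega> = J \<omega>"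
proof -
  note sq = is_ito_sq_integrable[OF \<alpha> I] is_ito_sq_integrable[OF \<alpha> J]
  have "expectation (\<lambda>\<omega>. (I \<omega> - J \<omega>)\<^sup>2) = 0"
    using integral_square_diff[OF sq] is_ito_inner[OF \<alpha> \<alpha> I I] is_ito_inner[OF \<alpha> \<alpha> J J] is_ito_inner[OF \<alpha> \<alpha> I J]
    by (simp add: power2_eq_square)
  from integral_square_eq_0_imp_AE[OF sq_integrable_diff[OF sq] this] show ?thesis by auto
qed

text \<open>
  One approximating sequence on \<open>[0,T]\<close> serves all times \<open>s\<close> simultaneously, although the integral
  is chosen separately for each \<open>s\<close>.
\<close>

lemma ito_limit:
  assumes \<alpha>: "\<alpha> \<in> controls M F T"
    and S: "\<And>k::nat. simple_integrand M F T (n k) (\<tau> k) (\<xi> k)"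
    and lim: "l2_tendsto PM (\<lambda>k. cut {0..T} (simple_process (n k) (\<tau> k) (\<xi> k))) (cut {0..T} \<alpha>)"
    and s: "0 \<le> s" "s \<le> T"
  shows "l2_tendsto M (\<lambda>k. simple_integral B (n k) (\<tau> k) (\<xi> k) s) (ito \<alpha> s)"
    and "is_ito_integral M F T B \<alpha> s (ito \<alpha> s)"
proof -
  have lims: "l2_tendsto PM (\<lambda>k. cut {0..s} (simple_process (n k) (\<tau> k) (\<xi> k))) (cut {0..s} \<alpha>)"
    by (rule cut_l2_tendsto_restrict[OF lim s(2)])
  obtain I where I: "l2_tendsto M (\<lambda>k. simple_integral B (n k) (\<tau> k) (\<xi> k) s) I"
    using simple_integrals_converge[OF S s(1) lims] by blast
  have "is_ito_integral M F T B \<alpha> s I"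
    unfolding is_ito_integral_iff[OF \<alpha> s] using S lims I by blast
  moreover from this show isI: "is_ito_integral M F T B \<alpha> s (ito \<alpha> s)"
    unfolding ito_integral_def by (rule someI[of "is_ito_integral M F T B \<alpha> s"])
  ultimately have "AE \<omega> in M. I \<omega> = ito \<alpha> s \<omega>" by (rule is_ito_unique[OF \<alpha> s])
  moreover have "ito \<alpha> s \<in> borel_measurable M" using isI by (simp add: is_ito_integral_def)
  ultimately show "l2_tendsto M (\<lambda>k. simple_integral B (n k) (\<tau> k) (\<xi> k) s) (ito \<alpha> s)"
    by (intro l2_tendsto_cong_AE[OF I])
qed

lemma ito_is_ito:
  assumes "\<alpha> \<in> controls M F T" "0 \<le> s" "s \<le> T"
  shows "is_ito_integral M F T B \<alpha> s (ito \<alpha> s)"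
proof -
  obtain n \<tau> \<xi> where "\<And>k::nat. simple_integrand M F T (n k) (\<tau> k) (\<xi> k)"
    "l2_tendsto PM (\<lambda>k. cut {0..T} (simple_process (n k) (\<tau> k) (\<xi> k))) (cut {0..T} \<alpha>)"
    using simple_dense[OF assms(1)] by blast
  from ito_limit(2)[OF assms(1) this assms(2,3)] show ?thesis .
qed

lemma ito_sq_integrable:
  "\<alpha> \<in> controls M F T \<Longrightarrow> 0 \<le> s \<Longrightarrow> s \<le> T \<Longrightarrow> sq_integrable M (ito \<alpha> s)"
  by (rule is_ito_sq_integrable[OF _ _ _ ito_is_ito])

lemma ito_isometry:
  assumes "\<alpha> \<in> controls M F T" "0 \<le> s" "s \<le> T" "\<beta> \<in> controls M F T" "0 \<le> u" "u \<le> T"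
  shows "expectation (\<lambda>\<omega>. ito \<alpha> s \<omega> * ito \<beta> u \<omega>) = (\<integral>x. cut {0..s} \<alpha> x * cut {0..u} \<beta> x \<partial>PM)"
  using assms by (intro is_ito_inner ito_is_ito)

lemma controls_diff:
  assumes "\<alpha> \<in> controls M F T" "\<beta> \<in> controls M F T"
  shows "(\<lambda>r \<omega>. \<alpha> r \<omega> - \<beta> r \<omega>) \<in> controls M F T"
proof -
  have "progressively_measurable M F T (\<lambda>r \<omega>. \<alpha> r \<omega> - \<beta> r \<omega>)"
    using assms unfolding controls_iff progressively_measurable_def
    by (auto simp: split_beta' intro!: borel_measurable_diff)
  moreover have "sq_integrable PM (\<lambda>x. cut {0..T} \<alpha> x - cut {0..T} \<beta> x)"
    using assms by (intro sq_integrable_diff) (auto simp: controls_iff)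
  moreover have "cut {0..T} \<alpha> x - cut {0..T} \<beta> x = cut {0..T} (\<lambda>r \<omega>. \<alpha> r \<omega> - \<beta> r \<omega>) x" for x
    by (simp add: cut_def right_diff_distrib)
  ultimately show ?thesis by (simp add: controls_iff)
qed

lemma ito_diff:
  assumes \<alpha>: "\<alpha> \<in> controls M F T" and \<beta>: "\<beta> \<in> controls M F T" and s: "0 \<le> s" "s \<le> T"
  shows "AE \<omega> in M. ito (\<lambda>r \<omega>. \<alpha> r \<omega> - \<beta> r \<omega>) s \<omega> = ito \<alpha> s \<omega> - ito \<beta> s \<omega>"
proof -
  let ?\<delta> = "\<lambda>r \<omega>. \<alpha> r \<omega> - \<beta> r \<omega>"
  have \<delta>: "?\<delta> \<in> controls M F T" by (rule controls_diff[OF \<alpha> \<beta>])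
  let ?K = "ito ?\<delta> s" and ?I = "ito \<alpha> s" and ?J = "ito \<beta> s"
  let ?k = "cut {0..s} ?\<delta>" and ?i = "cut {0..s} \<alpha>" and ?j = "cut {0..s} \<beta>"
  have sq: "sq_integrable M ?K" "sq_integrable M ?I" "sq_integrable M ?J"
    using ito_sq_integrable \<alpha> \<beta> \<delta> s by auto
  have sc: "sq_integrable PM ?k" "sq_integrable PM ?i" "sq_integrable PM ?j"
    using controls_cut_sq_integrable \<alpha> \<beta> \<delta> s by auto
  have KI: "expectation (\<lambda>\<omega>. ?K \<omega> * (?I \<omega> - ?J \<omega>)) = expectation (\<lambda>\<omega>. ?K \<omega> * ?I \<omega>) - expectation (\<lambda>\<omega>. ?K \<omega> * ?J \<omega>)"
    using sq by (simp add: right_diff_distrib sq_integrable_mult)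
  have ki: "(\<integral>x. ?k x * (?i x - ?j x) \<partial>PM) = (\<integral>x. ?k x * ?i x \<partial>PM) - (\<integral>x. ?k x * ?j x \<partial>PM)"
    using sc by (simp add: right_diff_distrib sq_integrable_mult)
  have "expectation (\<lambda>\<omega>. (?K \<omega> - (?I \<omega> - ?J \<omega>))\<^sup>2) = (\<integral>x. (?k x - (?i x - ?j x))\<^sup>2 \<partial>PM)"
    unfolding integral_square_diff[OF sq(1) sq_integrable_diff[OF sq(2,3)]] integral_square_diff[OF sq(2,3)] KI
      integral_square_diff[OF sc(1) sq_integrable_diff[OF sc(2,3)]] integral_square_diff[OF sc(2,3)] ki
    by (simp add: power2_eq_square ito_isometry \<alpha> \<beta> \<delta> s)
  also have "\<dots> = (\<integral>x. 0 \<partial>PM)" by (intro Bochner_Integration.integral_cong refl) (simp add: cut_def algebra_simps)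
  finally have "expectation (\<lambda>\<omega>. (?K \<omega> - (?I \<omega> - ?J \<omega>))\<^sup>2) = 0" by simp
  from integral_square_eq_0_imp_AE[OF sq_integrable_diff[OF sq(1) sq_integrable_diff[OF sq(2,3)]] this]
  show ?thesis by auto
qed

lemma ito_cong_AE:
  assumes \<alpha>: "\<alpha> \<in> controls M F T" and \<beta>: "\<beta> \<in> controls M F T" and s: "0 \<le> s" "s \<le> T"
    and eq: "AE x in PM. cut {0..s} \<alpha> x = cut {0..s} \<beta> x"
  shows "AE \<omega> in M. ito \<alpha> s \<omega> = ito \<beta> s \<omega>"
proof -
  let ?I = "ito \<alpha> s" and ?J = "ito \<beta> s"
  let ?i = "cut {0..s} \<alpha>" and ?j = "cut {0..s} \<beta>"
  have sq: "sq_integrable M ?I" "sq_integrable M ?J"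
    using ito_sq_integrable \<alpha> \<beta> s by auto
  have sc: "sq_integrable PM ?i" "sq_integrable PM ?j"
    using controls_cut_sq_integrable \<alpha> \<beta> s by auto
  have "expectation (\<lambda>\<omega>. (?I \<omega> - ?J \<omega>)\<^sup>2) = (\<integral>x. (?i x - ?j x)\<^sup>2 \<partial>PM)"
    unfolding integral_square_diff[OF sq] integral_square_diff[OF sc]
    by (simp add: power2_eq_square ito_isometry \<alpha> \<beta> s)
  also have "\<dots> = (\<integral>x. 0 \<partial>PM)"
    by (rule integral_cong_AE) (use eq sc[THEN sq_integrable_measurable] in auto)
  finally have "expectation (\<lambda>\<omega>. (?I \<omega> - ?J \<omega>)\<^sup>2) = 0" by simp
  from integral_square_eq_0_imp_AE[OF sq_integrable_diff[OF sq] this] show ?thesis by auto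
qed

text \<open>
  The correlation of the integral with a fixed random variable \<open>N\<close> is given by a kernel \<open>\<kappa>\<close> that has
  to be found for single terms only. The kernel need not be adapted: below it is \<open>0\<close> when \<open>N\<close>
  belongs to the past, and \<open>- N\<close> when \<open>N\<close> contains the density \<open>zeta\<close>.
\<close>

lemma ito_weight:
  assumes \<alpha>: "\<alpha> \<in> controls M F T" and ts: "0 \<le> t" "t \<le> s" "s \<le> T"
    and N: "sq_integrable M N" and \<kappa>: "sq_integrable PM \<kappa>"
    and weight: "\<And>a b \<eta>. t \<le> a \<Longrightarrow> a \<le> b \<Longrightarrow> b \<le> s \<Longrightarrow> bounded_F a \<eta> \<Longrightarrow>
      expectation (\<lambda>\<omega>. N \<omega> * (\<eta> \<omega> * (B b \<omega> - B a \<omega>))) =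
      (\<integral>x. \<kappa> x * cut {a<..b} (\<lambda>_. \<eta>) x \<partial>PM)"
  shows "expectation (\<lambda>\<omega>. N \<omega> * (ito \<alpha> s \<omega> - ito \<alpha> t \<omega>)) =
    (\<integral>x. \<kappa> x * (cut {0..s} \<alpha> x - cut {0..t} \<alpha> x) \<partial>PM)"
proof -
  obtain n \<tau> \<xi> where S: "\<And>k::nat. simple_integrand M F T (n k) (\<tau> k) (\<xi> k)"
    and lim: "l2_tendsto PM (\<lambda>k. cut {0..T} (simple_process (n k) (\<tau> k) (\<xi> k))) (cut {0..T} \<alpha>)"
    using simple_dense[OF \<alpha>] by blast
  have tT: "t \<le> T" and s0: "0 \<le> s" using ts by auto
  have 1: "(\<lambda>k. expectation (\<lambda>\<omega>. N \<omega> * (simple_integral B (n k) (\<tau> k) (\<xi> k) s \<omega> - simple_integral B (n k) (\<tau> k) (\<xi> k) t \<omega>)))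
    \<longlonglongrightarrow> expectation (\<lambda>\<omega>. N \<omega> * (ito \<alpha> s \<omega> - ito \<alpha> t \<omega>))"
    by (intro l2_tendsto_inner l2_tendsto_const N l2_tendsto_diff ito_limit(1)[OF \<alpha> S lim] s0 ts tT)
  have 2: "(\<lambda>k. \<integral>x. \<kappa> x * (cut {0..s} (simple_process (n k) (\<tau> k) (\<xi> k)) x - cut {0..t} (simple_process (n k) (\<tau> k) (\<xi> k)) x) \<partial>PM)
    \<longlonglongrightarrow> (\<integral>x. \<kappa> x * (cut {0..s} \<alpha> x - cut {0..t} \<alpha> x) \<partial>PM)"
    by (intro l2_tendsto_inner l2_tendsto_const \<kappa> l2_tendsto_diff cut_l2_tendsto_restrict[OF lim] ts tT)
  have "expectation (\<lambda>\<omega>. N \<omega> * (simple_integral B (n k) (\<tau> k) (\<xi> k) s \<omega> - simple_integral B (n k) (\<tau> k) (\<xi> k) t \<omega>)) =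
    (\<integral>x. \<kappa> x * (cut {0..s} (simple_process (n k) (\<tau> k) (\<xi> k)) x - cut {0..t} (simple_process (n k) (\<tau> k) (\<xi> k)) x) \<partial>PM)" for k
    by (rule simple_integral_weight[OF S ts N \<kappa>]) (rule weight)
  with 1 2 show ?thesis by (simp only: LIMSEQ_unique)
qed

end

section \<open>Drift integrals and the change of measure\<close>

context brownian_filtration
begin

definition time_integral :: "('a \<times> real \<Rightarrow> real) \<Rightarrow> 'a \<Rightarrow> real" where
  "time_integral f \<omega> = (\<integral>r. f (\<omega>, r) \<partial>lborel)"

lemma time_integral_cut: "time_integral (cut {0..s} \<alpha>) \<omega> = (LINT r:{0..s}|lborel. \<alpha> r \<omega>)"
  by (simp add: time_integral_def cut_def set_lebesgue_integral_def)

lemma weight_integrable: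
  assumes f: "sq_integrable PM f" and supp: "\<And>x. f x = indicator {a..b} (snd x) * f x" and ab: "a \<le> b"
    and N: "sq_integrable M N"
  shows "integrable PM (\<lambda>x. N (fst x) * f x)"
proof -
  have "integrable PM (\<lambda>x. (N (fst x))\<^sup>2 * indicator {a..b} (snd x))"
    using N ab by (intro P.integrable_product_mult[of "\<lambda>\<omega>. (N \<omega>)\<^sup>2"] integrable_real_indicator sq_integrable_square) auto
  moreover have "(N (fst x) * indicator {a..b} (snd x))\<^sup>2 = (N (fst x))\<^sup>2 * indicator {a..b} (snd x)" for x :: "'a \<times> real"
    by (auto simp: indicator_def)
  moreover have "(\<lambda>x. N (fst x) * indicator {a..b} (snd x)) \<in> borel_measurable PM"
    using sq_integrable_measurable[OF N] by measurable
  ultimately have "sq_integrable PM (\<lambda>x. N (fst x) * indicator {a..b} (snd x))"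
    by (simp add: sq_integrable_def)
  from sq_integrable_mult[OF this f]
  have "integrable PM (\<lambda>x. N (fst x) * (indicator {a..b} (snd x) * f x))" by (simp only: mult.assoc)
  then show ?thesis by (simp only: supp[symmetric])
qed

text \<open>
  The Cauchy-Schwarz inequality in time bounds the norm, and Fubini's theorem computes correlations.
\<close>

lemma
  assumes f: "sq_integrable PM f" and supp: "\<And>x. f x = indicator {a..b} (snd x) * f x" and ab: "a \<le> b"
  shows time_integral_sq_integrable: "sq_integrable M (time_integral f)"
    and time_integral_norm: "expectation (\<lambda>\<omega>. (time_integral f \<omega>)\<^sup>2) \<le> (b - a) * (\<integral>x. (f x)\<^sup>2 \<partial>PM)"
    and time_integral_weight: "sq_integrable M N \<Longrightarrow>
      expectation (\<lambda>\<omega>. N \<omega> * time_integral f \<omega>) = (\<integral>x. N (fst x) * f x \<partial>PM)"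
    and time_integrable_AE: "AE \<omega> in M. integrable lborel (\<lambda>r. f (\<omega>, r))"
proof -
  have fm[measurable]: "f \<in> borel_measurable PM" and f2: "integrable PM (\<lambda>x. (f x)\<^sup>2)"
    using f by (auto simp: sq_integrable_def)
  have m: "time_integral f \<in> borel_measurable M"
    unfolding time_integral_def[abs_def] by (rule P.M2.borel_measurable_lebesgue_integral) simp
  have ind2: "(indicator {a..b} r)\<^sup>2 = (indicator {a..b} r :: real)" for r by (simp add: indicator_def)
  have I: "sq_integrable lborel (indicator {a..b} :: real \<Rightarrow> real)"
    using ab unfolding sq_integrable_def ind2 by (intro conjI integrable_real_indicator) auto
  have good: "integrable lborel (\<lambda>r. f (\<omega>, r))" "(time_integral f \<omega>)\<^sup>2 \<le> (b - a) * (\<integral>r. (f (\<omega>, r))\<^sup>2 \<partial>lborel)"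
    if "\<omega> \<in> space M" "integrable lborel (\<lambda>r. (f (\<omega>, r))\<^sup>2)" for \<omega>
  proof -
    have s: "sq_integrable lborel (\<lambda>r. f (\<omega>, r))"
      using measurable_compose[OF measurable_Pair1'[OF that(1)] fm] that(2) by (simp add: sq_integrable_def)
    have e: "f (\<omega>, r) = indicator {a..b} r * f (\<omega>, r)" for r using supp[of "(\<omega>, r)"] by simp
    have "integrable lborel (\<lambda>r. indicator {a..b} r * f (\<omega>, r))" by (rule sq_integrable_mult[OF I s])
    then show "integrable lborel (\<lambda>r. f (\<omega>, r))" by (simp only: e[symmetric])
    have "(time_integral f \<omega>)\<^sup>2 = (\<integral>r. indicator {a..b} r * f (\<omega>, r) \<partial>lborel)\<^sup>2"
      unfolding time_integral_def by (simp only: e[symmetric])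
    also have "\<dots> \<le> (\<integral>r. (indicator {a..b} r)\<^sup>2 \<partial>lborel) * (\<integral>r. (f (\<omega>, r))\<^sup>2 \<partial>lborel)"
      by (rule Cauchy_Schwarz_integral[OF I s])
    also have "(\<integral>r. (indicator {a..b} r)\<^sup>2 \<partial>lborel) = b - a"
      using ab by (simp add: ind2)
    finally show "(time_integral f \<omega>)\<^sup>2 \<le> (b - a) * (\<integral>r. (f (\<omega>, r))\<^sup>2 \<partial>lborel)" .
  qed
  have ae: "AE \<omega> in M. integrable lborel (\<lambda>r. (f (\<omega>, r))\<^sup>2)"
    using P.AE_integrable_fst'[OF f2] by simp
  have ae2: "AE \<omega> in M. (time_integral f \<omega>)\<^sup>2 \<le> (b - a) * (\<integral>r. (f (\<omega>, r))\<^sup>2 \<partial>lborel)"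
    using ae AE_space by eventually_elim (rule good(2))
  show "AE \<omega> in M. integrable lborel (\<lambda>r. f (\<omega>, r))"
    using ae AE_space by eventually_elim (rule good(1))
  have i: "integrable M (\<lambda>\<omega>. (b - a) * (\<integral>r. (f (\<omega>, r))\<^sup>2 \<partial>lborel))"
    using P.integrable_fst'[OF f2] by simp
  have "integrable M (\<lambda>\<omega>. (time_integral f \<omega>)\<^sup>2)"
    by (rule Bochner_Integration.integrable_bound[OF i]) (use m ae2 in auto)
  then show sq: "sq_integrable M (time_integral f)" using m by (simp add: sq_integrable_def)
  have "expectation (\<lambda>\<omega>. (time_integral f \<omega>)\<^sup>2) \<le> expectation (\<lambda>\<omega>. (b - a) * (\<integral>r. (f (\<omega>, r))\<^sup>2 \<partial>lborel))"
    by (rule integral_mono_AE[OF sq_integrable_square[OF sq] i ae2])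
  also have "\<dots> = (b - a) * (\<integral>x. (f x)\<^sup>2 \<partial>PM)"
    using P.integral_fst'[OF f2] by simp
  finally show "expectation (\<lambda>\<omega>. (time_integral f \<omega>)\<^sup>2) \<le> (b - a) * (\<integral>x. (f x)\<^sup>2 \<partial>PM)" .
  show "expectation (\<lambda>\<omega>. N \<omega> * time_integral f \<omega>) = (\<integral>x. N (fst x) * f x \<partial>PM)" if N: "sq_integrable M N"
    using P.integral_fst'[OF weight_integrable[OF f supp ab N]] by (simp add: time_integral_def)
qed

definition drift :: "(real \<Rightarrow> 'a \<Rightarrow> real) \<Rightarrow> real \<Rightarrow> 'a \<Rightarrow> real" where
  "drift \<alpha> s = time_integral (cut {0..s} \<alpha>)"

lemma drift_eq: "drift \<alpha> s \<omega> = (LINT r:{0..s}|lborel. \<alpha> r \<omega>)"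
  by (simp add: drift_def time_integral_cut)

lemma cut_support: "cut {0..s} \<alpha> x = indicator {0..s} (snd x) * cut {0..s} \<alpha> x"
  by (auto simp: cut_def indicator_def)

lemma drift_sq_integrable:
  assumes "\<alpha> \<in> controls M F T" "0 \<le> s" "s \<le> T"
  shows "sq_integrable M (drift \<alpha> s)"
  unfolding drift_def
  by (rule time_integral_sq_integrable[OF controls_cut_sq_integrable[OF assms] cut_support assms(2)])

lemma drift_weight:
  assumes "\<alpha> \<in> controls M F T" "0 \<le> s" "s \<le> T" "sq_integrable M N"
  shows "expectation (\<lambda>\<omega>. N \<omega> * drift \<alpha> s \<omega>) = (\<integral>x. N (fst x) * cut {0..s} \<alpha> x \<partial>PM)"
  unfolding drift_def
  by (rule time_integral_weight[OF controls_cut_sq_integrable[OF assms(1-3)] cut_support assms(2,4)])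

lemma cut_weight_integrable:
  assumes "\<alpha> \<in> controls M F T" "0 \<le> s" "s \<le> T" "sq_integrable M N"
  shows "integrable PM (\<lambda>x. N (fst x) * cut {0..s} \<alpha> x)"
  by (rule weight_integrable[OF controls_cut_sq_integrable[OF assms(1-3)] cut_support assms(2,4)])

lemma drift_F:
  assumes "\<alpha> \<in> controls M F T" "0 \<le> s" "s \<le> T"
  shows "drift \<alpha> s \<in> borel_measurable (F s)"
  unfolding drift_def time_integral_def[abs_def]
  by (rule P.M2.borel_measurable_lebesgue_integral)
    (simp add: cut_measurable_F[OF controls_progressive[OF assms(1)] assms(2,3)])

lemma drift_increment_norm:
  assumes \<alpha>: "\<alpha> \<in> controls M F T" and ts: "0 \<le> t" "t \<le> s" "s \<le> T"
  shows "expectation (\<lambda>\<omega>. (drift \<alpha> s \<omega> - drift \<alpha> t \<omega>)\<^sup>2) \<le> (s - t) * (\<integral>x. (cut {0..s} \<alpha> x - cut {0..t} \<alpha> x)\<^sup>2 \<partial>PM)"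
proof -
  have c: "sq_integrable PM (cut {0..s} \<alpha>)" "sq_integrable PM (cut {0..t} \<alpha>)"
    by (rule controls_cut_sq_integrable[OF \<alpha>]; use ts in linarith)+
  let ?f = "\<lambda>x. cut {0..s} \<alpha> x - cut {0..t} \<alpha> x"
  have f: "sq_integrable PM ?f" by (rule sq_integrable_diff[OF c])
  have supp: "?f x = indicator {t..s} (snd x) * ?f x" for x
    using ts by (auto simp: cut_def indicator_def)
  have ae: "AE \<omega> in M. time_integral ?f \<omega> = drift \<alpha> s \<omega> - drift \<alpha> t \<omega>"
    using time_integrable_AE[OF c(1) cut_support] time_integrable_AE[OF c(2) cut_support] ts
    by (auto simp: drift_def time_integral_def)
  have "sq_integrable M (drift \<alpha> s)" "sq_integrable M (drift \<alpha> t)"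
    by (rule drift_sq_integrable[OF \<alpha>]; use ts in linarith)+
  then have "expectation (\<lambda>\<omega>. (drift \<alpha> s \<omega> - drift \<alpha> t \<omega>)\<^sup>2) = expectation (\<lambda>\<omega>. (time_integral ?f \<omega>)\<^sup>2)"
    using ae time_integral_sq_integrable[OF f supp ts(2), THEN sq_integrable_measurable]
    by (intro integral_cong_AE) (auto dest!: sq_integrable_measurable)
  also have "\<dots> \<le> (s - t) * (\<integral>x. (?f x)\<^sup>2 \<partial>PM)" by (rule time_integral_norm[OF f supp ts(2)])
  finally show ?thesis .
qed

lemma drift_diff:
  assumes "\<alpha> \<in> controls M F T" "\<beta> \<in> controls M F T" "0 \<le> s" "s \<le> T"
  shows "AE \<omega> in M. drift (\<lambda>r \<omega>. \<alpha> r \<omega> - \<beta> r \<omega>) s \<omega> = drift \<alpha> s \<omega> - drift \<beta> s \<omega>"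
  using time_integrable_AE[OF controls_cut_sq_integrable[OF assms(1,3,4)] cut_support assms(3)]
    time_integrable_AE[OF controls_cut_sq_integrable[OF assms(2,3,4)] cut_support assms(3)]
proof eventually_elim
  case (elim \<omega>)
  have "cut {0..s} (\<lambda>r \<omega>. \<alpha> r \<omega> - \<beta> r \<omega>) (\<omega>, r) = cut {0..s} \<alpha> (\<omega>, r) - cut {0..s} \<beta> (\<omega>, r)" for r
    by (simp add: cut_def right_diff_distrib)
  then show ?case using elim by (simp add: drift_def time_integral_def)
qed

lemma drift_cong_AE:
  assumes "\<alpha> \<in> controls M F T" "\<beta> \<in> controls M F T" "0 \<le> s" "s \<le> T"
    and eq: "AE x in PM. cut {0..s} \<alpha> x = cut {0..s} \<beta> x"
  shows "AE \<omega> in M. drift \<alpha> s \<omega> = drift \<beta> s \<omega>"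
  using P.AE_pair[OF eq] AE_space
proof eventually_elim
  case (elim \<omega>)
  have [measurable]: "cut {0..s} \<alpha> \<in> borel_measurable PM" "cut {0..s} \<beta> \<in> borel_measurable PM"
    using controls_cut_sq_integrable[OF assms(1,3,4)] controls_cut_sq_integrable[OF assms(2,3,4)]
    by (auto simp: sq_integrable_def)
  show ?case unfolding drift_def time_integral_def
    by (rule integral_cong_AE)
      (use elim measurable_compose[OF measurable_Pair1'[OF elim(2)]] in \<open>auto\<close>)
qed

lemma cut_0_AE: "\<alpha> \<in> controls M F T \<Longrightarrow> AE x in PM. cut {0..0} \<alpha> x = 0"
proof (rule P.AE_pair_measure)
  assume \<alpha>: "\<alpha> \<in> controls M F T"
  have [measurable]: "cut {0..0} \<alpha> \<in> borel_measurable PM"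
    by (rule sq_integrable_measurable[OF controls_cut_sq_integrable[OF \<alpha>]]) (use T_pos in auto)
  show "{x \<in> space PM. cut {0..0} \<alpha> x = 0} \<in> sets PM" by measurable
  show "AE \<omega> in M. AE r in lborel. cut {0..0} \<alpha> (\<omega>, r) = 0"
    using AE_lborel_singleton[of "0::real"] by (auto simp: cut_def elim: eventually_mono)
qed

lemma ito_0:
  assumes \<alpha>: "\<alpha> \<in> controls M F T"
  shows "AE \<omega> in M. ito \<alpha> 0 \<omega> = 0"
proof -
  have T: "(0::real) \<le> 0" "0 \<le> T" using T_pos by auto
  have "AE x in PM. cut {0..0} \<alpha> x = 0" by (rule cut_0_AE[OF \<alpha>])
  then have "(\<integral>x. cut {0..0} \<alpha> x * cut {0..0} \<alpha> x \<partial>PM) = (\<integral>x. 0 \<partial>PM)"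
    using sq_integrable_measurable[OF controls_cut_sq_integrable[OF \<alpha> T]]
    by (intro integral_cong_AE) auto
  then have "expectation (\<lambda>\<omega>. (ito \<alpha> 0 \<omega>)\<^sup>2) = 0"
    by (simp add: power2_eq_square ito_isometry[OF \<alpha> T \<alpha> T])
  then show ?thesis by (rule integral_square_eq_0_imp_AE[OF ito_sq_integrable[OF \<alpha> T]])
qed

lemma drift_0: "drift \<alpha> 0 \<omega> = 0"
proof -
  have "(\<integral>r. cut {0..0} \<alpha> (\<omega>, r) \<partial>lborel) = (\<integral>r. (0::real) \<partial>lborel)"
    by (subst integral_eq_zero_AE)
      (use AE_lborel_singleton[of "0::real"] in \<open>auto simp: cut_def elim: eventually_mono\<close>)
  then show ?thesis by (simp add: drift_def time_integral_def)
qed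

text \<open>
  The product of \<open>G\<close> with a coefficient at a time \<open>a \<ge> t\<close> is known at time \<open>a\<close>, so the kernel is \<open>0\<close>.
\<close>

lemma ito_increment_orthogonal:
  assumes \<alpha>: "\<alpha> \<in> controls M F T" and ts: "0 \<le> t" "t \<le> s" "s \<le> T"
    and G: "G \<in> borel_measurable (F t)" "sq_integrable M G"
  shows "expectation (\<lambda>\<omega>. G \<omega> * (ito \<alpha> s \<omega> - ito \<alpha> t \<omega>)) = 0"
proof -
  have w: "expectation (\<lambda>\<omega>. G \<omega> * (\<eta> \<omega> * (B b \<omega> - B a \<omega>))) = (\<integral>x. 0 * cut {a<..b} (\<lambda>_. \<eta>) x \<partial>PM)"
    if ab: "t \<le> a" "a \<le> b" "b \<le> s" and \<eta>: "bounded_F a \<eta>" for a b \<eta>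
  proof -
    have a: "0 \<le> a" "a \<le> T" "b \<le> T" using ab ts by auto
    have "G \<in> borel_measurable (F a)" by (rule F_mono[OF G(1) ts(1) ab(1) a(2)])
    then have m: "(\<lambda>\<omega>. \<eta> \<omega> * G \<omega>) \<in> borel_measurable (F a)"
      using \<eta> by (auto simp: bounded_F_def intro: borel_measurable_times)
    have i: "integrable M (\<lambda>\<omega>. \<eta> \<omega> * G \<omega>)"
      by (intro sq_integrable_mult bounded_F_sq_integrable[OF \<eta>] a G)
    have "has_bochner_integral M (\<lambda>\<omega>. \<eta> \<omega> * G \<omega> * (B b \<omega> - B a \<omega>)) 0"
      by (rule increment_mean_zero[OF a(1) ab(2) a(3) m i])
    then show ?thesis by (simp add: has_bochner_integral_iff mult_ac)
  qed
  have "expectation (\<lambda>\<omega>. G \<omega> * (ito \<alpha> s \<omega> - ito \<alpha> t \<omega>)) =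
      (\<integral>x. 0 * (cut {0..s} \<alpha> x - cut {0..t} \<alpha> x) \<partial>PM)"
    by (rule ito_weight[OF \<alpha> ts G(2) sq_integrable_zero]) (rule w)
  then show ?thesis by simp
qed

lemma zeta_weighted_increment:
  assumes t: "0 \<le> t" "t \<le> a" "a \<le> b" "b \<le> u" "u \<le> T"
    and X: "X \<in> borel_measurable (F a)" "sq_integrable M X"
  shows "expectation (\<lambda>\<omega>. X \<omega> * zeta a u \<omega> * (B b \<omega> - B a \<omega>)) = - (b - a) * expectation X"
    and "expectation (\<lambda>\<omega>. X \<omega> * zeta a u \<omega>) = expectation X"
proof -
  have abu: "0 \<le> a" "a \<le> T" "0 \<le> b" "b \<le> T" "a \<le> u" using t by auto
  have Xi: "integrable M X" by (rule sq_integrable_integrable[OF X(2)])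
  let ?X' = "\<lambda>\<omega>. X \<omega> * ((B b \<omega> - B a \<omega>) * zeta a b \<omega>)"
  have 1: "has_bochner_integral M ?X' (- (b - a) * expectation X)"
    by (rule zeta_moments(3)[OF abu(1) t(3) abu(4) X(1) Xi])
  have [measurable]: "X \<in> borel_measurable (F b)" "B b \<in> borel_measurable (F b)"
    "B a \<in> borel_measurable (F b)" "zeta a b \<in> borel_measurable (F b)"
    by (rule F_mono[OF X(1)] B_F zeta_F; use t abu in linarith)+
  have "?X' \<in> borel_measurable (F b)" by measurable
  from zeta_moments(1)[OF abu(3) t(4,5) this] 1
  have "expectation (\<lambda>\<omega>. ?X' \<omega> * zeta b u \<omega>) = - (b - a) * expectation X"
    by (simp add: has_bochner_integral_iff)
  moreover have "?X' \<omega> * zeta b u \<omega> = X \<omega> * zeta a u \<omega> * (B b \<omega> - B a \<omega>)" for \<omega>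
    by (simp add: zeta_mult[symmetric, of a u \<omega> b])
  ultimately show "expectation (\<lambda>\<omega>. X \<omega> * zeta a u \<omega> * (B b \<omega> - B a \<omega>)) = - (b - a) * expectation X" by simp
  show "expectation (\<lambda>\<omega>. X \<omega> * zeta a u \<omega>) = expectation X"
    using zeta_moments(1)[OF abu(1,5) t(5) X(1) Xi] by (simp add: has_bochner_integral_iff)
qed

lemma bounded_zeta_sq_integrable:
  assumes t: "0 \<le> t" "t \<le> u" "u \<le> T" and G: "bounded_F t G"
  shows "sq_integrable M (\<lambda>\<omega>. G \<omega> * zeta t u \<omega>)"
  by (intro bounded_F_mult_sq_integrable[OF G] zeta_sq_integrable) (use t in auto)

text \<open>
  Under the tilt each increment of \<open>B\<close> has drift \<open>-1\<close>, so the kernel is \<open>- N\<close>.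
\<close>

lemma ito_zeta_weight:
  assumes \<alpha>: "\<alpha> \<in> controls M F T" and tu: "0 \<le> t" "t \<le> u" "u \<le> T" and G: "bounded_F t G"
  shows "expectation (\<lambda>\<omega>. (G \<omega> * zeta t u \<omega>) * (ito \<alpha> u \<omega> - ito \<alpha> t \<omega>)) =
    - (\<integral>x. (G (fst x) * zeta t u (fst x)) * (cut {0..u} \<alpha> x - cut {0..t} \<alpha> x) \<partial>PM)"
proof -
  let ?N = "\<lambda>\<omega>. G \<omega> * zeta t u \<omega>"
  let ?\<kappa> = "\<lambda>x. - ?N (fst x) * indicator {0..T} (snd x)"
  have N: "sq_integrable M ?N" by (rule bounded_zeta_sq_integrable[OF tu G])
  have Nm[measurable]: "?N \<in> borel_measurable M" by (rule sq_integrable_measurable[OF N])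
  have "integrable PM (\<lambda>x. (?N (fst x))\<^sup>2 * indicator {0..T} (snd x))"
    using N T_pos by (intro P.integrable_product_mult[of "\<lambda>\<omega>. (?N \<omega>)\<^sup>2"] integrable_real_indicator sq_integrable_square) auto
  moreover have "(?\<kappa> x)\<^sup>2 = (?N (fst x))\<^sup>2 * indicator {0..T} (snd x)" for x by (auto simp: indicator_def)
  moreover have "?\<kappa> \<in> borel_measurable PM"
    using measurable_compose[OF measurable_fst Nm] by measurable
  ultimately have \<kappa>: "sq_integrable PM ?\<kappa>" by (simp add: sq_integrable_def)
  have "expectation (\<lambda>\<omega>. ?N \<omega> * (ito \<alpha> u \<omega> - ito \<alpha> t \<omega>)) = (\<integral>x. ?\<kappa> x * (cut {0..u} \<alpha> x - cut {0..t} \<alpha> x) \<partial>PM)"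
  proof (rule ito_weight[OF \<alpha> tu N \<kappa>])
    fix a b \<eta> assume ab: "t \<le> a" "a \<le> b" "b \<le> u" and \<eta>: "bounded_F a \<eta>"
    have a: "0 \<le> a" "a \<le> T" "a \<le> u" "b \<le> T" using ab tu by auto
    let ?X = "\<lambda>\<omega>. \<eta> \<omega> * (G \<omega> * zeta t a \<omega>)"
    have "sq_integrable M (\<lambda>\<omega>. G \<omega> * zeta t a \<omega>)" by (rule bounded_zeta_sq_integrable[OF tu(1) ab(1) a(2) G])
    then have Xs: "sq_integrable M ?X" by (rule bounded_F_mult_sq_integrable[OF \<eta> a(1,2)])
    have [measurable]: "\<eta> \<in> borel_measurable (F a)" "G \<in> borel_measurable (F a)"
      using \<eta> bounded_F_mono[OF G tu(1) ab(1) a(2)] by (auto simp: bounded_F_def)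
    have [measurable]: "zeta t a \<in> borel_measurable (F a)" by (rule zeta_F[OF tu(1) ab(1) order.refl a(2)])
    have Xm: "?X \<in> borel_measurable (F a)" by measurable
    note w = zeta_weighted_increment[OF tu(1) ab tu(3) Xm Xs]
    have X: "?X \<omega> * zeta a u \<omega> = ?N \<omega> * \<eta> \<omega>" for \<omega> by (simp add: zeta_mult[symmetric, of t u \<omega> a])
    have i: "integrable M (\<lambda>\<omega>. - (?N \<omega> * \<eta> \<omega>))"
      by (intro Bochner_Integration.integrable_minus sq_integrable_mult N bounded_F_sq_integrable[OF \<eta> a(1,2)])
    have "(\<integral>x. ?\<kappa> x * cut {a<..b} (\<lambda>_. \<eta>) x \<partial>PM) = (\<integral>x. - (?N (fst x) * \<eta> (fst x)) * indicator {a<..b} (snd x) \<partial>PM)"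
      using a by (intro Bochner_Integration.integral_cong refl) (auto simp: cut_def indicator_def)
    also have "\<dots> = expectation (\<lambda>\<omega>. - (?N \<omega> * \<eta> \<omega>)) * (\<integral>r. indicator {a<..b} r \<partial>lborel)"
      by (rule P.integral_product_mult[OF i]) (auto intro!: integrable_real_indicator simp: ab)
    also have "\<dots> = - (b - a) * expectation (\<lambda>\<omega>. ?N \<omega> * \<eta> \<omega>)" using ab by (simp add: algebra_simps)
    also have "\<dots> = - (b - a) * expectation ?X" using w(2) unfolding X by simp
    also have "\<dots> = expectation (\<lambda>\<omega>. ?N \<omega> * \<eta> \<omega> * (B b \<omega> - B a \<omega>))" using w(1) unfolding X by simp
    also have "\<dots> = expectation (\<lambda>\<omega>. ?N \<omega> * (\<eta> \<omega> * (B b \<omega> - B a \<omega>)))" by (simp only: mult.assoc)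
    finally show "expectation (\<lambda>\<omega>. ?N \<omega> * (\<eta> \<omega> * (B b \<omega> - B a \<omega>))) = (\<integral>x. ?\<kappa> x * cut {a<..b} (\<lambda>_. \<eta>) x \<partial>PM)" by simp
  qed
  also have "\<dots> = (\<integral>x. - (?N (fst x) * (cut {0..u} \<alpha> x - cut {0..t} \<alpha> x)) \<partial>PM)"
    using tu by (intro Bochner_Integration.integral_cong refl) (auto simp: cut_def indicator_def)
  finally show ?thesis by simp
qed

text \<open>
  A weak form of Girsanov's theorem: under the density \<open>zeta\<close> the process
  \<open>B\<^sub>s + s\<close> is driftless, so gains \<open>\<integral> \<alpha> dr + \<integral> \<alpha> dB\<close> have conditional mean zero.
\<close>

lemma zeta_weighted_gain:
  assumes \<alpha>: "\<alpha> \<in> controls M F T" and tu: "0 \<le> t" "t \<le> u" "u \<le> T" and G: "bounded_F t G"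
  shows "expectation (\<lambda>\<omega>. (G \<omega> * zeta t u \<omega>) * ((drift \<alpha> u \<omega> + ito \<alpha> u \<omega>) - (drift \<alpha> t \<omega> + ito \<alpha> t \<omega>))) = 0"
proof -
  have u: "0 \<le> u" "t \<le> T" using tu by auto
  let ?N = "\<lambda>\<omega>. G \<omega> * zeta t u \<omega>"
  have N: "sq_integrable M ?N" by (rule bounded_zeta_sq_integrable[OF tu G])
  note i = sq_integrable_mult[OF N drift_sq_integrable[OF \<alpha> u(1) tu(3)]]
    sq_integrable_mult[OF N drift_sq_integrable[OF \<alpha> tu(1) u(2)]]
    sq_integrable_mult[OF N ito_sq_integrable[OF \<alpha> u(1) tu(3)]]
    sq_integrable_mult[OF N ito_sq_integrable[OF \<alpha> tu(1) u(2)]]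
  note c = cut_weight_integrable[OF \<alpha> u(1) tu(3) N] cut_weight_integrable[OF \<alpha> tu(1) u(2) N]
  have "expectation (\<lambda>\<omega>. ?N \<omega> * ((drift \<alpha> u \<omega> + ito \<alpha> u \<omega>) - (drift \<alpha> t \<omega> + ito \<alpha> t \<omega>))) =
    expectation (\<lambda>\<omega>. (?N \<omega> * drift \<alpha> u \<omega> - ?N \<omega> * drift \<alpha> t \<omega>) + ?N \<omega> * (ito \<alpha> u \<omega> - ito \<alpha> t \<omega>))"
    by (intro Bochner_Integration.integral_cong refl) (simp only: right_diff_distrib distrib_left)
  also have "\<dots> = (expectation (\<lambda>\<omega>. ?N \<omega> * drift \<alpha> u \<omega>) - expectation (\<lambda>\<omega>. ?N \<omega> * drift \<alpha> t \<omega>))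
      + expectation (\<lambda>\<omega>. ?N \<omega> * (ito \<alpha> u \<omega> - ito \<alpha> t \<omega>))"
    using i by (simp add: right_diff_distrib)
  also have "\<dots> = 0"
    unfolding ito_zeta_weight[OF \<alpha> tu G] drift_weight[OF \<alpha> u(1) tu(3) N] drift_weight[OF \<alpha> tu(1) u(2) N]
    using c by (simp add: right_diff_distrib)
  finally show ?thesis .
qed

end

section \<open>The candidate control\<close>

context brownian_filtration
begin

text \<open>
  Path continuity makes \<open>B\<close> the pointwise limit of its values at the times \<open>\<lfloor>s n\<rfloor> / n\<close>.
\<close>

lemma B_progressive:
  assumes t: "0 \<le> t" "t \<le> T"
  shows "(\<lambda>x. B (fst x) (snd x)) \<in> borel_measurable (restrict_space borel {0..t} \<Otimes>\<^sub>M F t)"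
proof -
  let ?N = "restrict_space borel {0..t} \<Otimes>\<^sub>M F t"
  define g where "g n s = max 0 (min t (real_of_int \<lfloor>s * real n\<rfloor> / real n))" for n :: nat and s
  have fst_m: "fst \<in> borel_measurable ?N"
    by (rule measurable_compose[OF measurable_fst measurable_restrict_space1]) simp
  have m: "(\<lambda>x. B (g n (fst x)) (snd x)) \<in> borel_measurable ?N" for n
  proof -
    have "(\<lambda>x. \<lfloor>fst x * real n\<rfloor>) \<in> ?N \<rightarrow>\<^sub>M count_space UNIV"
      using fst_m by measurable
    moreover have "(\<lambda>x. B (max 0 (min t (real_of_int i / real n))) (snd x)) \<in> borel_measurable ?N" for i
      by (rule measurable_compose[OF measurable_snd B_F]) (use t in auto)
    ultimately show ?thesis unfolding g_def by (rule measurable_compose_countable[rotated])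
  qed
  show ?thesis
  proof (rule borel_measurable_LIMSEQ_metric[OF m])
    fix x assume "x \<in> space ?N"
    then obtain s \<omega> where x: "x = (s, \<omega>)" and s: "0 \<le> s" "s \<le> t" and \<omega>: "\<omega> \<in> space M"
      by (auto simp: space_pair_measure space_restrict_space space_F[OF t])
    have "(\<lambda>n. real_of_int \<lfloor>s * real n\<rfloor> / real n) \<longlonglongrightarrow> s"
    proof (rule LIMSEQ_I)
      fix e :: real assume "e > 0"
      obtain N :: nat where N: "1 / e < real N" using reals_Archimedean2 by blast
      have "norm (real_of_int \<lfloor>s * real n\<rfloor> / real n - s) < e" if "n \<ge> N" for n
      proof -
        have "1 / e < real n" using N that by linarith
        moreover have "0 < 1 / e" using \<open>e > 0\<close> by simp
        ultimately have n: "real n > 0" by linarith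
        then have "1 / real n < e" using \<open>1 / e < real n\<close> \<open>e > 0\<close> by (simp add: field_simps)
        have fl: "real_of_int \<lfloor>s * real n\<rfloor> \<le> s * real n" "s * real n < real_of_int \<lfloor>s * real n\<rfloor> + 1" by linarith+
        have "real_of_int \<lfloor>s * real n\<rfloor> / real n - s = (real_of_int \<lfloor>s * real n\<rfloor> - s * real n) / real n"
          using n by (simp add: diff_divide_distrib)
        then have "\<bar>real_of_int \<lfloor>s * real n\<rfloor> / real n - s\<bar> = \<bar>real_of_int \<lfloor>s * real n\<rfloor> - s * real n\<bar> / real n"
          by (simp only: abs_divide abs_of_nat)
        also have "\<dots> \<le> 1 / real n"
        proof (rule divide_right_mono)
          show "\<bar>real_of_int \<lfloor>s * real n\<rfloor> - s * real n\<bar> \<le> 1" using fl by linarith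
        qed simp
        finally show ?thesis using \<open>1 / real n < e\<close> by simp
      qed
      then show "\<exists>N. \<forall>n\<ge>N. norm (real_of_int \<lfloor>s * real n\<rfloor> / real n - s) < e" by blast
    qed
    then have "(\<lambda>n. g n s) \<longlonglongrightarrow> max 0 (min t s)" unfolding g_def by (intro tendsto_intros)
    then have lim: "(\<lambda>n. g n s) \<longlonglongrightarrow> s" using s by simp
    have "(\<lambda>n. B (g n s) \<omega>) \<longlonglongrightarrow> B s \<omega>"
    proof (rule continuous_on_tendsto_compose[OF continuous_paths[OF \<omega>] lim])
      have "g n s \<in> {0..T}" for n using t by (auto simp: g_def min_def max_def)
      then show "\<forall>\<^sub>F n in sequentially. g n s \<in> {0..T}" by simp
    qed (use s t in auto)
    then show "(\<lambda>n. B (g n (fst x)) (snd x)) \<longlonglongrightarrow> B (fst x) (snd x)" by (simp add: x)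
  qed
qed

text \<open>
  The process \<open>Y = k exp (- s) zeta 0 s\<close> solves \<open>dY = - Y ds - Y dB\<close> with \<open>Y\<^sub>0 = k\<close>. Hence the control \<open>Y\<close>
  leads from \<open>x0\<close> to the state \<open>X = x0 + k - Y\<close>, and \<open>Y = - X + x0 + k\<close> is feedback control.
\<close>

definition opt :: "real \<Rightarrow> real \<Rightarrow> 'a \<Rightarrow> real" where
  "opt k r \<omega> = k * exp (- r) * zeta 0 r \<omega>"

lemma opt_progressive: "progressively_measurable M F T (opt k)"
  unfolding progressively_measurable_def
proof
  fix t assume "t \<in> {0..T}"
  then have t: "0 \<le> t" "t \<le> T" by auto
  let ?N = "restrict_space borel {0..t} \<Otimes>\<^sub>M F t"
  have [measurable]: "fst \<in> borel_measurable ?N"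
    by (rule measurable_compose[OF measurable_fst measurable_restrict_space1]) simp
  have [measurable]: "(\<lambda>x. B 0 (snd x)) \<in> borel_measurable ?N"
    by (rule measurable_compose[OF measurable_snd B_F]) (use t in auto)
  have [measurable]: "(\<lambda>x. B (fst x) (snd x)) \<in> borel_measurable ?N" by (rule B_progressive[OF t])
  have "(\<lambda>x. k * exp (- fst x) * exp (- (B (fst x) (snd x) - B 0 (snd x)) - (fst x - 0) / 2)) \<in> borel_measurable ?N"
    by measurable
  then show "(\<lambda>(s, \<omega>). opt k s \<omega>) \<in> borel_measurable ?N" by (simp add: opt_def zeta_def split_beta')
qed

lemma zeta_inner:
  assumes "0 \<le> r" "r \<le> v" "v \<le> T"
  shows "expectation (\<lambda>\<omega>. zeta 0 r \<omega> * zeta 0 v \<omega>) = exp r"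
proof -
  have r: "(0::real) \<le> 0" "r \<le> T" using assms by auto
  have sq: "has_bochner_integral M (\<lambda>\<omega>. 1 * (zeta 0 r \<omega>)\<^sup>2) (expectation (\<lambda>\<omega>. 1) * exp (r - 0))"
    by (rule zeta_moments(2)) (use assms in auto)
  have m: "zeta 0 r \<in> borel_measurable (F r)" by (rule zeta_F) (use assms in auto)
  have "has_bochner_integral M (\<lambda>\<omega>. (zeta 0 r \<omega>)\<^sup>2 * zeta r v \<omega>) (expectation (\<lambda>\<omega>. (zeta 0 r \<omega>)\<^sup>2))"
    by (rule zeta_moments(1)[OF assms]) (use m sq in \<open>auto simp: has_bochner_integral_iff\<close>)
  moreover have "(zeta 0 r \<omega>)\<^sup>2 * zeta r v \<omega> = zeta 0 r \<omega> * zeta 0 v \<omega>" for \<omega>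
    by (simp add: power2_eq_square zeta_mult[symmetric, of 0 v \<omega> r])
  ultimately show ?thesis using sq by (simp add: has_bochner_integral_iff prob_space)
qed

lemma zeta_mean:
  assumes "0 \<le> t" "t \<le> u" "u \<le> T"
  shows "expectation (zeta t u) = 1"
proof -
  have "has_bochner_integral M (\<lambda>\<omega>. 1 * zeta t u \<omega>) (expectation (\<lambda>\<omega>. 1))"
    by (rule zeta_moments(1)[OF assms]) auto
  then show ?thesis by (simp add: has_bochner_integral_iff prob_space)
qed

lemma opt_inner:
  assumes "0 \<le> v" "v \<le> T"
  shows "has_bochner_integral M (\<lambda>\<omega>. (opt k v \<omega>)\<^sup>2) (k\<^sup>2 * exp (- v))"
proof -
  have "(opt k v \<omega>)\<^sup>2 = (k\<^sup>2 * (exp (- v))\<^sup>2) * (zeta 0 v \<omega>)\<^sup>2" for \<omega>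
    by (simp add: opt_def power_mult_distrib)
  moreover have "has_bochner_integral M (\<lambda>\<omega>. (zeta 0 v \<omega>)\<^sup>2) (exp v)"
    using zeta_inner[of v v] sq_integrable_square[OF zeta_sq_integrable[of 0 v]] assms
    by (simp add: has_bochner_integral_iff power2_eq_square)
  from has_bochner_integral_mult_right[OF this, of "k\<^sup>2 * (exp (- v))\<^sup>2"]
  have "has_bochner_integral M (\<lambda>\<omega>. (k\<^sup>2 * (exp (- v))\<^sup>2) * (zeta 0 v \<omega>)\<^sup>2) (k\<^sup>2 * exp (- v))"
    by (simp add: power2_eq_square mult.assoc mult_exp_exp)
  ultimately show ?thesis by simp
qed

lemma opt_controls: "opt k \<in> controls M F T"
proof -
  have T: "0 \<le> T" using T_pos by simp
  have m[measurable]: "cut {0..T} (opt k) \<in> borel_measurable PM" by (rule progressive_cut_M[OF opt_progressive T order.refl])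
  have "(\<integral>\<^sup>+x. ennreal ((cut {0..T} (opt k) x)\<^sup>2) \<partial>PM) = (\<integral>\<^sup>+r. \<integral>\<^sup>+\<omega>. ennreal ((cut {0..T} (opt k) (\<omega>, r))\<^sup>2) \<partial>M \<partial>lborel)"
    by (intro P.nn_integral_snd[symmetric] measurable_compose[OF m]) measurable
  also have "\<dots> \<le> (\<integral>\<^sup>+r. ennreal (k\<^sup>2) * indicator {0..T} r \<partial>lborel)"
  proof (rule nn_integral_mono)
    fix r :: real
    show "(\<integral>\<^sup>+\<omega>. ennreal ((cut {0..T} (opt k) (\<omega>, r))\<^sup>2) \<partial>M) \<le> ennreal (k\<^sup>2) * indicator {0..T} r"
    proof (cases "r \<in> {0..T}")
      case True
      then have "has_bochner_integral M (\<lambda>\<omega>. (opt k r \<omega>)\<^sup>2) (k\<^sup>2 * exp (- r))" by (intro opt_inner) auto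
      then have "(\<integral>\<^sup>+\<omega>. ennreal ((opt k r \<omega>)\<^sup>2) \<partial>M) = ennreal (k\<^sup>2 * exp (- r))"
        by (subst nn_integral_eq_integral) (auto simp: has_bochner_integral_iff)
      also have "\<dots> \<le> ennreal (k\<^sup>2)" using True by (intro ennreal_leI mult_left_le) auto
      finally show ?thesis using True by (simp add: cut_def)
    qed (simp add: cut_def)
  qed
  also have "\<dots> < \<infinity>" using T by (simp add: nn_integral_cmult_indicator ennreal_mult_less_top)
  finally have "sq_integrable PM (cut {0..T} (opt k))" by (simp add: sq_integrable_iff_nn[OF m])
  then show ?thesis using opt_progressive by (simp add: controls_iff)
qed

lemma opt_weight:
  assumes s: "0 \<le> s" "s \<le> T" and N: "sq_integrable M N"
  shows "(\<integral>x. N (fst x) * cut {0..s} (opt k) x \<partial>PM) =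
    (\<integral>r. k * exp (- r) * expectation (\<lambda>\<omega>. N \<omega> * zeta 0 r \<omega>) * indicator {0..s} r \<partial>lborel)"
proof -
  have i: "integrable PM (\<lambda>(\<omega>, r). N \<omega> * cut {0..s} (opt k) (\<omega>, r))"
    using cut_weight_integrable[OF opt_controls s N] by (simp add: split_beta')
  have "(\<integral>x. N (fst x) * cut {0..s} (opt k) x \<partial>PM) = (\<integral>r. (\<integral>\<omega>. N \<omega> * cut {0..s} (opt k) (\<omega>, r) \<partial>M) \<partial>lborel)"
    using P.integral_snd[OF i] by (simp add: split_beta')
  also have "\<dots> = (\<integral>r. k * exp (- r) * expectation (\<lambda>\<omega>. N \<omega> * zeta 0 r \<omega>) * indicator {0..s} r \<partial>lborel)"
  proof (intro Bochner_Integration.integral_cong refl)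
    fix r :: real
    have e: "(\<lambda>\<omega>. N \<omega> * cut {0..s} (opt k) (\<omega>, r)) = (\<lambda>\<omega>. (k * exp (- r) * indicator {0..s} r) * (N \<omega> * zeta 0 r \<omega>))"
      by (auto simp: cut_def opt_def)
    show "(\<integral>\<omega>. N \<omega> * cut {0..s} (opt k) (\<omega>, r) \<partial>M) = k * exp (- r) * expectation (\<lambda>\<omega>. N \<omega> * zeta 0 r \<omega>) * indicator {0..s} r"
      unfolding e by simp
  qed
  finally show ?thesis .
qed

lemma opt_norm:
  assumes s: "0 \<le> s" "s \<le> T"
  shows "(\<integral>x. cut {0..s} (opt k) x * cut {0..s} (opt k) x \<partial>PM) = (\<integral>r. k\<^sup>2 * exp (- r) * indicator {0..s} r \<partial>lborel)"
proof -
  have c: "sq_integrable PM (cut {0..s} (opt k))" by (rule controls_cut_sq_integrable[OF opt_controls s])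
  have i: "integrable PM (\<lambda>(\<omega>, r). (cut {0..s} (opt k) (\<omega>, r))\<^sup>2)"
    using sq_integrable_square[OF c] by (simp add: split_beta')
  have "(\<integral>x. (cut {0..s} (opt k) x)\<^sup>2 \<partial>PM) = (\<integral>r. (\<integral>\<omega>. (cut {0..s} (opt k) (\<omega>, r))\<^sup>2 \<partial>M) \<partial>lborel)"
    using P.integral_snd[OF i] by (simp add: split_beta')
  also have "\<dots> = (\<integral>r. k\<^sup>2 * exp (- r) * indicator {0..s} r \<partial>lborel)"
  proof (intro Bochner_Integration.integral_cong refl)
    fix r :: real
    show "(\<integral>\<omega>. (cut {0..s} (opt k) (\<omega>, r))\<^sup>2 \<partial>M) = k\<^sup>2 * exp (- r) * indicator {0..s} r"
      using opt_inner[of r k] s by (cases "r \<in> {0..s}") (auto simp: cut_def has_bochner_integral_iff)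
  qed
  finally show ?thesis by (simp add: power2_eq_square)
qed

lemma bounded_F_one: "bounded_F t (\<lambda>_. 1)"
  unfolding bounded_F_def by (auto intro!: exI[of _ 1])

lemma zeta_weighted_state:
  assumes \<alpha>: "\<alpha> \<in> controls M F T" and u: "0 \<le> u" "u \<le> T"
  shows "expectation (\<lambda>\<omega>. zeta 0 u \<omega> * (drift \<alpha> u \<omega> + ito \<alpha> u \<omega>)) = 0"
proof -
  have T: "(0::real) \<le> 0" "0 \<le> T" using u by auto
  have [measurable]: "zeta 0 u \<in> borel_measurable M" "drift \<alpha> u \<in> borel_measurable M" "ito \<alpha> u \<in> borel_measurable M"
      "ito \<alpha> 0 \<in> borel_measurable M"
    by (rule sq_integrable_measurable, rule zeta_sq_integrable drift_sq_integrable[OF \<alpha>] ito_sq_integrable[OF \<alpha>]; use u T in linarith)+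
  have "expectation (\<lambda>\<omega>. zeta 0 u \<omega> * (drift \<alpha> u \<omega> + ito \<alpha> u \<omega>)) =
    expectation (\<lambda>\<omega>. (1 * zeta 0 u \<omega>) * ((drift \<alpha> u \<omega> + ito \<alpha> u \<omega>) - (drift \<alpha> 0 \<omega> + ito \<alpha> 0 \<omega>)))"
    by (rule integral_cong_AE) (use ito_0[OF \<alpha>] in \<open>auto simp: drift_0\<close>)
  also have "\<dots> = 0" by (rule zeta_weighted_gain[OF \<alpha> T(1) u bounded_F_one])
  finally show ?thesis .
qed

lemma zeta_drift_opt:
  assumes r: "0 \<le> r" "r \<le> s" "s \<le> T"
  shows "expectation (\<lambda>\<omega>. zeta 0 r \<omega> * drift (opt k) s \<omega>) = k * (r + 1 - exp (r - s))"
proof -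
  have s: "0 \<le> s" "r \<le> T" using r by auto
  have "expectation (\<lambda>\<omega>. zeta 0 r \<omega> * drift (opt k) s \<omega>) =
    (\<integral>v. k * exp (- v) * expectation (\<lambda>\<omega>. zeta 0 r \<omega> * zeta 0 v \<omega>) * indicator {0..s} v \<partial>lborel)"
    using zeta_sq_integrable[of 0 r] r s by (simp add: drift_weight opt_controls opt_weight)
  \<comment> \<open>By \<open>zeta_inner\<close> the expectation is \<open>exp (min r v)\<close>; the intervals overlap in the null set \<open>{r}\<close>.\<close>
  also have "\<dots> = (\<integral>v. k * indicator {0..r} v + k * exp (r - v) * indicator {r..s} v \<partial>lborel)"
  proof (rule Bochner_Integration.integral_cong_AE)
    have pt: "k * exp (- v) * expectation (\<lambda>\<omega>. zeta 0 r \<omega> * zeta 0 v \<omega>) * indicator {0..s} v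
       = k * indicator {0..r} v + k * exp (r - v) * indicator {r..s} v" if "v \<noteq> r" for v
    proof (cases "v \<in> {0..s}")
      case True
      show ?thesis
      proof (cases "v < r")
        case True
        then have "expectation (\<lambda>\<omega>. zeta 0 r \<omega> * zeta 0 v \<omega>) = exp v"
          using zeta_inner[of v r] \<open>v \<in> {0..s}\<close> r s by (simp add: mult.commute)
        then show ?thesis using True \<open>v \<in> {0..s}\<close> by (simp add: mult.assoc mult_exp_exp)
      next
        case False
        then have "expectation (\<lambda>\<omega>. zeta 0 r \<omega> * zeta 0 v \<omega>) = exp r"
          using zeta_inner[of r v] \<open>v \<in> {0..s}\<close> r s by simp
        then show ?thesis using False that \<open>v \<in> {0..s}\<close> by (simp add: mult.assoc mult_exp_exp)
      qed
    qed (use r in \<open>auto simp: indicator_def\<close>)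
    then show "AE v in lborel. k * exp (- v) * expectation (\<lambda>\<omega>. zeta 0 r \<omega> * zeta 0 v \<omega>) * indicator {0..s} v
       = k * indicator {0..r} v + k * exp (r - v) * indicator {r..s} v"
      using AE_lborel_singleton[of r] by (auto elim!: eventually_mono)
    show g: "(\<lambda>v. k * indicator {0..r} v + k * exp (r - v) * indicator {r..s} v) \<in> borel_measurable lborel" by measurable
    let ?f = "\<lambda>v. k * exp (- v) * expectation (\<lambda>\<omega>. zeta 0 r \<omega> * zeta 0 v \<omega>) * indicator {0..s} v"
    have "?f = (\<lambda>v. if v = r then ?f r else k * indicator {0..r} v + k * exp (r - v) * indicator {r..s} v)"
      using pt by auto
    also have "\<dots> \<in> borel_measurable lborel" by measurable
    finally show "?f \<in> borel_measurable lborel" .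
  qed
  also have "\<dots> = (\<integral>v. k * indicator {0..r} v \<partial>lborel) + (\<integral>v. k * exp (r - v) * indicator {r..s} v \<partial>lborel)"
    using r by (intro Bochner_Integration.integral_add borel_integrable_atLeastAtMost) (auto intro!: continuous_intros)
  also have "(\<integral>v. k * exp (r - v) * indicator {r..s} v \<partial>lborel) = - k * exp (r - s) - - k * exp (r - r)"
    by (rule integral_FTC_Icc_real[where F="\<lambda>v. - k * exp (r - v)", OF r(2)])
      (auto intro!: derivative_eq_intros continuous_intros)
  finally show ?thesis using r by (simp add: algebra_simps)
qed

lemma zeta_ito_opt:
  assumes r: "0 \<le> r" "r \<le> s" "s \<le> T"
  shows "expectation (\<lambda>\<omega>. zeta 0 r \<omega> * ito (opt k) s \<omega>) = - k * r"
proof -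
  have s: "0 \<le> s" "r \<le> T" using r by auto
  have z: "sq_integrable M (zeta 0 r)" by (rule zeta_sq_integrable) (use r s in auto)
  have sq: "sq_integrable M (ito (opt k) s)" "sq_integrable M (ito (opt k) r)" "sq_integrable M (drift (opt k) r)"
    using ito_sq_integrable[OF opt_controls, of _ k] drift_sq_integrable[OF opt_controls, of _ k] r s by auto
  have zm: "zeta 0 r \<in> borel_measurable (F r)" by (rule zeta_F) (use r s in auto)
  have "expectation (\<lambda>\<omega>. zeta 0 r \<omega> * (ito (opt k) s \<omega> - ito (opt k) r \<omega>)) = 0"
    by (rule ito_increment_orthogonal[OF opt_controls r zm z])
  then have "expectation (\<lambda>\<omega>. zeta 0 r \<omega> * ito (opt k) s \<omega>) = expectation (\<lambda>\<omega>. zeta 0 r \<omega> * ito (opt k) r \<omega>)"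
    using z sq by (simp add: right_diff_distrib sq_integrable_mult)
  moreover have "expectation (\<lambda>\<omega>. zeta 0 r \<omega> * drift (opt k) r \<omega>) + expectation (\<lambda>\<omega>. zeta 0 r \<omega> * ito (opt k) r \<omega>) = 0"
    using zeta_weighted_state[OF opt_controls r(1) s(2), of k]
      Bochner_Integration.integral_add[OF sq_integrable_mult[OF z sq(3)] sq_integrable_mult[OF z sq(2)]]
    by (simp only: distrib_left)
  ultimately show ?thesis using zeta_drift_opt[OF r(1) order.refl s(2), of k] by simp
qed

text \<open>
  This is Ito's formula for the process \<open>k exp (- s) zeta 0 s\<close>, proved in \<open>L\<^sup>2\<close>: the difference \<open>K\<close>
  of the two sides is orthogonal to every \<open>zeta 0 r\<close> with \<open>r \<le> s\<close>, hence to all its parts except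
  the Ito integral. A computation of moments shows that it is orthogonal to the Ito integral as
  well, so \<open>K\<close> is orthogonal to itself.
\<close>

lemma opt_gain:
  assumes s: "0 \<le> s" "s \<le> T"
  shows "AE \<omega> in M. drift (opt k) s \<omega> + ito (opt k) s \<omega> = k * (1 - exp (- s) * zeta 0 s \<omega>)"
proof -
  let ?D = "drift (opt k) s" and ?I = "ito (opt k) s"
  define c where "c = k * exp (- s)"
  define K where "K \<omega> = c * zeta 0 s \<omega> - k * zeta 0 0 \<omega> + ?D \<omega> + ?I \<omega>" for \<omega>
  have T: "0 \<le> T" using s by auto
  have z: "sq_integrable M (zeta 0 r)" if "0 \<le> r" "r \<le> s" for r by (rule zeta_sq_integrable) (use that s in auto)
  have D: "sq_integrable M ?D" and I: "sq_integrable M ?I"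
    using ito_sq_integrable[OF opt_controls s] drift_sq_integrable[OF opt_controls s] by auto
  have K: "sq_integrable M K" unfolding K_def[abs_def]
    by (intro sq_integrable_add sq_integrable_diff sq_integrable_cmult z D I) (use s in auto)
  have expand: "expectation (\<lambda>\<omega>. X \<omega> * K \<omega>) = c * expectation (\<lambda>\<omega>. X \<omega> * zeta 0 s \<omega>) - k * expectation (\<lambda>\<omega>. X \<omega> * zeta 0 0 \<omega>)
      + expectation (\<lambda>\<omega>. X \<omega> * ?D \<omega>) + expectation (\<lambda>\<omega>. X \<omega> * ?I \<omega>)" if X: "sq_integrable M X" for X
  proof -
    have i: "integrable M (\<lambda>\<omega>. X \<omega> * zeta 0 s \<omega>)" "integrable M (\<lambda>\<omega>. X \<omega> * zeta 0 0 \<omega>)"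
      "integrable M (\<lambda>\<omega>. X \<omega> * ?D \<omega>)" "integrable M (\<lambda>\<omega>. X \<omega> * ?I \<omega>)"
      using z s D I X by (auto intro!: sq_integrable_mult)
    have "X \<omega> * K \<omega> = c * (X \<omega> * zeta 0 s \<omega>) - k * (X \<omega> * zeta 0 0 \<omega>) + X \<omega> * ?D \<omega> + X \<omega> * ?I \<omega>" for \<omega>
      by (simp add: K_def algebra_simps)
    then show ?thesis using i by simp
  qed
  have zK: "expectation (\<lambda>\<omega>. zeta 0 r \<omega> * K \<omega>) = 0" if r: "0 \<le> r" "r \<le> s" for r
  proof -
    have "expectation (\<lambda>\<omega>. zeta 0 r \<omega> * zeta 0 s \<omega>) = exp r" by (rule zeta_inner[OF r s(2)])
    moreover have "expectation (\<lambda>\<omega>. zeta 0 r \<omega> * zeta 0 0 \<omega>) = 1"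
      using zeta_mean[of 0 r] r s by (simp add: zeta_refl)
    moreover have "c * exp r = k * exp (r - s)" by (simp add: c_def mult_exp_exp)
    ultimately show ?thesis
      unfolding expand[OF z[OF r]] zeta_drift_opt[OF r s(2)] zeta_ito_opt[OF r s(2)]
      by (simp add: algebra_simps)
  qed
  have KD: "expectation (\<lambda>\<omega>. K \<omega> * ?D \<omega>) = 0"
  proof -
    have "expectation (\<lambda>\<omega>. K \<omega> * ?D \<omega>) = (\<integral>r. k * exp (- r) * expectation (\<lambda>\<omega>. K \<omega> * zeta 0 r \<omega>) * indicator {0..s} r \<partial>lborel)"
      by (simp add: drift_weight opt_controls opt_weight s K)
    also have "\<dots> = (\<integral>r. 0 \<partial>(lborel :: real measure))"
      by (intro Bochner_Integration.integral_cong refl) (use zK in \<open>auto simp: indicator_def mult.commute[of "K _"]\<close>)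
    finally show ?thesis by simp
  qed
  have IK: "expectation (\<lambda>\<omega>. ?I \<omega> * K \<omega>) = 0"
  proof -
    have zI: "expectation (\<lambda>\<omega>. ?I \<omega> * zeta 0 r \<omega>) = - k * r" if "0 \<le> r" "r \<le> s" for r
      using zeta_ito_opt[OF that s(2)] by (simp add: mult.commute)
    have ID: "expectation (\<lambda>\<omega>. ?I \<omega> * ?D \<omega>) = (\<integral>r. - k\<^sup>2 * (r * exp (- r)) * indicator {0..s} r \<partial>lborel)"
      unfolding drift_weight[OF opt_controls s I] opt_weight[OF s I]
      by (intro Bochner_Integration.integral_cong refl) (use zI in \<open>auto simp: indicator_def power2_eq_square\<close>)
    have FTC1: "(\<integral>r. - k\<^sup>2 * (r * exp (- r)) * indicator {0..s} r \<partial>lborel) = k\<^sup>2 * ((s + 1) * exp (- s)) - k\<^sup>2 * ((0 + 1) * exp (- 0))"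
      by (rule integral_FTC_Icc_real[where F="\<lambda>r. k\<^sup>2 * ((r + 1) * exp (- r))", OF s(1)])
        (auto intro!: derivative_eq_intros continuous_intros simp: algebra_simps)
    have FTC2: "(\<integral>r. k\<^sup>2 * exp (- r) * indicator {0..s} r \<partial>lborel) = - k\<^sup>2 * exp (- s) - - k\<^sup>2 * exp (- 0)"
      by (rule integral_FTC_Icc_real[where F="\<lambda>r. - k\<^sup>2 * exp (- r)", OF s(1)])
        (auto intro!: derivative_eq_intros continuous_intros)
    show ?thesis
      unfolding expand[OF I] ID FTC1 zI[OF s(1) order.refl] zI[OF order.refl s(1)]
        ito_isometry[OF opt_controls s opt_controls s] opt_norm[OF s] FTC2 c_def
      by (simp add: algebra_simps power2_eq_square)
  qed
  have "expectation (\<lambda>\<omega>. K \<omega> * K \<omega>) = 0"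
    unfolding expand[OF K] using zK[OF s(1) order.refl] zK[OF order.refl s(1)] KD IK
    by (simp add: mult.commute[of "K _"])
  then have "AE \<omega> in M. K \<omega> = 0"
    using integral_square_eq_0_imp_AE[OF K] by (simp add: power2_eq_square)
  then show ?thesis
    by eventually_elim (simp add: K_def c_def zeta_refl algebra_simps)
qed

end

section \<open>The static problem\<close>

context brownian_filtration
begin

definition gain :: "(real \<Rightarrow> 'a \<Rightarrow> real) \<Rightarrow> real \<Rightarrow> 'a \<Rightarrow> real" where
  "gain \<alpha> s \<omega> = drift \<alpha> s \<omega> + ito \<alpha> s \<omega>"

lemma gain_sq_integrable:
  "\<alpha> \<in> controls M F T \<Longrightarrow> 0 \<le> s \<Longrightarrow> s \<le> T \<Longrightarrow> sq_integrable M (gain \<alpha> s)"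
  unfolding gain_def[abs_def] by (intro sq_integrable_add drift_sq_integrable ito_sq_integrable)

lemma zeta_gain:
  assumes "\<alpha> \<in> controls M F T"
  shows "expectation (\<lambda>\<omega>. zeta 0 T \<omega> * gain \<alpha> T \<omega>) = 0"
  unfolding gain_def by (rule zeta_weighted_state[OF assms]) (use T_pos in auto)

lemma zeta_T_moments:
  shows "sq_integrable M (zeta 0 T)" "expectation (zeta 0 T) = 1" "expectation (\<lambda>\<omega>. (zeta 0 T \<omega>)\<^sup>2) = exp T"
  using zeta_sq_integrable[of 0 T] zeta_mean[of 0 T] zeta_inner[of T T] T_pos
  by (simp_all add: power2_eq_square)

text \<open>
  Completing the square. Since \<open>E (zeta 0 T X) = x0\<close>, the excess of \<open>E X\<close> over \<open>x0\<close> is the covariance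
  of \<open>X\<close> with \<open>1 - zeta 0 T\<close>, and the loss against the optimal value measures how far
  \<open>lam (X - E X)\<close> is from \<open>1 - zeta 0 T\<close>.
\<close>

lemma mean_variance_identity:
  fixes x0 :: real
  assumes \<alpha>: "\<alpha> \<in> controls M F T" and lam: "lam > 0"
  defines "X \<equiv> (\<lambda>\<omega>. x0 + gain \<alpha> T \<omega>)"
  shows "expectation X - lam / 2 * variance X = x0 + (exp T - 1) / (2 * lam)
    - 1 / (2 * lam) * expectation (\<lambda>\<omega>. (lam * (X \<omega> - expectation X) - (1 - zeta 0 T \<omega>))\<^sup>2)"
proof -
  define m where "m = expectation X"
  have g: "sq_integrable M (gain \<alpha> T)" by (rule gain_sq_integrable[OF \<alpha>]) (use T_pos in auto)
  have X: "sq_integrable M X" unfolding X_def by (rule sq_integrable_add[OF sq_integrable_const g])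
  note z = zeta_T_moments
  have zi: "integrable M (zeta 0 T)" by (rule sq_integrable_integrable[OF z(1)])
  have Xi: "integrable M X" by (rule sq_integrable_integrable[OF X])
  have f: "sq_integrable M (\<lambda>\<omega>. lam * (X \<omega> - m))"
    by (intro sq_integrable_cmult sq_integrable_diff X sq_integrable_const)
  have h: "sq_integrable M (\<lambda>\<omega>. 1 - zeta 0 T \<omega>)"
    by (intro sq_integrable_diff z(1) sq_integrable_const)
  have "expectation (\<lambda>\<omega>. (lam * (X \<omega> - m))\<^sup>2) = lam\<^sup>2 * variance X"
    by (simp add: power_mult_distrib m_def)
  moreover have "expectation (\<lambda>\<omega>. (1 - zeta 0 T \<omega>)\<^sup>2) = exp T - 1"
    using integral_square_diff[OF sq_integrable_const[of 1] z(1)] z by (simp add: prob_space)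
  moreover have "expectation (\<lambda>\<omega>. lam * (X \<omega> - m) * (1 - zeta 0 T \<omega>)) = lam * (m - x0)"
  proof -
    have zg: "integrable M (\<lambda>\<omega>. zeta 0 T \<omega> * gain \<alpha> T \<omega>)" by (rule sq_integrable_mult[OF z(1) g])
    have e: "(\<lambda>\<omega>. lam * (X \<omega> - m) * (1 - zeta 0 T \<omega>)) = (\<lambda>\<omega>. lam * (X \<omega> - m - (x0 - m) * zeta 0 T \<omega> - zeta 0 T \<omega> * gain \<alpha> T \<omega>))"
      by (auto simp: X_def algebra_simps)
    have "expectation (\<lambda>\<omega>. lam * (X \<omega> - m) * (1 - zeta 0 T \<omega>)) =
        lam * (expectation X - m - (x0 - m) * expectation (zeta 0 T) - expectation (\<lambda>\<omega>. zeta 0 T \<omega> * gain \<alpha> T \<omega>))"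
      unfolding e using Xi zi zg by (simp add: prob_space)
    then show ?thesis using z(2) zeta_gain[OF \<alpha>] by (simp add: m_def)
  qed
  ultimately have "expectation (\<lambda>\<omega>. (lam * (X \<omega> - m) - (1 - zeta 0 T \<omega>))\<^sup>2) = lam\<^sup>2 * variance X + (exp T - 1) - 2 * (lam * (m - x0))"
    using integral_square_diff[OF f h] by simp
  moreover have "m - lam / 2 * V = x0 + (exp T - 1) / (2 * lam) - 1 / (2 * lam) * D"
    if "D = lam\<^sup>2 * V + (exp T - 1) - 2 * (lam * (m - x0))" for D V :: real
    unfolding that using lam by (simp add: field_simps power2_eq_square)
  ultimately show ?thesis unfolding m_def by blast
qed

lemma opt_terminal:
  assumes lam: "lam > 0"
  shows "AE \<omega> in M. gain (opt (exp T / lam)) T \<omega> = (exp T - zeta 0 T \<omega>) / lam"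
  using opt_gain[of T "exp T / lam"] T_pos
  by (auto simp: gain_def field_simps mult_exp_exp elim!: eventually_mono)

lemma mean_variance_opt:
  fixes x0 :: real
  assumes lam: "lam > 0"
  defines "X \<equiv> (\<lambda>\<omega>. x0 + gain (opt (exp T / lam)) T \<omega>)"
  shows "expectation X - lam / 2 * variance X = x0 + (exp T - 1) / (2 * lam)"
proof -
  note z = zeta_T_moments
  have zi: "integrable M (zeta 0 T)" by (rule sq_integrable_integrable[OF z(1)])
  have g: "sq_integrable M (gain (opt (exp T / lam)) T)" by (rule gain_sq_integrable[OF opt_controls]) (use T_pos in auto)
  have [measurable]: "zeta 0 T \<in> borel_measurable M" "gain (opt (exp T / lam)) T \<in> borel_measurable M"
    using g z(1) by (auto simp: sq_integrable_def)
  have "expectation X = expectation (\<lambda>\<omega>. x0 + (exp T - zeta 0 T \<omega>) / lam)"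
    by (rule integral_cong_AE) (use opt_terminal[OF lam] in \<open>auto simp: X_def\<close>)
  also have "\<dots> = x0 + (exp T - 1) / lam" using zi z(2) by (simp add: prob_space)
  finally have m: "expectation X = x0 + (exp T - 1) / lam" .
  have "AE \<omega> in M. (lam * (X \<omega> - expectation X) - (1 - zeta 0 T \<omega>))\<^sup>2 = 0"
    using opt_terminal[OF lam]
  proof eventually_elim
    case (elim \<omega>)
    show ?case unfolding m unfolding X_def elim using lam by (simp add: field_simps)
  qed
  then have "expectation (\<lambda>\<omega>. (lam * (X \<omega> - expectation X) - (1 - zeta 0 T \<omega>))\<^sup>2) = 0"
    by (rule integral_eq_zero_AE)
  then show ?thesis using mean_variance_identity[OF opt_controls lam, of x0] by (simp add: X_def)
qed

lemma mean_variance_bound: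
  fixes x0 :: real
  assumes \<alpha>: "\<alpha> \<in> controls M F T" and lam: "lam > 0"
  defines "X \<equiv> (\<lambda>\<omega>. x0 + gain \<alpha> T \<omega>)"
  shows "expectation X - lam / 2 * variance X \<le> x0 + (exp T - 1) / (2 * lam)"
  unfolding X_def mean_variance_identity[OF \<alpha> lam] using lam by simp

text \<open>
  If the square vanishes, \<open>X\<close> is determined up to its mean; the mean follows from \<open>E (zeta 0 T X) = x0\<close>.
\<close>

lemma mean_variance_optimal_terminal:
  fixes x0 :: real
  assumes \<alpha>: "\<alpha> \<in> controls M F T" and lam: "lam > 0"
  defines "X \<equiv> (\<lambda>\<omega>. x0 + gain \<alpha> T \<omega>)"
  assumes opt: "expectation X - lam / 2 * variance X = x0 + (exp T - 1) / (2 * lam)"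
  shows "AE \<omega> in M. gain \<alpha> T \<omega> = (exp T - zeta 0 T \<omega>) / lam"
proof -
  note z = zeta_T_moments
  define m where "m = expectation X"
  have g: "sq_integrable M (gain \<alpha> T)" by (rule gain_sq_integrable[OF \<alpha>]) (use T_pos in auto)
  have X: "sq_integrable M X" unfolding X_def by (rule sq_integrable_add[OF sq_integrable_const g])
  have "sq_integrable M (\<lambda>\<omega>. lam * (X \<omega> - m) - (1 - zeta 0 T \<omega>))"
    by (intro sq_integrable_cmult sq_integrable_diff X sq_integrable_const z(1))
  moreover have "expectation (\<lambda>\<omega>. (lam * (X \<omega> - m) - (1 - zeta 0 T \<omega>))\<^sup>2) = 0"
    using mean_variance_identity[OF \<alpha> lam, of x0] opt lam by (simp add: X_def m_def)
  ultimately have ae: "AE \<omega> in M. lam * (X \<omega> - m) - (1 - zeta 0 T \<omega>) = 0"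
    by (rule integral_square_eq_0_imp_AE)
  have [measurable]: "zeta 0 T \<in> borel_measurable M" "gain \<alpha> T \<in> borel_measurable M"
    using g z(1) by (auto simp: sq_integrable_def)
  have i: "integrable M (zeta 0 T)" "integrable M (\<lambda>\<omega>. (zeta 0 T \<omega>)\<^sup>2)"
    using z(1) by (auto intro: sq_integrable_integrable sq_integrable_square)
  have "0 = expectation (\<lambda>\<omega>. zeta 0 T \<omega> * gain \<alpha> T \<omega>)" by (simp add: zeta_gain[OF \<alpha>])
  also have "\<dots> = expectation (\<lambda>\<omega>. (m - x0 + 1 / lam) * zeta 0 T \<omega> - (1 / lam) * (zeta 0 T \<omega>)\<^sup>2)"
  proof (rule integral_cong_AE)
    show "AE \<omega> in M. zeta 0 T \<omega> * gain \<alpha> T \<omega> = (m - x0 + 1 / lam) * zeta 0 T \<omega> - (1 / lam) * (zeta 0 T \<omega>)\<^sup>2"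
      using ae
    proof eventually_elim
      case (elim \<omega>)
      then have e: "gain \<alpha> T \<omega> = m - x0 + (1 - zeta 0 T \<omega>) / lam" using lam by (simp add: X_def field_simps)
      show ?case unfolding e by (simp add: algebra_simps power2_eq_square diff_divide_distrib)
    qed
  qed measurable
  also have "\<dots> = (m - x0 + 1 / lam) - exp T / lam" using i z by simp
  finally have "m = x0 + (exp T - 1) / lam" by (simp add: diff_divide_distrib)
  then have m: "m - x0 = (exp T - 1) / lam" by simp
  show ?thesis using ae
  proof eventually_elim
    case (elim \<omega>)
    then have "gain \<alpha> T \<omega> = (m - x0) + (1 - zeta 0 T \<omega>) / lam" using lam by (simp add: X_def field_simps)
    then show ?case unfolding m by (simp add: diff_divide_distrib)
  qed
qed

section \<open>Uniqueness of the replicating control\<close>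

text \<open>
  If \<open>gain \<delta>\<close> vanishes at time \<open>u\<close>, then the increment \<open>J\<close> of the Ito integral over \<open>[t,u]\<close>
  is minus the sum of \<open>gain \<delta> t\<close>, to which it is orthogonal, and the drift increment, whose
  norm is at most \<open>sqrt (u - t)\<close> times the norm of \<open>J\<close>.
\<close>

lemma gain_zero_step:
  assumes \<delta>: "\<delta> \<in> controls M F T" and tu: "0 \<le> t" "t \<le> u" "u \<le> T" and short: "u - t < 1"
    and zero: "AE \<omega> in M. gain \<delta> u \<omega> = 0"
  shows "AE \<omega> in M. gain \<delta> t \<omega> = 0" and "AE x in PM. cut {0..u} \<delta> x = cut {0..t} \<delta> x"
proof -
  have tT: "t \<le> T" "0 \<le> u" using tu by auto
  let ?J = "\<lambda>\<omega>. ito \<delta> u \<omega> - ito \<delta> t \<omega>" and ?A = "\<lambda>\<omega>. drift \<delta> u \<omega> - drift \<delta> t \<omega>"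
  let ?c = "\<lambda>x. cut {0..u} \<delta> x - cut {0..t} \<delta> x"
  have I: "sq_integrable M (ito \<delta> u)" "sq_integrable M (ito \<delta> t)"
    by (rule ito_sq_integrable[OF \<delta>]; use tu tT in linarith)+
  have D: "sq_integrable M (drift \<delta> u)" "sq_integrable M (drift \<delta> t)"
    by (rule drift_sq_integrable[OF \<delta>]; use tu tT in linarith)+
  have C: "sq_integrable PM (cut {0..u} \<delta>)" "sq_integrable PM (cut {0..t} \<delta>)"
    by (rule controls_cut_sq_integrable[OF \<delta>]; use tu tT in linarith)+
  have J: "sq_integrable M ?J" and A: "sq_integrable M ?A" and c: "sq_integrable PM ?c"
    by (rule sq_integrable_diff[OF I] sq_integrable_diff[OF D] sq_integrable_diff[OF C])+
  define n where "n = (\<integral>x. (?c x)\<^sup>2 \<partial>PM)"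
  have JJ: "expectation (\<lambda>\<omega>. (?J \<omega>)\<^sup>2) = n"
    unfolding n_def integral_square_diff[OF I] integral_square_diff[OF C]
    by (simp add: power2_eq_square ito_isometry \<delta> tu tT)
  have AA: "expectation (\<lambda>\<omega>. (?A \<omega>)\<^sup>2) \<le> (u - t) * n"
    unfolding n_def by (rule drift_increment_norm[OF \<delta> tu])
  have "expectation (\<lambda>\<omega>. ito \<delta> t \<omega> * ?J \<omega>) = 0"
  proof -
    have "(\<integral>x. cut {0..t} \<delta> x * cut {0..u} \<delta> x \<partial>PM) = (\<integral>x. cut {0..t} \<delta> x * cut {0..t} \<delta> x \<partial>PM)"
      using tu by (intro Bochner_Integration.integral_cong refl) (auto simp: cut_def indicator_def)
    then show ?thesis
      using I by (simp add: right_diff_distrib sq_integrable_mult ito_isometry \<delta> tu tT)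
  qed
  moreover have "expectation (\<lambda>\<omega>. drift \<delta> t \<omega> * ?J \<omega>) = 0"
    by (rule ito_increment_orthogonal[OF \<delta> tu drift_F[OF \<delta> tu(1) tT(1)] D(2)])
  moreover have "expectation (\<lambda>\<omega>. (drift \<delta> t \<omega> * ?J \<omega> + ito \<delta> t \<omega> * ?J \<omega>) + (?A \<omega> * ?J \<omega> + (?J \<omega>)\<^sup>2)) =
     (expectation (\<lambda>\<omega>. drift \<delta> t \<omega> * ?J \<omega>) + expectation (\<lambda>\<omega>. ito \<delta> t \<omega> * ?J \<omega>))
     + (expectation (\<lambda>\<omega>. ?A \<omega> * ?J \<omega>) + expectation (\<lambda>\<omega>. (?J \<omega>)\<^sup>2))"
    using sq_integrable_mult[OF D(2) J] sq_integrable_mult[OF I(2) J] sq_integrable_mult[OF A J] sq_integrable_square[OF J]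
    by (simp only: Bochner_Integration.integral_add Bochner_Integration.integrable_add)
  moreover have "expectation (\<lambda>\<omega>. (drift \<delta> t \<omega> * ?J \<omega> + ito \<delta> t \<omega> * ?J \<omega>) + (?A \<omega> * ?J \<omega> + (?J \<omega>)\<^sup>2)) = 0"
  proof (rule integral_eq_zero_AE)
    show "AE \<omega> in M. (drift \<delta> t \<omega> * ?J \<omega> + ito \<delta> t \<omega> * ?J \<omega>) + (?A \<omega> * ?J \<omega> + (?J \<omega>)\<^sup>2) = 0"
      using zero
    proof eventually_elim
      case (elim \<omega>)
      have "(drift \<delta> t \<omega> * ?J \<omega> + ito \<delta> t \<omega> * ?J \<omega>) + (?A \<omega> * ?J \<omega> + (?J \<omega>)\<^sup>2) = gain \<delta> u \<omega> * ?J \<omega>"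
        by (simp add: gain_def power2_eq_square algebra_simps)
      then show ?case using elim by simp
    qed
  qed
  ultimately have "n = - expectation (\<lambda>\<omega>. ?A \<omega> * ?J \<omega>)" using JJ by simp
  then have "n\<^sup>2 = (expectation (\<lambda>\<omega>. ?A \<omega> * ?J \<omega>))\<^sup>2" by simp
  also have "\<dots> \<le> expectation (\<lambda>\<omega>. (?A \<omega>)\<^sup>2) * n" using Cauchy_Schwarz_integral[OF A J] JJ by simp
  also have "\<dots> \<le> (u - t) * n * n" using AA by (intro mult_right_mono) (auto simp: n_def)
  finally have "(1 - (u - t)) * n\<^sup>2 \<le> 0" by (simp add: power2_eq_square algebra_simps)
  then have "n = 0" using short by (simp add: mult_le_0_iff)
  then have J0: "AE \<omega> in M. ?J \<omega> = 0" and c0: "AE x in PM. ?c x = 0"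
    using integral_square_eq_0_imp_AE[OF J] integral_square_eq_0_imp_AE[OF c] JJ by (auto simp: n_def)
  have "expectation (\<lambda>\<omega>. (?A \<omega>)\<^sup>2) = 0" using AA \<open>n = 0\<close> by (intro antisym) auto
  then have A0: "AE \<omega> in M. ?A \<omega> = 0" by (rule integral_square_eq_0_imp_AE[OF A])
  show "AE \<omega> in M. gain \<delta> t \<omega> = 0"
    using zero J0 A0 by eventually_elim (simp add: gain_def)
  show "AE x in PM. cut {0..u} \<delta> x = cut {0..t} \<delta> x" using c0 by eventually_elim simp
qed

text \<open>
  Backwards from \<open>T\<close> in steps shorter than \<open>1\<close>.
\<close>

lemma gain_zero_imp_control_zero:
  assumes \<delta>: "\<delta> \<in> controls M F T" and zero: "AE \<omega> in M. gain \<delta> T \<omega> = 0"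
  shows "AE x in PM. cut {0..T} \<delta> x = 0"
proof -
  have T: "0 \<le> T" using T_pos by simp
  obtain N :: nat where N: "T < real N" using reals_Archimedean2 by blast
  then have N0: "N > 0" using T by (cases N) auto
  have short: "T / real N < 1" using N N0 by simp
  have "(AE \<omega> in M. gain \<delta> (grid T N (N - i)) \<omega> = 0) \<and> (AE x in PM. cut {0..T} \<delta> x = cut {0..grid T N (N - i)} \<delta> x)"
    if "i \<le> N" for i
    using that
  proof (induction i)
    case 0
    then show ?case using zero N0 by (simp add: grid_end)
  next
    case (Suc i)
    define j where "j = N - Suc i"
    have j: "N - i = Suc j" "Suc j \<le> N" using Suc.prems by (auto simp: j_def)
    have tu: "0 \<le> grid T N j" "grid T N j \<le> grid T N (Suc j)" "grid T N (Suc j) \<le> T"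
      using grid_mono[OF T, of "Suc j" N N] j T N0 by (auto simp: grid_end intro!: grid_mono grid_nonneg)
    have sh: "grid T N (Suc j) - grid T N j < 1" using short by (simp add: grid_Suc)
    have IH: "AE \<omega> in M. gain \<delta> (grid T N (Suc j)) \<omega> = 0" "AE x in PM. cut {0..T} \<delta> x = cut {0..grid T N (Suc j)} \<delta> x"
      using Suc by (auto simp: j)
    note step = gain_zero_step[OF \<delta> tu sh IH(1)]
    show ?case using step(1) step(2) IH(2) by (auto simp: j_def[symmetric])
  qed
  from this[of N] have "AE x in PM. cut {0..T} \<delta> x = cut {0..0} \<delta> x" by (simp add: grid_0)
  then show ?thesis using cut_0_AE[OF \<delta>] by eventually_elim simp
qed

lemma control_unique:
  assumes \<alpha>: "\<alpha> \<in> controls M F T" and \<beta>: "\<beta> \<in> controls M F T"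
    and eq: "AE \<omega> in M. gain \<alpha> T \<omega> = gain \<beta> T \<omega>"
  shows "AE x in PM. cut {0..T} \<alpha> x = cut {0..T} \<beta> x"
proof -
  have T: "0 \<le> T" using T_pos by simp
  have "AE \<omega> in M. gain (\<lambda>r \<omega>. \<alpha> r \<omega> - \<beta> r \<omega>) T \<omega> = 0"
    using eq ito_diff[OF \<alpha> \<beta> T order.refl] drift_diff[OF \<alpha> \<beta> T order.refl]
    by eventually_elim (simp add: gain_def)
  from gain_zero_imp_control_zero[OF controls_diff[OF \<alpha> \<beta>] this]
  show ?thesis by eventually_elim (auto simp: cut_def right_diff_distrib)
qed

lemma gain_cong_AE:
  assumes "\<alpha> \<in> controls M F T" "\<beta> \<in> controls M F T" "0 \<le> s" "s \<le> T"
    and eq: "AE x in PM. cut {0..s} \<alpha> x = cut {0..s} \<beta> x"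
  shows "AE \<omega> in M. gain \<alpha> s \<omega> = gain \<beta> s \<omega>"
  using ito_cong_AE[OF assms] drift_cong_AE[OF assms] by eventually_elim (simp add: gain_def)

end

section \<open>The dynamic problem\<close>

lemma nonneg_on_Rats_imp_nonneg:
  fixes f :: "real \<Rightarrow> real"
  assumes "continuous_on UNIV f" "\<And>q. q \<in> \<rat> \<Longrightarrow> 0 \<le> f q"
  shows "0 \<le> f x"
proof (rule continuous_ge_on_closure[where S="\<rat>" and f=f and x=x and a=0])
  show "continuous_on (closure \<rat>) f" using assms(1) by (rule continuous_on_subset) simp
  show "x \<in> closure \<rat>" by (simp add: Rats_closure_real)
qed (rule assms(2))

context brownian_filtration
begin

lemma cond_exp_zeta:
  assumes t: "0 \<le> t" "t \<le> T" and H: "H \<in> borel_measurable (F t)" "integrable M H"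
  shows "AE \<omega> in M. real_cond_exp M (F t) (\<lambda>\<omega>. H \<omega> * zeta t T \<omega>) \<omega> = H \<omega>"
    and "AE \<omega> in M. real_cond_exp M (F t) (\<lambda>\<omega>. H \<omega> * (zeta t T \<omega>)\<^sup>2) \<omega> = H \<omega> * exp (T - t)"
    and "integrable M (\<lambda>\<omega>. H \<omega> * zeta t T \<omega>)" and "integrable M (\<lambda>\<omega>. H \<omega> * (zeta t T \<omega>)\<^sup>2)"
proof -
  interpret sub: finite_measure_subalgebra M "F t" by standard (rule subalg[OF t])
  have m: "(\<lambda>\<omega>. indicator A \<omega> * H \<omega>) \<in> borel_measurable (F t)" and i: "integrable M (\<lambda>\<omega>. indicator A \<omega> * H \<omega>)"
    if "A \<in> sets (F t)" for A
  proof -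
    show "(\<lambda>\<omega>. indicator A \<omega> * H \<omega>) \<in> borel_measurable (F t)" using that H by measurable
    have "A \<in> sets M" using that subalg[OF t] by (auto simp: subalgebra_def)
    from integrable_mult_indicator[OF this H(2)] show "integrable M (\<lambda>\<omega>. indicator A \<omega> * H \<omega>)" by simp
  qed
  note z = zeta_moments[OF t(1) t(2) order.refl]
  show iz: "integrable M (\<lambda>\<omega>. H \<omega> * zeta t T \<omega>)" "integrable M (\<lambda>\<omega>. H \<omega> * (zeta t T \<omega>)\<^sup>2)"
    using z(1)[OF H] z(2)[OF H] by (auto simp: has_bochner_integral_iff)
  show "AE \<omega> in M. real_cond_exp M (F t) (\<lambda>\<omega>. H \<omega> * zeta t T \<omega>) \<omega> = H \<omega>"
  proof (rule sub.real_cond_exp_charact[OF _ iz(1) H(2,1)])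
    fix A assume A: "A \<in> sets (F t)"
    show "(\<integral>\<omega>\<in>A. H \<omega> * zeta t T \<omega> \<partial>M) = (\<integral>\<omega>\<in>A. H \<omega> \<partial>M)"
      using z(1)[OF m[OF A] i[OF A]] by (simp add: set_lebesgue_integral_def has_bochner_integral_iff mult.assoc)
  qed
  show "AE \<omega> in M. real_cond_exp M (F t) (\<lambda>\<omega>. H \<omega> * (zeta t T \<omega>)\<^sup>2) \<omega> = H \<omega> * exp (T - t)"
  proof (rule sub.real_cond_exp_charact[OF _ iz(2)])
    fix A assume A: "A \<in> sets (F t)"
    have "expectation (\<lambda>\<omega>. (indicator A \<omega> * H \<omega>) * exp (T - t)) = expectation (\<lambda>\<omega>. indicator A \<omega> * H \<omega>) * exp (T - t)"
      by (rule integral_mult_left_zero)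
    then show "(\<integral>\<omega>\<in>A. H \<omega> * (zeta t T \<omega>)\<^sup>2 \<partial>M) = (\<integral>\<omega>\<in>A. H \<omega> * exp (T - t) \<partial>M)"
      using z(2)[OF m[OF A] i[OF A]] by (simp add: set_lebesgue_integral_def has_bochner_integral_iff mult.assoc)
  qed (use H in auto)
qed

lemma cond_exp_zeta_wealth:
  fixes x0 :: real
  assumes \<alpha>: "\<alpha> \<in> controls M F T" and t: "0 \<le> t" "t \<le> T"
    and Y: "Y \<in> borel_measurable (F t)" "AE \<omega> in M. Y \<omega> = x0 + gain \<alpha> t \<omega>"
  shows "AE \<omega> in M. real_cond_exp M (F t) (\<lambda>\<omega>. zeta t T \<omega> * (x0 + gain \<alpha> T \<omega>)) \<omega> = Y \<omega>"
proof -
  interpret sub: finite_measure_subalgebra M "F t" by standard (rule subalg[OF t])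
  have g: "sq_integrable M (gain \<alpha> T)" "sq_integrable M (gain \<alpha> t)"
    by (rule gain_sq_integrable[OF \<alpha>]; use t in linarith)+
  have z: "sq_integrable M (zeta t T)" by (rule zeta_sq_integrable[OF t order.refl])
  have YM: "Y \<in> borel_measurable M" by (rule F_imp_M[OF Y(1) t])
  have Ys: "sq_integrable M Y"
    by (rule sq_integrable_cong_AE[OF sq_integrable_add[OF sq_integrable_const g(2)] YM]) (use Y(2) in auto)
  show ?thesis
  proof (rule sub.real_cond_exp_charact[OF _ _ sq_integrable_integrable[OF Ys] Y(1)])
    show "integrable M (\<lambda>\<omega>. zeta t T \<omega> * (x0 + gain \<alpha> T \<omega>))"
      by (intro sq_integrable_mult z sq_integrable_add sq_integrable_const g)
    fix A assume A: "A \<in> sets (F t)"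
    have AM: "A \<in> sets M" using A subalg[OF t] by (auto simp: subalgebra_def)
    have b: "bounded_F t (indicator A)"
      unfolding bounded_F_def using A by (auto intro!: exI[of _ 1] simp: indicator_def)
    have Nz: "sq_integrable M (\<lambda>\<omega>. indicator A \<omega> * zeta t T \<omega>)"
      by (rule bounded_zeta_sq_integrable[OF t order.refl b])
    have m: "(\<lambda>\<omega>. indicator A \<omega> * Y \<omega>) \<in> borel_measurable (F t)" using A Y(1) by measurable
    have i: "integrable M (\<lambda>\<omega>. indicator A \<omega> * Y \<omega>)"
      using integrable_mult_indicator[OF AM sq_integrable_integrable[OF Ys]] by simp
    have e1: "expectation (\<lambda>\<omega>. indicator A \<omega> * Y \<omega> * zeta t T \<omega>) = expectation (\<lambda>\<omega>. indicator A \<omega> * Y \<omega>)"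
      and i1: "integrable M (\<lambda>\<omega>. indicator A \<omega> * Y \<omega> * zeta t T \<omega>)"
      using zeta_moments(1)[OF t order.refl m i] by (auto simp: has_bochner_integral_iff)
    have e2: "expectation (\<lambda>\<omega>. (indicator A \<omega> * zeta t T \<omega>) * (gain \<alpha> T \<omega> - gain \<alpha> t \<omega>)) = 0"
      using zeta_weighted_gain[OF \<alpha> t order.refl b] by (simp add: gain_def)
    have i2: "integrable M (\<lambda>\<omega>. (indicator A \<omega> * zeta t T \<omega>) * (gain \<alpha> T \<omega> - gain \<alpha> t \<omega>))"
      by (intro sq_integrable_mult Nz sq_integrable_diff g)
    have [measurable]: "indicat_real A \<in> borel_measurable M" "zeta t T \<in> borel_measurable M" "Y \<in> borel_measurable M"
      "gain \<alpha> T \<in> borel_measurable M" "gain \<alpha> t \<in> borel_measurable M"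
      using AM g z YM by (auto simp: sq_integrable_def)
    have "(\<integral>\<omega>\<in>A. zeta t T \<omega> * (x0 + gain \<alpha> T \<omega>) \<partial>M) =
      expectation (\<lambda>\<omega>. indicator A \<omega> * Y \<omega> * zeta t T \<omega> + (indicator A \<omega> * zeta t T \<omega>) * (gain \<alpha> T \<omega> - gain \<alpha> t \<omega>))"
      unfolding set_lebesgue_integral_def
    proof (rule integral_cong_AE)
      show "AE \<omega> in M. indicator A \<omega> *\<^sub>R (zeta t T \<omega> * (x0 + gain \<alpha> T \<omega>)) =
        indicator A \<omega> * Y \<omega> * zeta t T \<omega> + (indicator A \<omega> * zeta t T \<omega>) * (gain \<alpha> T \<omega> - gain \<alpha> t \<omega>)"
        using Y(2) by eventually_elim (simp add: algebra_simps)
    qed measurable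
    also have "\<dots> = expectation (\<lambda>\<omega>. indicator A \<omega> * Y \<omega>)" using i1 i2 e1 e2 by simp
    finally show "(\<integral>\<omega>\<in>A. zeta t T \<omega> * (x0 + gain \<alpha> T \<omega>) \<partial>M) = (\<integral>\<omega>\<in>A. Y \<omega> \<partial>M)"
      by (simp add: set_lebesgue_integral_def)
  qed
qed

text \<open>
  The conditional form of completing the square. The inequality
  \<open>0 \<le> (1 - zeta t T - q (X - p))\<^sup>2\<close> is conditioned for constants \<open>p\<close> and \<open>q\<close>, where all terms are
  integrable. It then holds almost surely for all rational \<open>p\<close> and \<open>q\<close> at once, and by continuity
  for all real ones, so that \<open>p\<close> may be the conditional mean and \<open>q\<close> a random weight.
\<close>

lemma conditional_mean_variance_bound:
  fixes x0 :: real
  assumes \<alpha>: "\<alpha> \<in> controls M F T" and t: "0 \<le> t" "t \<le> T"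
    and Y: "Y \<in> borel_measurable (F t)" "AE \<omega> in M. Y \<omega> = x0 + gain \<alpha> t \<omega>"
  defines "X \<equiv> (\<lambda>\<omega>. x0 + gain \<alpha> T \<omega>)"
  shows "AE \<omega> in M. \<forall>q>0. real_cond_exp M (F t) X \<omega> - 1 / 2 * q * cond_var M (F t) X \<omega>
    \<le> Y \<omega> + (exp (T - t) - 1) / (2 * q)"
proof -
  interpret sub: finite_measure_subalgebra M "F t" by standard (rule subalg[OF t])
  let ?E = "real_cond_exp M (F t)"
  define Z where "Z = zeta t T"
  have g: "sq_integrable M (gain \<alpha> T)" by (rule gain_sq_integrable[OF \<alpha>]) (use t in auto)
  have X: "sq_integrable M X" unfolding X_def by (rule sq_integrable_add[OF sq_integrable_const g])
  have z: "sq_integrable M Z" unfolding Z_def by (rule zeta_sq_integrable[OF t order.refl])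
  have i: "integrable M X" "integrable M (\<lambda>\<omega>. (X \<omega>)\<^sup>2)" "integrable M Z" "integrable M (\<lambda>\<omega>. (Z \<omega>)\<^sup>2)"
    "integrable M (\<lambda>\<omega>. Z \<omega> * X \<omega>)"
    using X z by (auto intro: sq_integrable_integrable sq_integrable_square sq_integrable_mult)
  have one: "(\<lambda>_. 1) \<in> borel_measurable (F t)" "integrable M (\<lambda>_. 1 :: real)" by auto
  have EZ: "AE \<omega> in M. ?E Z \<omega> = 1" and EZ2: "AE \<omega> in M. ?E (\<lambda>\<omega>. (Z \<omega>)\<^sup>2) \<omega> = exp (T - t)"
    using cond_exp_zeta(1,2)[OF t one] by (simp_all add: Z_def)
  have EZX: "AE \<omega> in M. ?E (\<lambda>\<omega>. Z \<omega> * X \<omega>) \<omega> = Y \<omega>"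
    unfolding Z_def X_def by (rule cond_exp_zeta_wealth[OF \<alpha> t Y])
  have rat: "AE \<omega> in M. 0 \<le> (exp (T - t) - 1) + q\<^sup>2 * (?E (\<lambda>\<omega>. (X \<omega>)\<^sup>2) \<omega> - 2 * p * ?E X \<omega> + p\<^sup>2) - 2 * q * (?E X \<omega> - Y \<omega>)"
    for p q :: real
  proof -
    let ?f = "\<lambda>\<omega>. (1 - Z \<omega> - q * (X \<omega> - p))\<^sup>2"
    have e: "?f = (\<lambda>\<omega>. ((1 + 2 * q * p + q\<^sup>2 * p\<^sup>2) + (- 2 - 2 * q * p) * Z \<omega>) + ((Z \<omega>)\<^sup>2 + q\<^sup>2 * (X \<omega>)\<^sup>2)
        + ((- 2 * q - 2 * q\<^sup>2 * p) * X \<omega> + 2 * q * (Z \<omega> * X \<omega>)))"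
      by (auto simp: power2_eq_square algebra_simps)
    have "AE \<omega> in M. ?E ?f \<omega> \<ge> 0"
      by (rule sub.real_cond_exp_pos) (use X z in \<open>auto simp: sq_integrable_def\<close>)
    moreover have "AE \<omega> in M. ?E ?f \<omega> = ((1 + 2 * q * p + q\<^sup>2 * p\<^sup>2) + (- 2 - 2 * q * p) * ?E Z \<omega>) + (?E (\<lambda>\<omega>. (Z \<omega>)\<^sup>2) \<omega> + q\<^sup>2 * ?E (\<lambda>\<omega>. (X \<omega>)\<^sup>2) \<omega>)
        + ((- 2 * q - 2 * q\<^sup>2 * p) * ?E X \<omega> + 2 * q * ?E (\<lambda>\<omega>. Z \<omega> * X \<omega>) \<omega>)"
    proof -
      let ?c = "\<lambda>\<omega>::'a. 1 + 2 * q * p + q\<^sup>2 * p\<^sup>2" and ?a1 = "\<lambda>\<omega>. (- 2 - 2 * q * p) * Z \<omega>"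
        and ?a2 = "\<lambda>\<omega>. q\<^sup>2 * (X \<omega>)\<^sup>2" and ?a3 = "\<lambda>\<omega>. (- 2 * q - 2 * q\<^sup>2 * p) * X \<omega>" and ?a4 = "\<lambda>\<omega>. 2 * q * (Z \<omega> * X \<omega>)"
      have I: "integrable M ?c" "integrable M ?a1" "integrable M ?a2" "integrable M ?a3" "integrable M ?a4"
        using i by auto
      have I2: "integrable M (\<lambda>\<omega>. ?c \<omega> + ?a1 \<omega>)" "integrable M (\<lambda>\<omega>. (Z \<omega>)\<^sup>2 + ?a2 \<omega>)" "integrable M (\<lambda>\<omega>. ?a3 \<omega> + ?a4 \<omega>)"
        by (intro Bochner_Integration.integrable_add I i)+
      have I3: "integrable M (\<lambda>\<omega>. (?c \<omega> + ?a1 \<omega>) + ((Z \<omega>)\<^sup>2 + ?a2 \<omega>))"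
        by (intro Bochner_Integration.integrable_add I2)
      show ?thesis unfolding e
        using sub.real_cond_exp_add[OF I3 I2(3)] sub.real_cond_exp_add[OF I2(1,2)] sub.real_cond_exp_add[OF I(1,2)]
          sub.real_cond_exp_add[OF i(4) I(3)] sub.real_cond_exp_add[OF I(4,5)]
          sub.real_cond_exp_F_meas[OF I(1) borel_measurable_const] sub.real_cond_exp_cmult[OF i(3), of "- 2 - 2 * q * p"]
          sub.real_cond_exp_cmult[OF i(2), of "q\<^sup>2"] sub.real_cond_exp_cmult[OF i(1), of "- 2 * q - 2 * q\<^sup>2 * p"]
          sub.real_cond_exp_cmult[OF i(5), of "2 * q"]
        by eventually_elim simp
    qed
    ultimately show ?thesis using EZ EZ2 EZX
      by eventually_elim (simp add: power2_eq_square algebra_simps)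
  qed
  have "AE \<omega> in M. \<forall>p\<in>\<rat>. \<forall>q\<in>\<rat>. 0 \<le> (exp (T - t) - 1) + q\<^sup>2 * (?E (\<lambda>\<omega>. (X \<omega>)\<^sup>2) \<omega> - 2 * p * ?E X \<omega> + p\<^sup>2) - 2 * q * (?E X \<omega> - Y \<omega>)"
    using rat by (simp add: AE_ball_countable countable_rat)
  then show ?thesis
  proof eventually_elim
    case (elim \<omega>)
    define a where "a = ?E X \<omega>"
    define v where "v = ?E (\<lambda>\<omega>. (X \<omega>)\<^sup>2) \<omega>"
    let ?h = "\<lambda>p q. (exp (T - t) - 1) + q\<^sup>2 * (v - 2 * p * a + p\<^sup>2) - 2 * q * (a - Y \<omega>)"
    have rat1: "0 \<le> ?h p q" if "p \<in> \<rat>" for p q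
      by (rule nonneg_on_Rats_imp_nonneg) (use elim that in \<open>auto simp: a_def v_def intro!: continuous_intros\<close>)
    have h: "0 \<le> ?h p q" for p q
    proof (rule nonneg_on_Rats_imp_nonneg[where f="\<lambda>p. ?h p q" and x=p])
      show "continuous_on UNIV (\<lambda>p. ?h p q)" by (intro continuous_intros)
    qed (rule rat1)
    show ?case
    proof (intro allI impI)
      fix q :: real assume "q > 0"
      have "0 \<le> (exp (T - t) - 1) + q\<^sup>2 * (v - a\<^sup>2) - 2 * q * (a - Y \<omega>)"
        using h[of q a] by (simp add: power2_eq_square)
      then have "0 \<le> ((exp (T - t) - 1) + q\<^sup>2 * (v - a\<^sup>2) - 2 * q * (a - Y \<omega>)) / (2 * q)"
        using \<open>q > 0\<close> by simp
      also have "\<dots> = (exp (T - t) - 1) / (2 * q) + 1 / 2 * q * (v - a\<^sup>2) - (a - Y \<omega>)"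
        using \<open>q > 0\<close> by (simp add: field_simps power2_eq_square)
      finally show "?E X \<omega> - 1 / 2 * q * cond_var M (F t) X \<omega> \<le> Y \<omega> + (exp (T - t) - 1) / (2 * q)"
        by (simp add: cond_var_def a_def v_def)
    qed
  qed
qed

lemma conditional_moments_affine:
  assumes t: "0 \<le> t" "t \<le> T" and X: "X \<in> borel_measurable M" "AE \<omega> in M. X \<omega> = c - l * zeta 0 T \<omega>"
  shows "AE \<omega> in M. real_cond_exp M (F t) X \<omega> = c - l * zeta 0 t \<omega>"
    and "AE \<omega> in M. cond_var M (F t) X \<omega> = l\<^sup>2 * (zeta 0 t \<omega>)\<^sup>2 * (exp (T - t) - 1)"
proof -
  interpret sub: finite_measure_subalgebra M "F t" by standard (rule subalg[OF t])
  let ?E = "real_cond_exp M (F t)"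
  define H where "H = zeta 0 t"
  define Z where "Z = zeta t T"
  have HZ: "zeta 0 T \<omega> = H \<omega> * Z \<omega>" for \<omega> unfolding H_def Z_def by (simp add: zeta_mult)
  have Hs: "sq_integrable M H" unfolding H_def by (rule zeta_sq_integrable) (use t in auto)
  have Hm: "H \<in> borel_measurable (F t)" unfolding H_def by (rule zeta_F) (use t in auto)
  have H2m: "(\<lambda>\<omega>. (H \<omega>)\<^sup>2) \<in> borel_measurable (F t)" using Hm by measurable
  note 1 = cond_exp_zeta[OF t Hm sq_integrable_integrable[OF Hs], folded Z_def]
  note 2 = cond_exp_zeta[OF t H2m sq_integrable_square[OF Hs], folded Z_def]
  have [measurable]: "H \<in> borel_measurable M" "Z \<in> borel_measurable M"
    using Hs zeta_sq_integrable[OF t order.refl] by (auto simp: sq_integrable_def Z_def)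
  have I: "integrable M (\<lambda>\<omega>. c)" "integrable M (\<lambda>\<omega>. l * (H \<omega> * Z \<omega>))" using 1(3) by auto
  have "AE \<omega> in M. ?E X \<omega> = ?E (\<lambda>\<omega>. c - l * (H \<omega> * Z \<omega>)) \<omega>"
    by (rule sub.real_cond_exp_cong) (use X in \<open>auto simp: HZ\<close>)
  then show m: "AE \<omega> in M. ?E X \<omega> = c - l * zeta 0 t \<omega>"
    using sub.real_cond_exp_diff[OF I] sub.real_cond_exp_F_meas[OF I(1) borel_measurable_const] sub.real_cond_exp_cmult[OF 1(3), of l] 1(1)
    by eventually_elim (simp add: H_def)
  have J: "integrable M (\<lambda>\<omega>. c\<^sup>2)" "integrable M (\<lambda>\<omega>. (2 * c * l) * (H \<omega> * Z \<omega>))" "integrable M (\<lambda>\<omega>. l\<^sup>2 * ((H \<omega>)\<^sup>2 * (Z \<omega>)\<^sup>2))"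
    using 1(3) 2(4) by auto
  have J2: "integrable M (\<lambda>\<omega>. c\<^sup>2 - (2 * c * l) * (H \<omega> * Z \<omega>))" by (intro Bochner_Integration.integrable_diff J)
  have "AE \<omega> in M. ?E (\<lambda>\<omega>. (X \<omega>)\<^sup>2) \<omega> = ?E (\<lambda>\<omega>. (c\<^sup>2 - (2 * c * l) * (H \<omega> * Z \<omega>)) + l\<^sup>2 * ((H \<omega>)\<^sup>2 * (Z \<omega>)\<^sup>2)) \<omega>"
  proof (rule sub.real_cond_exp_cong)
    show "AE \<omega> in M. (X \<omega>)\<^sup>2 = (c\<^sup>2 - (2 * c * l) * (H \<omega> * Z \<omega>)) + l\<^sup>2 * ((H \<omega>)\<^sup>2 * (Z \<omega>)\<^sup>2)"
      using X(2)
    proof eventually_elim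
      case (elim \<omega>)
      show ?case unfolding elim HZ by (simp add: power2_eq_square algebra_simps)
    qed
  qed (use X in measurable)
  then have "AE \<omega> in M. ?E (\<lambda>\<omega>. (X \<omega>)\<^sup>2) \<omega> = c\<^sup>2 - 2 * c * l * H \<omega> + l\<^sup>2 * ((H \<omega>)\<^sup>2 * exp (T - t))"
    using sub.real_cond_exp_add[OF J2 J(3)] sub.real_cond_exp_diff[OF J(1,2)] sub.real_cond_exp_F_meas[OF J(1) borel_measurable_const]
      sub.real_cond_exp_cmult[OF 1(3), of "2 * c * l"] sub.real_cond_exp_cmult[OF 2(4), of "l\<^sup>2"] 1(1) 2(2)
    by eventually_elim simp
  with m show "AE \<omega> in M. cond_var M (F t) X \<omega> = l\<^sup>2 * (zeta 0 t \<omega>)\<^sup>2 * (exp (T - t) - 1)"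
  proof eventually_elim
    case (elim \<omega>)
    show ?case unfolding cond_var_def elim H_def by (simp add: power2_eq_square algebra_simps)
  qed
qed

end

section \<open>The augmented filtration of a Brownian motion\<close>

text \<open>
  Augmentation changes events only by null sets, and so preserves the independence of the
  increments.
\<close>

lemma sigma_null_sets_modification:
  assumes G: "space G = space P" "sets G \<subseteq> sets P"
    and A: "A \<in> sigma_sets (space P) (sets G \<union> null_sets P)"
  shows "\<exists>A'\<in>sets G. AE \<omega> in P. \<omega> \<in> A \<longleftrightarrow> \<omega> \<in> A'"
  using A
proof induction
  case (Basic a)
  show ?case
  proof (cases "a \<in> sets G")
    case True
    then show ?thesis by auto
  next
    case False
    then have "a \<in> null_sets P" using Basic by auto
    then have "AE \<omega> in P. \<omega> \<in> a \<longleftrightarrow> \<omega> \<in> {}" using AE_not_in by auto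
    then show ?thesis by blast
  qed
next
  case Empty
  show ?case by (intro bexI[of _ "{}"]) auto
next
  case (Compl a)
  then obtain a' where a': "a' \<in> sets G" "AE \<omega> in P. \<omega> \<in> a \<longleftrightarrow> \<omega> \<in> a'" by blast
  from a'(2) have "AE \<omega> in P. \<omega> \<in> space P - a \<longleftrightarrow> \<omega> \<in> space P - a'" by eventually_elim auto
  moreover have "space P - a' \<in> sets G" using a'(1) sets.compl_sets[of a' G] G(1) by simp
  ultimately show ?case by blast
next
  case (Union a)
  then have "\<forall>i::nat. \<exists>a'. a' \<in> sets G \<and> (AE \<omega> in P. \<omega> \<in> a i \<longleftrightarrow> \<omega> \<in> a')" by blast
  then obtain a' where a': "\<forall>i. a' i \<in> sets G \<and> (AE \<omega> in P. \<omega> \<in> a i \<longleftrightarrow> \<omega> \<in> a' i)"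
    by (rule choice[THEN exE])
  then have "AE \<omega> in P. \<forall>i. \<omega> \<in> a i \<longleftrightarrow> \<omega> \<in> a' i" by (simp add: AE_all_countable)
  then have "AE \<omega> in P. \<omega> \<in> (\<Union>i. a i) \<longleftrightarrow> \<omega> \<in> (\<Union>i. a' i)" by eventually_elim auto
  moreover have "(\<Union>i. a' i) \<in> sets G" using a' by (intro sets.countable_UN) auto
  ultimately show ?case by blast
qed

lemma distributed_completion:
  assumes "distributed W N X f"
  shows "distributed (completion W) N X f"
proof -
  have X: "X \<in> W \<rightarrow>\<^sub>M N" and d: "distr W N X = density N f" and f: "f \<in> borel_measurable N"
    using assms by (auto simp: distributed_def)
  have X': "X \<in> completion W \<rightarrow>\<^sub>M N" using X by (rule measurable_completion)
  have "distr (completion W) N X = distr W N X"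
  proof (rule measure_eqI)
    fix A assume "A \<in> sets (distr (completion W) N X)"
    then have A: "A \<in> sets N" by simp
    have "X -` A \<inter> space W \<in> sets W" using X A by (rule measurable_sets)
    then show "emeasure (distr (completion W) N X) A = emeasure (distr W N X) A"
      using A X X' by (simp add: emeasure_distr)
  qed simp
  then show ?thesis using X' d f by (simp add: distributed_def)
qed

lemma prob_space_completion:
  assumes "prob_space W" shows "prob_space (completion W)"
  using prob_space.emeasure_space_1[OF assms] by (intro prob_spaceI) simp

lemma brownian_motion_augmented:
  fixes W :: "'a measure"
  assumes T: "T > 0" and bm: "brownian_motion W T B"
  shows "brownian_filtration (completion W) (augmented_filtration (completion W) B) T B"
proof -
  let ?P = "completion W"
  have W: "prob_space W" and Bm: "\<And>t. 0 \<le> t \<Longrightarrow> t \<le> T \<Longrightarrow> B t \<in> borel_measurable W"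
    and cont: "\<And>\<omega>. \<omega> \<in> space W \<Longrightarrow> continuous_on {0..T} (\<lambda>t. B t \<omega>)"
    and incr: "\<And>s t. 0 \<le> s \<Longrightarrow> s < t \<Longrightarrow> t \<le> T \<Longrightarrow>
        distributed W lborel (\<lambda>\<omega>. B t \<omega> - B s \<omega>) (normal_density 0 (sqrt (t - s)))"
    and indep: "\<And>s t. 0 \<le> s \<Longrightarrow> s < t \<Longrightarrow> t \<le> T \<Longrightarrow> prob_space.indep_set W (sets (natural_filtration W B s))
          (sets (vimage_algebra (space W) (\<lambda>\<omega>. B t \<omega> - B s \<omega>) borel))"
    using bm by (auto simp: brownian_motion_def)
  interpret W: prob_space W by (rule W)
  interpret P: prob_space ?P by (rule prob_space_completion[OF W])
  define gen where "gen t = (\<Union>s\<in>{0..t}. {B s -` A \<inter> space W | A. A \<in> sets borel})" for t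
  define G where "G t = natural_filtration W B t" for t
  have gen_Pow: "gen t \<subseteq> Pow (space W)" for t by (auto simp: gen_def)
  have G_P: "natural_filtration ?P B t = G t" for t by (simp add: G_def natural_filtration_def)
  have sets_G: "sets (G t) = sigma_sets (space W) (gen t)" and space_G: "space (G t) = space W" for t
    using gen_Pow[of t] by (simp_all add: G_def natural_filtration_def gen_def sets_measure_of space_measure_of)
  have gen_W: "gen t \<subseteq> sets W" if "t \<le> T" for t
    using that Bm by (auto simp: gen_def intro!: measurable_sets)
  have G_W: "sets (G t) \<subseteq> sets W" if "t \<le> T" for t
    unfolding sets_G by (rule sets.sigma_sets_subset[OF gen_W[OF that]])
  let ?F = "augmented_filtration ?P B"
  have N_Pow: "sets (G t) \<union> null_sets ?P \<subseteq> Pow (space W)" for t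
    using sets.space_closed[of "G t"] sets.space_closed[of ?P] by (auto simp: space_G null_sets_def)
  have sets_F: "sets (?F t) = sigma_sets (space W) (sets (G t) \<union> null_sets ?P)" and space_F: "space (?F t) = space W" for t
    using N_Pow[of t] by (simp_all add: augmented_filtration_def G_P sets_measure_of space_measure_of)
  have F_P: "sets (?F t) \<subseteq> sets ?P" if "t \<le> T" for t
  proof -
    have "sets (G t) \<union> null_sets ?P \<subseteq> sets ?P" using G_W[OF that] by auto
    from sets.sigma_sets_subset[OF this] show ?thesis by (simp add: sets_F)
  qed
  show ?thesis
  proof
    show "T > 0" by (rule T)
    show "subalgebra ?P (?F t)" if "0 \<le> t" "t \<le> T" for t
      using F_P[OF that(2)] by (simp add: subalgebra_def space_F)
    show "sets (?F s) \<subseteq> sets (?F t)" if "0 \<le> s" "s \<le> t" "t \<le> T" for s t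
    proof -
      have "gen s \<subseteq> gen t" unfolding gen_def by (rule UN_mono) (use that in auto)
      then have "sets (G s) \<subseteq> sets (G t)" unfolding sets_G by (rule sigma_sets_mono')
      then show ?thesis unfolding sets_F by (intro sigma_sets_mono') auto
    qed
    show "B t \<in> borel_measurable (?F t)" if "0 \<le> t" "t \<le> T" for t
    proof (rule measurableI)
      fix A :: "real set" assume "A \<in> sets borel"
      then have "B t -` A \<inter> space W \<in> gen t"
        using that unfolding gen_def by (intro UN_I[of t]) auto
      then show "B t -` A \<inter> space (?F t) \<in> sets (?F t)"
        unfolding sets_F space_F sets_G by (intro sigma_sets.Basic) (auto intro: sigma_sets.Basic)
    qed simp
    show "continuous_on {0..T} (\<lambda>t. B t \<omega>)" if "\<omega> \<in> space ?P" for \<omega> using that cont by simp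
    fix s t assume st: "0 \<le> s" "s < t" "t \<le> T"
    let ?D = "\<lambda>\<omega>. B t \<omega> - B s \<omega>"
    show "distributed ?P lborel ?D (normal_density 0 (sqrt (t - s)))"
      by (rule distributed_completion[OF incr[OF st]])
    have D: "?D \<in> borel_measurable W" using Bm[of s] Bm[of t] st by simp
    have V: "sets (vimage_algebra (space W) ?D borel) \<subseteq> sets W"
      using measurable_sets[OF D] by (auto simp: sets_vimage_algebra2)
    have sT: "s \<le> T" using st by simp
    have "P.prob (a \<inter> c) = P.prob a * P.prob c" if a: "a \<in> sets (?F s)" and c: "c \<in> sets (vimage_algebra (space W) ?D borel)" for a c
    proof -
      have "a \<in> sigma_sets (space ?P) (sets (G s) \<union> null_sets ?P)" using a by (simp add: sets_F)
      then obtain a' where a': "a' \<in> sets (G s)" and ae: "AE \<omega> in ?P. \<omega> \<in> a \<longleftrightarrow> \<omega> \<in> a'"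
        using sigma_null_sets_modification[of "G s" ?P a] G_W[OF sT] by (auto simp: space_G)
      have a'W: "a' \<in> sets W" and cW: "c \<in> sets W" and aP: "a \<in> sets ?P"
        using a' G_W[OF sT] c V a F_P[OF sT] by auto
      have "P.prob a = P.prob a'" by (rule P.finite_measure_eq_AE[OF ae]) (use aP a'W in auto)
      moreover have "P.prob (a \<inter> c) = P.prob (a' \<inter> c)"
        by (rule P.finite_measure_eq_AE) (use ae aP a'W cW in auto)
      moreover have "W.prob (a' \<inter> c) = W.prob a' * W.prob c"
        using indep[OF st] a' c by (intro W.indep_setD) (simp_all add: G_def)
      ultimately show ?thesis using a'W cW by simp
    qed
    then show "P.indep_set (sets (?F s)) (sets (vimage_algebra (space ?P) ?D borel))"
      using F_P[OF sT] V by (intro P.indep_setI) auto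
  qed
qed

section \<open>The mean variance problem on Wiener space\<close>

lemma is_ess_sup_cong_AE:
  assumes "is_ess_sup M \<Xi> V" "V' \<in> borel_measurable M" "AE \<omega> in M. V \<omega> = V' \<omega>"
  shows "is_ess_sup M \<Xi> V'"
  unfolding is_ess_sup_def
proof (intro conjI ballI impI)
  show "V' \<in> borel_measurable M" by fact
  show "AE \<omega> in M. \<xi> \<omega> \<le> V' \<omega>" if "\<xi> \<in> \<Xi>" for \<xi>
  proof -
    have "AE \<omega> in M. \<xi> \<omega> \<le> V \<omega>" using assms(1) that by (simp add: is_ess_sup_def)
    then show ?thesis using assms(3) by eventually_elim simp
  qed
  show "AE \<omega> in M. V' \<omega> \<le> W \<omega>" if "W \<in> borel_measurable M" "\<forall>\<xi>\<in>\<Xi>. AE \<omega> in M. \<xi> \<omega> \<le> W \<omega>" for W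
  proof -
    have "AE \<omega> in M. V \<omega> \<le> W \<omega>" using assms(1) that by (simp add: is_ess_sup_def)
    then show ?thesis using assms(3) by eventually_elim simp
  qed
qed

lemma AE_continuous_eq:
  fixes X Y :: "real \<Rightarrow> 'a \<Rightarrow> real"
  assumes T: "T > 0"
    and X: "AE \<omega> in M. continuous_on {0..T} (\<lambda>t. X t \<omega>)" and Y: "AE \<omega> in M. continuous_on {0..T} (\<lambda>t. Y t \<omega>)"
    and eq: "\<And>t. t \<in> {0..T} \<Longrightarrow> AE \<omega> in M. X t \<omega> = Y t \<omega>"
  shows "AE \<omega> in M. \<forall>t\<in>{0..T}. X t \<omega> = Y t \<omega>"
proof -
  have "AE \<omega> in M. \<forall>t\<in>{0<..<T} \<inter> \<rat>. X t \<omega> = Y t \<omega>"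
    by (subst AE_ball_countable) (auto intro!: eq countable_Int2 countable_rat)
  then show ?thesis using X Y
  proof eventually_elim
    case (elim \<omega>)
    have cl: "closure ({0<..<T} \<inter> \<rat>) = {0..T}"
      using closure_open_Int_superset[of "{0<..<T}" \<rat>] T by (simp add: Rats_closure_real)
    show ?case
    proof
      fix t assume "t \<in> {0..T}"
      have "X t \<omega> - Y t \<omega> = 0"
      proof (rule continuous_constant_on_closure[where S="{0<..<T} \<inter> \<rat>" and f="\<lambda>t. X t \<omega> - Y t \<omega>"])
        show "continuous_on (closure ({0<..<T} \<inter> \<rat>)) (\<lambda>t. X t \<omega> - Y t \<omega>)"
          unfolding cl using elim by (intro continuous_on_diff)
        show "t \<in> closure ({0<..<T} \<inter> \<rat>)" unfolding cl by fact
      qed (use elim in auto)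
      then show "X t \<omega> = Y t \<omega>" by simp
    qed
  qed
qed

lemma (in pair_sigma_finite) AE_pair_swap:
  assumes "AE x in M1 \<Otimes>\<^sub>M M2. Q x"
  shows "AE (y, x) in M2 \<Otimes>\<^sub>M M1. Q (x, y)"
proof -
  have "AE x in distr (M2 \<Otimes>\<^sub>M M1) (M1 \<Otimes>\<^sub>M M2) (\<lambda>(x, y). (y, x)). Q x"
    using assms by (subst (asm) distr_pair_swap)
  from AE_distrD[OF measurable_pair_swap' this] show ?thesis by (simp add: split_beta')
qed

lemma (in pair_sigma_finite) AE_pair_fst:
  assumes "AE x in M1. R x"
  shows "AE z in M1 \<Otimes>\<^sub>M M2. R (fst z)"
proof -
  from assms obtain N where N: "{x \<in> space M1. \<not> R x} \<subseteq> N" "N \<in> null_sets M1"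
    by (auto simp: eventually_ae_filter)
  have "AE z in M1 \<Otimes>\<^sub>M M2. fst z \<notin> N"
  proof (rule AE_pair_measure)
    have "{z \<in> space (M1 \<Otimes>\<^sub>M M2). fst z \<notin> N} = (space M1 - N) \<times> space M2"
      by (auto simp: space_pair_measure)
    then show "{z \<in> space (M1 \<Otimes>\<^sub>M M2). fst z \<notin> N} \<in> sets (M1 \<Otimes>\<^sub>M M2)"
      using N(2) by (auto intro!: pair_measureI)
    show "AE x in M1. AE y in M2. fst (x, y) \<notin> N" using AE_not_in[OF N(2)] by eventually_elim simp
  qed
  then show ?thesis using AE_space by eventually_elim (use N(1) in \<open>auto simp: space_pair_measure\<close>)
qed

context brownian_filtration
begin

definition opt_state :: "real \<Rightarrow> real \<Rightarrow> real \<Rightarrow> 'a \<Rightarrow> real" where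
  "opt_state x0 lam t \<omega> = x0 + exp T / lam * (1 - exp (- t) * zeta 0 t \<omega>)"

lemma opt_state_continuous:
  assumes "\<omega> \<in> space M"
  shows "continuous_on {0..T} (\<lambda>t. opt_state x0 lam t \<omega>)"
  unfolding opt_state_def zeta_def
  by (intro continuous_intros continuous_paths[OF assms]) auto

lemma opt_state_F:
  assumes "0 \<le> t" "t \<le> T"
  shows "opt_state x0 lam t \<in> borel_measurable (F t)"
proof -
  have [measurable]: "zeta 0 t \<in> borel_measurable (F t)" by (rule zeta_F) (use assms in auto)
  show ?thesis unfolding opt_state_def[abs_def] by measurable
qed

lemma opt_state_gain:
  assumes "0 \<le> t" "t \<le> T"
  shows "AE \<omega> in M. opt_state x0 lam t \<omega> = x0 + gain (opt (exp T / lam)) t \<omega>"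
  using opt_gain[OF assms, of "exp T / lam"] by eventually_elim (simp add: opt_state_def gain_def)

lemma opt_state_less: "lam > 0 \<Longrightarrow> opt_state x0 lam t \<omega> - x0 < 1 / lam * exp T"
  using zeta_pos[of 0 t \<omega>] by (simp add: opt_state_def algebra_simps)

lemma opt_feedback: "opt (exp T / lam) t \<omega> = - opt_state x0 lam t \<omega> + x0 + 1 / lam * exp T"
  by (simp add: opt_def opt_state_def algebra_simps)

text \<open>
  This is the weight with which \<open>Lambda (X - E\<^sub>t X) = 1 - zeta t T\<close> holds for the terminal state
  \<open>X = x0 + (exp T - zeta 0 T) / lam\<close>.
\<close>

lemma Lambda_opt_state:
  assumes "lam > 0" "x t = opt_state x0 lam t \<omega>" "x 0 = opt_state x0 lam 0 \<omega>"
  shows "Lambda T lam t x = lam / zeta 0 t \<omega>"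
proof -
  have "exp T - lam * (x t - x 0) = exp (T - t) * zeta 0 t \<omega>"
    unfolding assms(2,3) opt_state_def zeta_refl using assms(1) by (simp add: exp_diff exp_minus field_simps)
  then show ?thesis by (simp add: Lambda_def)
qed

definition dyn_value :: "real \<Rightarrow> real \<Rightarrow> real \<Rightarrow> 'a \<Rightarrow> real" where
  "dyn_value x0 lam t \<omega> = 1 / 2 * (1 + exp (t - T)) * opt_state x0 lam t \<omega> + 1 / 2 * (1 - exp (t - T)) * x0
     + exp T / (2 * lam) * (1 - exp (t - T))"

text \<open>
  The first identity is the upper bound at the weight \<open>Lambda\<close>, the second one the objective of the
  optimal control: both equal the asserted value.
\<close>

lemma dyn_value_eq:
  assumes "lam > 0"
  shows "opt_state x0 lam t \<omega> + (exp (T - t) - 1) / (2 * (lam / zeta 0 t \<omega>)) = dyn_value x0 lam t \<omega>"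
    and "x0 + exp T / lam - 1 / lam * zeta 0 t \<omega> - 1 / 2 * (lam / zeta 0 t \<omega>) * ((1 / lam)\<^sup>2 * (zeta 0 t \<omega>)\<^sup>2 * (exp (T - t) - 1))
      = dyn_value x0 lam t \<omega>"
proof -
  define z where "z = zeta 0 t \<omega>"
  define e where "e = exp (T - t)"
  have z: "z > 0" and e: "e > 0" by (simp_all add: z_def e_def zeta_pos)
  have X: "opt_state x0 lam t \<omega> = x0 + exp T / lam - e * z / lam"
    by (simp add: opt_state_def e_def z_def exp_diff exp_minus algebra_simps divide_inverse)
  have i: "exp (t - T) = 1 / e" by (simp add: e_def exp_diff)
  have V: "dyn_value x0 lam t \<omega> = x0 + exp T / lam - (e + 1) * z / (2 * lam)"
    unfolding dyn_value_def X i using e assms by (simp add: field_simps)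
  show "opt_state x0 lam t \<omega> + (exp (T - t) - 1) / (2 * (lam / zeta 0 t \<omega>)) = dyn_value x0 lam t \<omega>"
    unfolding V X e_def[symmetric] z_def[symmetric] using assms z by (simp add: field_simps)
  show "x0 + exp T / lam - 1 / lam * zeta 0 t \<omega> - 1 / 2 * (lam / zeta 0 t \<omega>) * ((1 / lam)\<^sup>2 * (zeta 0 t \<omega>)\<^sup>2 * (exp (T - t) - 1))
      = dyn_value x0 lam t \<omega>"
    unfolding V e_def[symmetric] z_def[symmetric] using assms z by (simp add: field_simps power2_eq_square)
qed

end

theorem theorem7p3:
  fixes T lam x0 :: real and P :: "(real \<Rightarrow> real) measure"
  assumes "T > 0" and "lam > 0" and "wiener_measure T P"
  shows "(\<exists>\<alpha> X. mv_optimal P T lam x0 \<alpha> \<and> trajectory P T x0 \<alpha> X) \<and>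
    (\<forall>\<alpha> X. mv_optimal P T lam x0 \<alpha> \<and> trajectory P T x0 \<alpha> X \<longrightarrow>
       (AE \<omega> in P. (SUP t\<in>{0..T}. X t \<omega> - x0) < 1 / lam * exp T) \<and>
       time_consistent P T lam x0 \<alpha> X \<and>
       (AE (t, \<omega>) in lborel \<Otimes>\<^sub>M P. t \<in> {0..T} \<longrightarrow> \<alpha> t \<omega> = - X t \<omega> + x0 + 1 / lam * exp T) \<and>
       (\<forall>t\<in>{0..T}. is_dyn_value P T lam x0 \<alpha> X t
          (\<lambda>\<omega>. 1 / 2 * (1 + exp (t - T)) * X t \<omega> + 1 / 2 * (1 - exp (t - T)) * x0
                + exp T / (2 * lam) * (1 - exp (t - T))))) \<and>
    mv_value P T lam x0 =
      ereal (1 / 2 * (1 + exp (0 - T)) * x0 + 1 / 2 * (1 - exp (0 - T)) * x0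
                + exp T / (2 * lam) * (1 - exp (0 - T)))"
proof -
  note T = assms(1) and lam = assms(2)
  obtain W where W: "brownian_motion W T coord" and P: "P = completion W"
    using assms(3) by (auto simp: wiener_measure_def)
  interpret brownian_filtration P "wiener_filtration P" T coord
    unfolding P by (rule brownian_motion_augmented[OF T W])
  interpret swap: pair_sigma_finite "lborel :: real measure" P ..
  let ?F = "wiener_filtration P" and ?k = "exp T / lam"
  define V0 where "V0 = x0 + (exp T - 1) / (2 * lam)"
  have state: "state P T x0 \<alpha> s = (\<lambda>\<omega>. x0 + gain \<alpha> s \<omega>)" for \<alpha> s
    by (simp add: state_def gain_def drift_eq fun_eq_iff)
  have bound: "mv_objective P T lam x0 \<alpha> \<le> V0" if "\<alpha> \<in> mv_controls P T" for \<alpha>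
    unfolding mv_objective_def state V0_def by (rule mean_variance_bound[OF that lam])
  have opt_obj: "mv_objective P T lam x0 (opt ?k) = V0"
    unfolding mv_objective_def state V0_def by (rule mean_variance_opt[OF lam])
  have value0: "mv_value P T lam x0 = ereal V0"
    unfolding mv_value_def
  proof (rule antisym)
    show "(SUP \<alpha>\<in>mv_controls P T. ereal (mv_objective P T lam x0 \<alpha>)) \<le> ereal V0"
      by (rule SUP_least) (simp add: bound)
    show "ereal V0 \<le> (SUP \<alpha>\<in>mv_controls P T. ereal (mv_objective P T lam x0 \<alpha>))"
      by (rule SUP_upper2[OF opt_controls[of ?k]]) (simp add: opt_obj)
  qed
  have "mv_optimal P T lam x0 (opt ?k)"
    unfolding mv_optimal_def value0 opt_obj using opt_controls by simp
  moreover have "trajectory P T x0 (opt ?k) (opt_state x0 lam)"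
    unfolding trajectory_def state
    using opt_state_continuous opt_state_F opt_state_gain by (auto intro!: AE_I2)
  ultimately have existence: "\<exists>\<alpha> X. mv_optimal P T lam x0 \<alpha> \<and> trajectory P T x0 \<alpha> X" by blast

  have universal: "(AE \<omega> in P. (SUP t\<in>{0..T}. X t \<omega> - x0) < 1 / lam * exp T) \<and>
       time_consistent P T lam x0 \<alpha> X \<and>
       (AE (t, \<omega>) in lborel \<Otimes>\<^sub>M P. t \<in> {0..T} \<longrightarrow> \<alpha> t \<omega> = - X t \<omega> + x0 + 1 / lam * exp T) \<and>
       (\<forall>t\<in>{0..T}. is_dyn_value P T lam x0 \<alpha> X t
          (\<lambda>\<omega>. 1 / 2 * (1 + exp (t - T)) * X t \<omega> + 1 / 2 * (1 - exp (t - T)) * x0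
                + exp T / (2 * lam) * (1 - exp (t - T))))"
    if opt: "mv_optimal P T lam x0 \<alpha>" and traj: "trajectory P T x0 \<alpha> X" for \<alpha> X
  proof -
    have \<alpha>: "\<alpha> \<in> mv_controls P T" and \<alpha>obj: "mv_objective P T lam x0 \<alpha> = V0"
      using opt by (auto simp: mv_optimal_def value0)
    have X_cont: "AE \<omega> in P. continuous_on {0..T} (\<lambda>t. X t \<omega>)"
      and X_F: "\<And>t. t \<in> {0..T} \<Longrightarrow> X t \<in> borel_measurable (?F t)"
      and X_gain: "\<And>t. t \<in> {0..T} \<Longrightarrow> AE \<omega> in P. X t \<omega> = x0 + gain \<alpha> t \<omega>"
      using traj by (auto simp: trajectory_def state)
    have terminal: "AE \<omega> in P. gain \<alpha> T \<omega> = (exp T - zeta 0 T \<omega>) / lam"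
      by (rule mean_variance_optimal_terminal[OF \<alpha> lam, of x0])
        (use \<alpha>obj in \<open>simp add: mv_objective_def state V0_def\<close>)
    have "AE \<omega> in P. gain \<alpha> T \<omega> = gain (opt ?k) T \<omega>"
      using terminal opt_terminal[OF lam] by eventually_elim simp
    from control_unique[OF \<alpha> opt_controls this]
    have \<alpha>_opt: "AE x in PM. cut {0..T} \<alpha> x = cut {0..T} (opt ?k) x" .
    have X_opt: "AE \<omega> in P. X t \<omega> = opt_state x0 lam t \<omega>" if t: "t \<in> {0..T}" for t
    proof -
      have tT: "0 \<le> t" "t \<le> T" using t by auto
      have "AE x in PM. cut {0..t} \<alpha> x = cut {0..t} (opt ?k) x"
        using \<alpha>_opt by eventually_elim (simp add: cut_restrict[OF tT(2)])
      from gain_cong_AE[OF \<alpha> opt_controls tT this] show ?thesis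
        using X_gain[OF t] opt_state_gain[OF tT, of x0 lam] by eventually_elim simp
    qed
    \<comment> \<open>The supremum over \<open>t\<close> and the joint null set in \<open>(t, \<omega>)\<close> require equality at all times at once.\<close>
    have X_path: "AE \<omega> in P. \<forall>t\<in>{0..T}. X t \<omega> = opt_state x0 lam t \<omega>"
      by (rule AE_continuous_eq[OF T X_cont _ X_opt]) (auto intro!: AE_I2 opt_state_continuous)

    have sup: "AE \<omega> in P. (SUP t\<in>{0..T}. X t \<omega> - x0) < 1 / lam * exp T"
      using X_path X_cont
    proof eventually_elim
      case (elim \<omega>)
      have "continuous_on {0..T} (\<lambda>t. X t \<omega> - x0)" using elim(2) by (intro continuous_intros)
      then obtain s where s: "s \<in> {0..T}" "\<And>t. t \<in> {0..T} \<Longrightarrow> X t \<omega> - x0 \<le> X s \<omega> - x0"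
        using continuous_attains_sup[of "{0..T}" "\<lambda>t. X t \<omega> - x0"] T by auto
      have "(SUP t\<in>{0..T}. X t \<omega> - x0) \<le> X s \<omega> - x0"
        by (rule cSUP_least) (use s T in auto)
      also have "\<dots> < 1 / lam * exp T"
        using elim(1) s(1) opt_state_less[OF lam, of x0 s \<omega>] by simp
      finally show ?case .
    qed

    have feedback: "AE (t, \<omega>) in lborel \<Otimes>\<^sub>M P. t \<in> {0..T} \<longrightarrow> \<alpha> t \<omega> = - X t \<omega> + x0 + 1 / lam * exp T"
    proof -
      have "AE x in PM. snd x \<in> {0..T} \<longrightarrow> \<alpha> (snd x) (fst x) = - X (snd x) (fst x) + x0 + 1 / lam * exp T"
        using \<alpha>_opt P.AE_pair_fst[OF X_path]
      proof eventually_elim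
        case (elim x)
        show ?case
        proof
          assume t: "snd x \<in> {0..T}"
          then have "\<alpha> (snd x) (fst x) = opt ?k (snd x) (fst x)" using elim(1) by (simp add: cut_def)
          then show "\<alpha> (snd x) (fst x) = - X (snd x) (fst x) + x0 + 1 / lam * exp T"
            using elim(2) t opt_feedback[of lam "snd x" "fst x" x0] by simp
        qed
      qed
      from P.AE_pair_swap[OF this] show ?thesis by simp
    qed

    have dyn: "is_dyn_value P T lam x0 \<alpha> X t (dyn_value x0 lam t) \<and>
        (AE \<omega> in P. dyn_objective P T lam x0 X t \<alpha> \<omega> = dyn_value x0 lam t \<omega>) \<and>
        dyn_objective P T lam x0 X t \<alpha> \<in> borel_measurable P \<and> \<alpha> \<in> dyn_controls P T \<alpha> t" if t: "t \<in> {0..T}" for t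
    proof -
      have tT: "0 \<le> t" "t \<le> T" and "0 \<in> {0..T}" using t T by auto
      have X_M: "X s \<in> borel_measurable P" if "s \<in> {0..T}" for s
        by (rule F_imp_M[OF X_F[OF that]]) (use that in auto)
      have [measurable]: "X t \<in> borel_measurable P" "X 0 \<in> borel_measurable P"
        using X_M[OF t] X_M[OF \<open>0 \<in> {0..T}\<close>] by auto
      have Lam: "AE \<omega> in P. Lambda T lam t (\<lambda>s. X s \<omega>) = lam / zeta 0 t \<omega>"
        using X_opt[OF t] X_opt[OF \<open>0 \<in> {0..T}\<close>] by eventually_elim (rule Lambda_opt_state[OF lam])
      have Vm: "dyn_value x0 lam t \<in> borel_measurable P"
      proof -
        have [measurable]: "opt_state x0 lam t \<in> borel_measurable P" by (rule F_imp_M[OF opt_state_F[OF tT] tT])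
        show ?thesis unfolding dyn_value_def[abs_def] by measurable
      qed
      have upper: "AE \<omega> in P. dyn_objective P T lam x0 X t \<beta> \<omega> \<le> dyn_value x0 lam t \<omega>"
        if \<beta>: "\<beta> \<in> dyn_controls P T \<alpha> t" for \<beta>
      proof -
        have \<beta>c: "\<beta> \<in> mv_controls P T" and agree: "AE (s, \<omega>) in lborel \<Otimes>\<^sub>M P. s \<in> {0..t} \<longrightarrow> \<beta> s \<omega> = \<alpha> s \<omega>"
          using \<beta> by (auto simp: dyn_controls_def)
        have "AE x in PM. cut {0..t} \<beta> x = cut {0..t} \<alpha> x"
          using swap.AE_pair_swap[OF agree] by eventually_elim (auto simp: cut_def indicator_def)
        from gain_cong_AE[OF \<beta>c \<alpha> tT this] X_gain[OF t]
        have "AE \<omega> in P. X t \<omega> = x0 + gain \<beta> t \<omega>" by eventually_elim simp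
        from conditional_mean_variance_bound[OF \<beta>c tT X_F[OF t] this] Lam X_opt[OF t]
        show ?thesis
        proof eventually_elim
          case (elim \<omega>)
          have "0 < lam / zeta 0 t \<omega>" using lam zeta_pos by simp
          then show ?case
            using elim(1)[rule_format, of "lam / zeta 0 t \<omega>"] elim(2,3) dyn_value_eq(1)[OF lam, of x0 t \<omega>]
            by (simp only: dyn_objective_def state)
        qed
      qed
      have XT: "(\<lambda>\<omega>. x0 + gain \<alpha> T \<omega>) \<in> borel_measurable P"
        using sq_integrable_measurable[OF gain_sq_integrable[OF \<alpha>]] T by simp
      have "AE \<omega> in P. x0 + gain \<alpha> T \<omega> = (x0 + ?k) - 1 / lam * zeta 0 T \<omega>"
        using terminal by eventually_elim (simp add: diff_divide_distrib)
      note moments = conditional_moments_affine[OF tT XT this]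
      have attained: "AE \<omega> in P. dyn_objective P T lam x0 X t \<alpha> \<omega> = dyn_value x0 lam t \<omega>"
        using moments Lam
      proof eventually_elim
        case (elim \<omega>)
        show ?case unfolding dyn_objective_def state elim by (rule dyn_value_eq(2)[OF lam])
      qed
      have obj_m: "dyn_objective P T lam x0 X t \<alpha> \<in> borel_measurable P"
        unfolding dyn_objective_def[abs_def] Lambda_def cond_var_def by measurable
      have self: "\<alpha> \<in> dyn_controls P T \<alpha> t" using \<alpha> by (simp add: dyn_controls_def)
      have "is_dyn_value P T lam x0 \<alpha> X t (dyn_value x0 lam t)"
        unfolding is_dyn_value_def is_ess_sup_def
      proof (intro conjI ballI impI)
        show "AE \<omega> in P. dyn_value x0 lam t \<omega> \<le> U \<omega>"
          if "\<forall>\<xi>\<in>dyn_objective P T lam x0 X t ` dyn_controls P T \<alpha> t. AE \<omega> in P. \<xi> \<omega> \<le> U \<omega>" for U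
        proof -
          have "AE \<omega> in P. dyn_objective P T lam x0 X t \<alpha> \<omega> \<le> U \<omega>" using that self by auto
          then show ?thesis using attained by eventually_elim simp
        qed
      qed (use Vm upper in auto)
      then show ?thesis using attained obj_m self by blast
    qed
    have "time_consistent P T lam x0 \<alpha> X"
      unfolding time_consistent_def dyn_optimal_def
    proof
      fix t assume t: "t \<in> {0..T}"
      note d = dyn[OF t]
      have "is_dyn_value P T lam x0 \<alpha> X t (dyn_objective P T lam x0 X t \<alpha>)"
        unfolding is_dyn_value_def
      proof (rule is_ess_sup_cong_AE)
        show "is_ess_sup P (dyn_objective P T lam x0 X t ` dyn_controls P T \<alpha> t) (dyn_value x0 lam t)"
          using d by (simp add: is_dyn_value_def)
        show "dyn_objective P T lam x0 X t \<alpha> \<in> borel_measurable P" using d by blast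
        show "AE \<omega> in P. dyn_value x0 lam t \<omega> = dyn_objective P T lam x0 X t \<alpha> \<omega>"
          using d by (auto elim!: eventually_mono)
      qed
      then show "\<alpha> \<in> dyn_controls P T \<alpha> t \<and> is_dyn_value P T lam x0 \<alpha> X t (dyn_objective P T lam x0 X t \<alpha>)"
        using d by blast
    qed
    moreover have "is_dyn_value P T lam x0 \<alpha> X t
          (\<lambda>\<omega>. 1 / 2 * (1 + exp (t - T)) * X t \<omega> + 1 / 2 * (1 - exp (t - T)) * x0
                + exp T / (2 * lam) * (1 - exp (t - T)))" if t: "t \<in> {0..T}" for t
      unfolding is_dyn_value_def
    proof (rule is_ess_sup_cong_AE)
      show "is_ess_sup P (dyn_objective P T lam x0 X t ` dyn_controls P T \<alpha> t) (dyn_value x0 lam t)"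
        using dyn[OF t] by (simp add: is_dyn_value_def)
      have [measurable]: "X t \<in> borel_measurable P" by (rule F_imp_M[OF X_F[OF t]]) (use t in auto)
      show "(\<lambda>\<omega>. 1 / 2 * (1 + exp (t - T)) * X t \<omega> + 1 / 2 * (1 - exp (t - T)) * x0
                + exp T / (2 * lam) * (1 - exp (t - T))) \<in> borel_measurable P" by measurable
      show "AE \<omega> in P. dyn_value x0 lam t \<omega> = 1 / 2 * (1 + exp (t - T)) * X t \<omega> + 1 / 2 * (1 - exp (t - T)) * x0
                + exp T / (2 * lam) * (1 - exp (t - T))"
        using X_opt[OF t] by eventually_elim (simp only: dyn_value_def)
    qed
    ultimately show ?thesis using sup feedback by blast
  qed
  have "V0 = 1 / 2 * (1 + exp (0 - T)) * x0 + 1 / 2 * (1 - exp (0 - T)) * x0 + exp T / (2 * lam) * (1 - exp (0 - T))"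
    using lam by (simp add: V0_def field_simps mult_exp_exp)
  then show ?thesis using existence universal value0 by blast
qed

end
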